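(* Let $1\le p\le q$ be integers, $d=p+q$, and let $\Sigma\in\mathbb{S}^d_{>}$ have upper left $p\times p$ diagonal block $\Sigma_1$ and lower right $q\times q$ diagonal block $\Sigma_2$. Assume that $\Sigma_1$ has $p$ distinct eigenvalues and $\Sigma_2$ has $q$ distinct eigenvalues. Let $H_t\in\mathbb{S}^d$ for $t>0$ and $H\in\mathbb{S}^d$ be such that $H_t\to H$ element-wise as $t\downarrow0$. Then $$\lim_{t\downarrow0}t^{-1}\bigl(\mathfrak{D}_2(\Sigma+tH_t)-\mathfrak{D}_2(\Sigma)\bigr)=\operatorname{tr}(M_2H)$$ where $$M_2=\frac1{c_2}\Bigl(-\tfrac12(J_0+J^{-1})+(1-\mathfrak{D}_2(\Sigma))I_d+\mathfrak{D}_2(\Sigma)\Upsilon_2\Bigr),$$ $$c_2=\operatorname{tr}(\Sigma)-\operatorname{tr}\bigl((\Sigma_0^{1/2}\Sigma_m\Sigma_0^{1/2})^{1/2}\bigr),\qquad \Upsilon_2=\begin{bmatrix}U_1\Delta_1'U_1^\top & 0 \\ 0 & U_2\Delta_2'U_2^\top\end{bmatrix},$$ where $\Sigma_0,\Sigma_m,U_1,U_2,\Delta_1',\Delta_2',J,J_0$ are as defined in the context.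
   Context: $\mathbb{S}^m$, $\mathbb{S}^m_\ge$, $\mathbb{S}^m_>$ are the sets of real symmetric, symmetric positive semi-definite and symmetric positive definite $m\times m$ matrices. Eigendecompositions: $\Sigma_j=U_j\Lambda_jU_j^\top$, $j\in\{1,2\}$, with $U_j$ orthogonal and $\Lambda_j$ diagonal containing the eigenvalues of $\Sigma_j$ in decreasing order. $\Sigma_0=\begin{bmatrix}\Sigma_1 & 0 \\ 0 & \Sigma_2\end{bmatrix}$. $\Sigma_m=\begin{bmatrix}\Sigma_1 & \Psi_m \\ \Psi_m^\top & \Sigma_2\end{bmatrix}$ with $\Psi_m=U_1\Lambda_1^{1/2}\Pi\Lambda_2^{1/2}U_2^\top$, where $\Pi\in\mathbb{R}^{p\times q}$ is the $p\times q$ upper left block of $I_d$. Since $q\ge p$, partition $\Lambda_2=\begin{bmatrix}\Lambda_{2,1} & 0 \\ 0 & \Lambda_{2,2}\end{bmatrix}$ with $\Lambda_{2,1}$ of size $p\times p$ (first $p$ eigenvalues) and $\Lambda_{2,2}$ of size $(q-p)\times(q-p)$ (empty if $q=p$). Put $\Delta_1'=(\Lambda_1^2+\Lambda_{2,1}^2)^{-1/2}\Lambda_1$ and $\Delta_2'=\begin{bmatrix}(\Lambda_1^2+\Lambda_{2,1}^2)^{-1/2}\Lambda_{2,1} & 0 \\ 0 & I_{q-p}\end{bmatrix}$ (second block empty if $q=p$). Put $J=\Sigma_0^{-1/2}(\Sigma_0^{1/2}\Sigma\Sigma_0^{1/2})^{1/2}\Sigma_0^{-1/2}=\begin{bmatrix}J_{11}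 & J_{12} \\ J_{21} & J_{22}\end{bmatrix}$ with diagonal blocks of sizes $p\times p$ and $q\times q$, and $J_0=\begin{bmatrix}J_{11} & 0 \\ 0 & J_{22}\end{bmatrix}$. The coefficient $\mathfrak{D}_2$: let $d_W^2(A,B)=\operatorname{tr}(A)+\operatorname{tr}(B)-2\operatorname{tr}\bigl((A^{1/2}BA^{1/2})^{1/2}\bigr)$ for positive semi-definite $A,B$ of the same size, and let $\Gamma(\Sigma_1,\Sigma_2)$ be the set of all matrices in $\mathbb{S}^d_\ge$ with diagonal blocks $\Sigma_1$ ($p\times p$) and $\Sigma_2$ ($q\times q$). For $\Sigma\in\mathbb{S}^d_\ge$ with non-zero diagonal blocks $\Sigma_1,\Sigma_2$, $\mathfrak{D}_2(\Sigma)=d_W^2(\Sigma,\Sigma_0)/\sup_{\tilde\Sigma\in\Gamma(\Sigma_1,\Sigma_2)}d_W^2(\tilde\Sigma,\Sigma_0)$. For $t>0$ sufficiently small, $\Sigma+tH_t$ is positive definite, so $\mathfrak{D}_2(\Sigma+tH_t)$ is well defined. *)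

theory Defs
  imports
    Complex_Main
    "Jordan_Normal_Form.Matrix"
    "Jordan_Normal_Form.Gauss_Jordan_Elimination"
    "Jordan_Normal_Form.Spectral_Radius"
begin

definition sym_mats :: "nat \<Rightarrow> real mat set" where
  "sym_mats m = {A \<in> carrier_mat m m. transpose_mat A = A}"

definition psd_mats :: "nat \<Rightarrow> real mat set" where
  "psd_mats m = {A \<in> sym_mats m. \<forall>v \<in> carrier_vec m. 0 \<le> v \<bullet> (A *\<^sub>v v)}"

definition pd_mats :: "nat \<Rightarrow> real mat set" where
  "pd_mats m = {A \<in> sym_mats m. \<forall>v \<in> carrier_vec m. v \<noteq> 0\<^sub>v m \<longrightarrow> 0 < v \<bullet> (A *\<^sub>v v)}"

definition mat_trace :: "real mat \<Rightarrow> real" where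
  "mat_trace A = (\<Sum>i<dim_row A. A $$ (i, i))"

text \<open>The principal square root; unspecified unless the argument is positive semi-definite.\<close>

definition psd_sqrt :: "real mat \<Rightarrow> real mat" where
  "psd_sqrt A = (THE B. B \<in> psd_mats (dim_row A) \<and> B * B = A)"

text \<open>Unspecified unless the argument is square and invertible.\<close>

definition mat_inv :: "real mat \<Rightarrow> real mat" where
  "mat_inv A = the (mat_inverse A)"

definition upper_left :: "nat \<Rightarrow> nat \<Rightarrow> real mat \<Rightarrow> real mat" where
  "upper_left r c A = (case split_block A r c of (A11, A12, A21, A22) \<Rightarrow> A11)"

definition lower_right :: "nat \<Rightarrow> nat \<Rightarrow> real mat \<Rightarrow> real mat" where
  "lower_right r c A = (case split_block A r c of (A11, A12, A21, A22) \<Rightarrow> A22)"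

text \<open>A matrix \<open>\<Sigma>\<close> of size \<open>p + q\<close> with its off-diagonal blocks replaced by zero; yields
  \<open>\<Sigma>\<^sub>0\<close> from \<open>\<Sigma>\<close> and \<open>J\<^sub>0\<close> from \<open>J\<close>.\<close>

definition diag_part :: "nat \<Rightarrow> real mat \<Rightarrow> real mat" where
  "diag_part p A = diag_block_mat [upper_left p p A, lower_right p p A]"

text \<open>\<open>A = U L U\<^sup>T\<close> with the eigenvalues in weakly decreasing order along \<open>L\<close>. The constant
  \<^const>\<open>orthogonal_mat\<close> is not used because it does not require the columns to have length 1.\<close>

definition eigendecomposition :: "nat \<Rightarrow> real mat \<Rightarrow> real mat \<Rightarrow> real mat \<Rightarrow> bool" where
  "eigendecomposition m A U L \<longleftrightarrow>
     U \<in> carrier_mat m m \<and> transpose_mat U * U = 1\<^sub>m m \<and> U * transpose_mat U = 1\<^sub>m m \<and>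
     L \<in> carrier_mat m m \<and> diagonal_mat L \<and>
     (\<forall>i j. i \<le> j \<and> j < m \<longrightarrow> L $$ (j, j) \<le> L $$ (i, i)) \<and>
     A = U * L * transpose_mat U"

definition dW2 :: "real mat \<Rightarrow> real mat \<Rightarrow> real" where
  "dW2 A B = mat_trace A + mat_trace B - 2 * mat_trace (psd_sqrt (psd_sqrt A * B * psd_sqrt A))"

definition Gamma_set :: "nat \<Rightarrow> nat \<Rightarrow> real mat \<Rightarrow> real mat \<Rightarrow> real mat set" where
  "Gamma_set p q S1 S2 =
     {T \<in> psd_mats (p + q). upper_left p p T = S1 \<and> lower_right p p T = S2}"

text \<open>The supremum is over a non-empty set that is bounded above by twice the trace of \<open>S\<close>
  when \<open>S\<close> is positive semi-definite.\<close>

definition D2_coeff :: "nat \<Rightarrow> nat \<Rightarrow> real mat \<Rightarrow> real" where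
  "D2_coeff p q S =
     dW2 S (diag_part p S) /
     (SUP T \<in> Gamma_set p q (upper_left p p S) (lower_right p p S). dW2 T (diag_part p S))"

text \<open>In what follows \<open>S\<close> is \<open>\<Sigma>\<close>, and \<open>U1\<close>, \<open>L1\<close>, \<open>U2\<close>, \<open>L2\<close> are the factors in the
  eigendecompositions of its diagonal blocks.\<close>

definition Psi_m :: "nat \<Rightarrow> nat \<Rightarrow> real mat \<Rightarrow> real mat \<Rightarrow> real mat \<Rightarrow> real mat \<Rightarrow> real mat" where
  "Psi_m p q U1 L1 U2 L2 =
     U1 * psd_sqrt L1 * upper_left p q (1\<^sub>m (p + q)) * psd_sqrt L2 * transpose_mat U2"

definition Sigma_m ::
  "nat \<Rightarrow> nat \<Rightarrow> real mat \<Rightarrow> real mat \<Rightarrow> real mat \<Rightarrow> real mat \<Rightarrow> real mat \<Rightarrow> real mat" where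
  "Sigma_m p q S U1 L1 U2 L2 =
     four_block_mat
       (upper_left p p S) (Psi_m p q U1 L1 U2 L2)
       (transpose_mat (Psi_m p q U1 L1 U2 L2)) (lower_right p p S)"

definition c2 ::
  "nat \<Rightarrow> nat \<Rightarrow> real mat \<Rightarrow> real mat \<Rightarrow> real mat \<Rightarrow> real mat \<Rightarrow> real mat \<Rightarrow> real" where
  "c2 p q S U1 L1 U2 L2 =
     mat_trace S -
     mat_trace (psd_sqrt
       (psd_sqrt (diag_part p S) * Sigma_m p q S U1 L1 U2 L2 * psd_sqrt (diag_part p S)))"

definition Delta1 :: "nat \<Rightarrow> real mat \<Rightarrow> real mat \<Rightarrow> real mat" where
  "Delta1 p L1 L2 =
     mat_inv (psd_sqrt (L1 * L1 + upper_left p p L2 * upper_left p p L2)) * L1"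

definition Delta2 :: "nat \<Rightarrow> nat \<Rightarrow> real mat \<Rightarrow> real mat \<Rightarrow> real mat" where
  "Delta2 p q L1 L2 =
     diag_block_mat
       [mat_inv (psd_sqrt (L1 * L1 + upper_left p p L2 * upper_left p p L2)) * upper_left p p L2,
        1\<^sub>m (q - p)]"

definition Upsilon2 ::
  "nat \<Rightarrow> nat \<Rightarrow> real mat \<Rightarrow> real mat \<Rightarrow> real mat \<Rightarrow> real mat \<Rightarrow> real mat" where
  "Upsilon2 p q U1 L1 U2 L2 =
     diag_block_mat
       [U1 * Delta1 p L1 L2 * transpose_mat U1, U2 * Delta2 p q L1 L2 * transpose_mat U2]"

definition J_mat :: "nat \<Rightarrow> real mat \<Rightarrow> real mat" where
  "J_mat p S =
     (let R = psd_sqrt (diag_part p S)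
      in mat_inv R * psd_sqrt (R * S * R) * mat_inv R)"

definition M2 ::
  "nat \<Rightarrow> nat \<Rightarrow> real mat \<Rightarrow> real mat \<Rightarrow> real mat \<Rightarrow> real mat \<Rightarrow> real mat \<Rightarrow> real mat" where
  "M2 p q S U1 L1 U2 L2 =
     (1 / c2 p q S U1 L1 U2 L2) \<cdot>\<^sub>m
       ((- 1 / 2) \<cdot>\<^sub>m (diag_part p (J_mat p S) + mat_inv (J_mat p S))
        + (1 - D2_coeff p q S) \<cdot>\<^sub>m 1\<^sub>m (p + q)
        + D2_coeff p q S \<cdot>\<^sub>m Upsilon2 p q U1 L1 U2 L2)"

end

theory Submission
  imports Defs
begin

text \<open>Write \<open>S\<^sub>0\<close> for the block diagonal part of \<open>S\<close>. The fidelity of two positive semi-definite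
  matrices is the trace of \<open>(A\<^sup>1\<^sup>/\<^sup>2 B A\<^sup>1\<^sup>/\<^sup>2)\<^sup>1\<^sup>/\<^sup>2\<close>. Let \<open>F\<close> be the fidelity of \<open>S\<close> and \<open>S\<^sub>0\<close>, and
  \<open>G\<close> the smallest fidelity of \<open>S\<^sub>0\<close> with any coupling of the two diagonal blocks. All
  couplings have the trace of \<open>S\<close>, so the coefficient is \<open>(tr S - F) / (tr S - G)\<close>, and it
  suffices to differentiate \<open>F\<close> and \<open>G\<close>.

  For \<open>F\<close>, the optimal transport map \<open>J\<close> satisfies \<open>J S\<^sub>0 J = S\<close>, which gives \<open>F = tr (S\<^sub>0 J)\<close>
  (\<open>trace_sqrt_transport\<close>). For every positive definite \<open>Z\<close>, expanding the trace of
  \<open>S\<^sub>0 (J - Z) Z\<^sup>-\<^sup>1 (J - Z)\<close> shows \<open>2 F \<le> tr (S Z\<^sup>-\<^sup>1) + tr (S\<^sub>0 Z)\<close>, with equality at \<open>Z = J\<close>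
  (\<open>transport_trace_le\<close>). So \<open>F\<close> is a minimum of functions that are linear in \<open>S\<close>. Testing
  this at \<open>S\<close> with the map of the perturbed matrix, and at the perturbed matrix with the map
  of \<open>S\<close>, encloses the difference quotient between two expressions that converge to
  \<open>tr ((J\<^sub>0 + J\<^sup>-\<^sup>1) H) / 2\<close>. The only analytic input is the continuity of \<open>J\<close>, hence of
  inverses (Cramer's rule) and of square roots (a Lipschitz estimate at positive definite
  matrices, \<open>psd_sqrt_lipschitz\<close>).

  For \<open>G\<close>, let \<open>a\<close> and \<open>b\<close> be the eigenvalues of the diagonal blocks in decreasing order.
  The matrix \<open>T\<^sup>1\<^sup>/\<^sup>2 S\<^sub>0 T\<^sup>1\<^sup>/\<^sup>2\<close> of a coupling \<open>T\<close> is a sum of two Gram matrices, the non-zero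
  eigenvalues of which are the squares of \<open>a\<close> and of \<open>b\<close>. By concavity of the square root
  and a trace inequality for oppositely ordered spectra, the trace of its root is smallest
  when the two spectra are aligned (\<open>trace_sqrt_sum_of_grams\<close>), so \<open>G\<close> is the sum of the
  \<open>sqrt (a\<^sub>k\<^sup>2 + b\<^sub>k\<^sup>2)\<close> and the surplus \<open>b\<^sub>k\<close>; \<open>\<Sigma>\<^sub>m\<close> attains this value. The eigenvalues are
  simple, so they are differentiable with derivative \<open>u\<^sub>k\<^sup>T H u\<^sub>k\<close>
  (\<open>simple_eigenvalue_derivative\<close>), and the chain rule turns the derivative of \<open>G\<close> into
  \<open>tr (\<Upsilon>\<^sub>2 H)\<close>.\<close>

section \<open>Matrix algebra with side conditions on dimensions\<close>

text \<open>With side conditions on \<^const>\<open>dim_row\<close> and \<^const>\<open>dim_col\<close> the ring laws are rewrite rules whose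
  conditions the simplifier evaluates; a \<^const>\<open>carrier_mat\<close> premise would contain dimensions that
  the left-hand side does not determine.\<close>

lemma mult_assoc_dim:
  fixes A B C :: "real mat"
  assumes "dim_col A = dim_row B" "dim_col B = dim_row C"
  shows "A * B * C = A * (B * C)"
  by (rule assoc_mult_mat[of A "dim_row A" "dim_row B" B "dim_row C" C "dim_col C"])
     (use assms in auto)

lemma add_mult_dim:
  fixes A B C :: "real mat"
  assumes "dim_row A = dim_row B" "dim_col A = dim_col B" "dim_col A = dim_row C"
  shows "(A + B) * C = A * C + B * C"
  by (rule add_mult_distrib_mat[of A "dim_row A" "dim_col A" B C "dim_col C"])
     (use assms in auto)

lemma mult_add_dim:
  fixes A B C :: "real mat"
  assumes "dim_row B = dim_row C" "dim_col B = dim_col C" "dim_col A = dim_row B"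
  shows "A * (B + C) = A * B + A * C"
  by (rule mult_add_distrib_mat[of A "dim_row A" "dim_col A" B "dim_col B" C])
     (use assms in auto)

lemma minus_mult_dim:
  fixes A B C :: "real mat"
  assumes "dim_row A = dim_row B" "dim_col A = dim_col B" "dim_col A = dim_row C"
  shows "(A - B) * C = A * C - B * C"
  by (rule minus_mult_distrib_mat[of A "dim_row A" "dim_col A" B C "dim_col C"])
     (use assms in auto)

lemma mult_minus_dim:
  fixes A B C :: "real mat"
  assumes "dim_row B = dim_row C" "dim_col B = dim_col C" "dim_col A = dim_row B"
  shows "A * (B - C) = A * B - A * C"
  by (rule mult_minus_distrib_mat[of A "dim_row A" "dim_col A" B "dim_col B" C])
     (use assms in auto)

lemma smult_mult_dim:
  fixes A B :: "real mat"
  assumes "dim_col A = dim_row B"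
  shows "(c \<cdot>\<^sub>m A) * B = c \<cdot>\<^sub>m (A * B)"
  by (rule mult_smult_assoc_mat[of A "dim_row A" "dim_col A" B "dim_col B"])
     (use assms in auto)

lemma mult_smult_dim:
  fixes A B :: "real mat"
  assumes "dim_col A = dim_row B"
  shows "A * (c \<cdot>\<^sub>m B) = c \<cdot>\<^sub>m (A * B)"
  by (rule mult_smult_distrib[of A "dim_row A" "dim_col A" B "dim_col B"])
     (use assms in auto)

lemma transpose_mult_dim:
  fixes A B :: "real mat"
  assumes "dim_col A = dim_row B"
  shows "transpose_mat (A * B) = B\<^sup>T * A\<^sup>T"
  by (rule transpose_mult[of A "dim_row A" "dim_col A" B "dim_col B"])
     (use assms in auto)

lemma mult_vec_assoc_dim:
  fixes A B :: "real mat"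
  assumes "dim_col A = dim_row B" "dim_col B = dim_vec v"
  shows "(A * B) *\<^sub>v v = A *\<^sub>v (B *\<^sub>v v)"
  by (rule assoc_mult_mat_vec[of A "dim_row A" "dim_row B" B "dim_vec v"])
     (use assms in \<open>auto intro: carrier_matI carrier_vecI\<close>)

lemma one_mult_dim: "dim_row A = n \<Longrightarrow> 1\<^sub>m n * A = (A :: real mat)"
  by auto

lemma mult_one_dim: "dim_col A = n \<Longrightarrow> A * 1\<^sub>m n = (A :: real mat)"
  by auto

lemmas ring_dim = mult_assoc_dim add_mult_dim mult_add_dim minus_mult_dim mult_minus_dim
  smult_mult_dim mult_smult_dim transpose_mult_dim one_mult_dim mult_one_dim

text \<open>Products are normalized to associate to the right, where a pair of inverses is not a
  subterm.\<close>

lemma inverse_cancel_left: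
  fixes A B C :: "real mat"
  assumes "A * B = 1\<^sub>m n" "dim_col A = dim_row B" "dim_col B = dim_row C" "dim_row C = n"
  shows "A * (B * C) = C"
  using assms mult_assoc_dim[of A B C] by auto

lemma mult_mat_index:
  fixes A B :: "real mat"
  assumes "i < dim_row A" "j < dim_col B" "dim_col A = dim_row B"
  shows "(A * B) $$ (i, j) = (\<Sum>k<dim_col A. A $$ (i, k) * B $$ (k, j))"
  using assms by (simp add: scalar_prod_def atLeast0LessThan)

lemma mat_diag_dims [simp]: "dim_row (mat_diag n l) = n" "dim_col (mat_diag n l) = n"
  by (simp_all add: mat_diag_def)

lemma mat_diag_index [simp]:
  "i < n \<Longrightarrow> j < n \<Longrightarrow> mat_diag n l $$ (i, j) = (if i = j then l i else 0)"
  by (simp add: mat_diag_def)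

lemma mult_diag_mult_index:
  fixes U V :: "real mat"
  assumes "i < dim_row U" "j < dim_col V" "dim_col U = n" "dim_row V = n"
  shows "(U * mat_diag n l * V) $$ (i, j) = (\<Sum>k<n. U $$ (i, k) * l k * V $$ (k, j))"
proof -
  have U: "U \<in> carrier_mat (dim_row U) n" using assms(3) by (intro carrier_matI) auto
  show ?thesis
    unfolding mat_diag_mult_right[OF U] using assms by (subst mult_mat_index) auto
qed

lemma mult_mat_vec_index:
  fixes A :: "real mat"
  assumes "i < dim_row A" "dim_col A = dim_vec v"
  shows "(A *\<^sub>v v) $ i = (\<Sum>k<dim_col A. A $$ (i, k) * v $ k)"
  using assms by (simp add: scalar_prod_def atLeast0LessThan)

lemma scalar_prod_sum: "v \<bullet> w = (\<Sum>i<dim_vec w. v $ i * w $ i)" for v w :: "real vec"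
  by (simp add: scalar_prod_def atLeast0LessThan)

lemma scalar_prod_self_nonneg: "0 \<le> v \<bullet> v" for v :: "real vec"
  by (auto simp: scalar_prod_sum intro: sum_nonneg)

lemma scalar_prod_self_eq_0: "v \<bullet> v = 0 \<Longrightarrow> v \<in> carrier_vec n \<Longrightarrow> v = 0\<^sub>v n" for v :: "real vec"
proof (rule eq_vecI)
  fix i assume "v \<bullet> v = 0" "v \<in> carrier_vec n" "i < dim_vec (0\<^sub>v n)"
  then show "v $ i = 0\<^sub>v n $ i"
    using sum_nonneg_eq_0_iff[of "{..<n}" "\<lambda>i. v $ i * v $ i"]
    by (auto simp: scalar_prod_sum)
qed auto

lemma scalar_mult_mat_vec:
  fixes A :: "real mat"
  assumes "x \<in> carrier_vec (dim_row A)" "y \<in> carrier_vec (dim_col A)"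
  shows "x \<bullet> (A *\<^sub>v y) = (A\<^sup>T *\<^sub>v x) \<bullet> y"
  using transpose_vec_mult_scalar[of A "dim_row A" "dim_col A" y x] assms by simp

section \<open>Traces, symmetric and positive semi-definite matrices\<close>

lemma mat_trace_mult:
  fixes A B :: "real mat"
  assumes "dim_col A = dim_row B" "dim_row A = dim_col B"
  shows "mat_trace (A * B) = (\<Sum>i<dim_row A. \<Sum>j<dim_col A. A $$ (i, j) * B $$ (j, i))"
  using assms by (simp add: mat_trace_def mult_mat_index del: index_mult_mat(1))

lemma mat_trace_commute:
  fixes A B :: "real mat"
  assumes "dim_col A = dim_row B" "dim_row A = dim_col B"
  shows "mat_trace (A * B) = mat_trace (B * A)"
  using assms by (simp add: mat_trace_mult) (subst sum.swap, simp add: mult.commute)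

lemma mat_trace_add:
  "dim_row A = dim_row B \<Longrightarrow> dim_col A = dim_col B \<Longrightarrow> dim_row A = dim_col A \<Longrightarrow> mat_trace (A + B) = mat_trace A + mat_trace B"
  by (auto simp: mat_trace_def sum.distrib)

lemma mat_trace_minus:
  "dim_row A = dim_row B \<Longrightarrow> dim_col A = dim_col B \<Longrightarrow> dim_row A = dim_col A \<Longrightarrow> mat_trace (A - B) = mat_trace A - mat_trace B"
  by (auto simp: mat_trace_def sum_subtractf)

lemma mat_trace_smult:
  "dim_row A = dim_col A \<Longrightarrow> mat_trace (c \<cdot>\<^sub>m A) = c * mat_trace A"
  by (auto simp: mat_trace_def sum_distrib_left)

lemmas trace_dim = mat_trace_add mat_trace_minus mat_trace_smult

lemma sym_matsD:
  assumes "A \<in> sym_mats n"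
  shows "dim_row A = n" "dim_col A = n" "A\<^sup>T = A"
  using assms by (auto simp: sym_mats_def)

lemma sym_mats_index: "A \<in> sym_mats n \<Longrightarrow> i < n \<Longrightarrow> j < n \<Longrightarrow> A $$ (i, j) = A $$ (j, i)"
  by (metis sym_matsD index_transpose_mat(1))

lemma psd_sym: "A \<in> psd_mats n \<Longrightarrow> A \<in> sym_mats n"
  by (auto simp: psd_mats_def)

lemma pd_sym: "A \<in> pd_mats n \<Longrightarrow> A \<in> sym_mats n"
  by (auto simp: pd_mats_def)

lemma pd_psd:
  assumes "A \<in> pd_mats n" shows "A \<in> psd_mats n"
proof -
  have "0 \<le> v \<bullet> (A *\<^sub>v v)" if "v \<in> carrier_vec n" for v
  proof (cases "v = 0\<^sub>v n")
    case True
    then show ?thesis by (simp add: scalar_prod_def)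
  next
    case False
    then show ?thesis using assms that by (auto simp: pd_mats_def less_imp_le)
  qed
  then show ?thesis using assms by (auto simp: psd_mats_def pd_mats_def)
qed

lemmas psd_matsD = sym_matsD[OF psd_sym]
lemmas pd_matsD = sym_matsD[OF pd_sym]

lemma sym_matsI: "dim_row A = n \<Longrightarrow> dim_col A = n \<Longrightarrow> A\<^sup>T = A \<Longrightarrow> A \<in> sym_mats n"
  by (auto simp: sym_mats_def)

lemma sym_congruence:
  assumes "A \<in> sym_mats n" "X \<in> carrier_mat n m"
  shows "X\<^sup>T * A * X \<in> sym_mats m"
  using assms(2) sym_matsD[OF assms(1)]
  by (intro sym_matsI) (auto simp: ring_dim)

lemma quad_congruence:
  fixes A X :: "real mat"
  assumes "A \<in> carrier_mat n n" "X \<in> carrier_mat n m" "v \<in> carrier_vec m"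
  shows "v \<bullet> ((X\<^sup>T * A * X) *\<^sub>v v) = (X *\<^sub>v v) \<bullet> (A *\<^sub>v (X *\<^sub>v v))"
proof -
  have "v \<bullet> ((X\<^sup>T * A * X) *\<^sub>v v) = v \<bullet> (X\<^sup>T *\<^sub>v (A *\<^sub>v (X *\<^sub>v v)))"
    using assms by (auto simp: mult_vec_assoc_dim)
  also have "\<dots> = (X *\<^sub>v v) \<bullet> (A *\<^sub>v (X *\<^sub>v v))"
    using assms by (subst scalar_mult_mat_vec) auto
  finally show ?thesis .
qed

lemma psd_congruence:
  assumes "A \<in> psd_mats n" "X \<in> carrier_mat n m"
  shows "X\<^sup>T * A * X \<in> psd_mats m"
  using sym_congruence[OF psd_sym[OF assms(1)] assms(2)] assms psd_matsD[OF assms(1)]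
  by (auto simp: psd_mats_def quad_congruence[of A n X m] sym_mats_def)

lemma psd_one: "1\<^sub>m n \<in> psd_mats n"
  by (auto simp: psd_mats_def sym_mats_def scalar_prod_self_nonneg)

lemma psd_gram:
  assumes "X \<in> carrier_mat n m"
  shows "X * X\<^sup>T \<in> psd_mats n"
  using psd_congruence[OF psd_one, of "X\<^sup>T" m n] assms by auto

lemma quad_unit_vec:
  assumes "A \<in> carrier_mat n n" "i < n"
  shows "unit_vec n i \<bullet> (A *\<^sub>v unit_vec n i) = (A $$ (i, i) :: real)"
proof -
  have "A *\<^sub>v unit_vec n i \<in> carrier_vec n" "row A i \<in> carrier_vec n"
    using assms by (auto intro!: carrier_vecI)
  then show ?thesis using assms by (simp add: scalar_prod_left_unit scalar_prod_right_unit)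
qed

lemma psd_diag_nonneg:
  assumes "A \<in> psd_mats n" "i < n"
  shows "0 \<le> A $$ (i, i)"
proof -
  have "0 \<le> unit_vec n i \<bullet> (A *\<^sub>v unit_vec n i)" using assms by (auto simp: psd_mats_def)
  then show ?thesis using assms quad_unit_vec[of A n i] by (auto simp: psd_mats_def sym_mats_def)
qed

lemma pd_diag_pos:
  assumes "A \<in> pd_mats n" "i < n"
  shows "0 < A $$ (i, i)"
proof -
  have "unit_vec n i \<noteq> (0\<^sub>v n :: real vec)" using assms(2)
    by (metis index_unit_vec(2) index_zero_vec(1) zero_neq_one)
  then have "0 < unit_vec n i \<bullet> (A *\<^sub>v unit_vec n i)" using assms by (auto simp: pd_mats_def)
  then show ?thesis using assms quad_unit_vec[of A n i] by (auto simp: pd_mats_def sym_mats_def)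
qed

lemma psd_trace_nonneg: "A \<in> psd_mats n \<Longrightarrow> 0 \<le> mat_trace A"
  using psd_diag_nonneg psd_matsD by (auto simp: mat_trace_def intro!: sum_nonneg)

lemma trace_square_sym:
  assumes "E \<in> sym_mats n"
  shows "mat_trace (E * E) = (\<Sum>i<n. \<Sum>j<n. (E $$ (i, j))\<^sup>2)"
  using sym_matsD[OF assms] sym_mats_index[OF assms]
  by (auto simp: mat_trace_mult power2_eq_square intro!: sum.cong)

section \<open>The spectral theorem for real symmetric matrices\<close>

text \<open>Let \<open>v\<close> be a complex eigenvector for \<open>z\<close>. Pairing \<open>A v\<close> with \<open>v\<close> yields \<open>z\<close> times \<open>\<parallel>v\<parallel>\<^sup>2\<close>,
  and this number is its own conjugate because \<open>A\<close> is real symmetric. So \<open>z\<close> is real, and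
  the real and imaginary parts of \<open>v\<close>, not both zero, are eigenvectors.\<close>

lemma symmetric_has_real_eigenvector:
  assumes A: "A \<in> sym_mats n" and n: "0 < n"
  shows "\<exists>e v. v \<in> carrier_vec n \<and> v \<noteq> 0\<^sub>v n \<and> A *\<^sub>v v = e \<cdot>\<^sub>v v"
proof -
  note d = sym_matsD[OF A]
  define C where "C = map_mat complex_of_real A"
  have C: "C \<in> carrier_mat n n" using d by (auto simp: C_def)
  obtain z where "eigenvalue C z"
    using spectrum_non_empty[OF C] n by (auto simp: spectrum_def)
  then obtain v where v: "v \<in> carrier_vec n" "v \<noteq> 0\<^sub>v n" "C *\<^sub>v v = z \<cdot>\<^sub>v v"
    using C by (auto simp: eigenvalue_def eigenvector_def)
  have row: "(\<Sum>j<n. complex_of_real (A $$ (i, j)) * v $ j) = z * v $ i" if "i < n" for i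
    using arg_cong[OF v(3), of "\<lambda>w. w $ i"] that v(1) C d
    by (simp add: scalar_prod_def atLeast0LessThan C_def)
  define N where "N = (\<Sum>i<n. cnj (v $ i) * v $ i)"
  have N_real: "N = of_real (\<Sum>i<n. (cmod (v $ i))\<^sup>2)"
    unfolding N_def of_real_sum by (intro sum.cong refl) (metis complex_norm_square mult.commute)
  have "N \<noteq> 0"
  proof
    assume "N = 0"
    then have "(\<Sum>i<n. (cmod (v $ i))\<^sup>2) = 0" using N_real by (metis of_real_eq_0_iff)
    then have "\<forall>i<n. v $ i = 0" by (auto simp: sum_nonneg_eq_0_iff)
    then show False using v(1,2) by auto
  qed
  have zN: "z * N = (\<Sum>i<n. \<Sum>j<n. cnj (v $ i) * (complex_of_real (A $$ (i, j)) * v $ j))"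
  proof -
    have "z * N = (\<Sum>i<n. cnj (v $ i) * (z * v $ i))"
      unfolding N_def sum_distrib_left by (simp add: mult_ac)
    also have "\<dots> = (\<Sum>i<n. cnj (v $ i) * (\<Sum>j<n. complex_of_real (A $$ (i, j)) * v $ j))"
      using row by simp
    finally show ?thesis by (simp add: sum_distrib_left)
  qed
  have "cnj (z * N) = z * N"
    unfolding zN cnj_sum
    by (subst sum.swap) (auto intro!: sum.cong simp: sym_mats_index[OF A] mult_ac)
  then have "cnj z = z" using \<open>N \<noteq> 0\<close> N_real by simp
  then have z: "z = of_real (Re z)"
    by (metis Reals_cnj_iff of_real_Re)
  define x where "x = map_vec Re v"
  define y where "y = map_vec Im v"
  have xy: "x \<in> carrier_vec n" "y \<in> carrier_vec n" using v(1) by (auto simp: x_def y_def)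
  have imz: "Im z = 0" using z by (metis Im_complex_of_real)
  have "A *\<^sub>v x = Re z \<cdot>\<^sub>v x"
  proof (rule eq_vecI)
    fix i assume "i < dim_vec (Re z \<cdot>\<^sub>v x)"
    then have i: "i < n" using xy by auto
    have "(A *\<^sub>v x) $ i = Re (\<Sum>j<n. complex_of_real (A $$ (i, j)) * v $ j)"
      using i d xy v(1) by (simp add: mult_mat_vec_index x_def del: index_mult_mat_vec)
    also have "\<dots> = Re z * x $ i" using row[OF i] imz i v(1) by (simp add: x_def)
    finally show "(A *\<^sub>v x) $ i = (Re z \<cdot>\<^sub>v x) $ i" using i xy by simp
  qed (use d xy in auto)
  moreover have "A *\<^sub>v y = Re z \<cdot>\<^sub>v y"
  proof (rule eq_vecI)
    fix i assume "i < dim_vec (Re z \<cdot>\<^sub>v y)"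
    then have i: "i < n" using xy by auto
    have "(A *\<^sub>v y) $ i = Im (\<Sum>j<n. complex_of_real (A $$ (i, j)) * v $ j)"
      using i d xy v(1) by (simp add: mult_mat_vec_index y_def del: index_mult_mat_vec)
    also have "\<dots> = Re z * y $ i" using row[OF i] imz i v(1) by (simp add: y_def)
    finally show "(A *\<^sub>v y) $ i = (Re z \<cdot>\<^sub>v y) $ i" using i xy by simp
  qed (use d xy in auto)
  moreover have "x \<noteq> 0\<^sub>v n \<or> y \<noteq> 0\<^sub>v n"
  proof (rule ccontr)
    assume "\<not> ?thesis"
    then have "\<forall>i<n. Re (v $ i) = 0 \<and> Im (v $ i) = 0"
      using v(1) unfolding x_def y_def by (metis carrier_vecD index_map_vec(1) index_zero_vec(1))
    then have "v = 0\<^sub>v n" using v(1) by (auto simp: complex_eq_iff)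
    then show False using v(2) by simp
  qed
  ultimately show ?thesis using xy by blast
qed

text \<open>For \<open>v \<noteq> e\<^sub>0\<close>, the reflection in the hyperplane orthogonal to \<open>w = v - e\<^sub>0\<close> exchanges the
  unit vectors \<open>e\<^sub>0\<close> and \<open>v\<close>.\<close>

lemma householder:
  fixes v :: "real vec"
  assumes v: "v \<in> carrier_vec n" "v \<bullet> v = 1" and n: "0 < n"
  shows "\<exists>Q. Q \<in> sym_mats n \<and> Q * Q = 1\<^sub>m n \<and> Q *\<^sub>v unit_vec n 0 = v"
proof (cases "v = unit_vec n 0")
  case True
  then show ?thesis using n by (intro exI[of _ "1\<^sub>m n"]) (auto simp: sym_mats_def)
next
  case False
  define w where "w i = v $ i - (if i = 0 then 1 else 0)" for i
  \<comment> \<open>\<open>Q = 1 - 2 w w\<^sup>T / (w\<^sup>T w)\<close>, where \<open>w\<^sup>T w = 2 - 2 v\<^sub>0\<close> since \<open>v\<close> has length one\<close>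
  define c where "c = 2 / (\<Sum>i<n. (w i)\<^sup>2)"
  define Q where "Q = mat n n (\<lambda>(i, j). (if i = j then 1 else 0) - c * w i * w j)"
  have ssv: "(\<Sum>i<n. v $ i * v $ i) = 1" using v by (simp add: scalar_prod_sum)
  have ss: "(\<Sum>i<n. (w i)\<^sup>2) = 2 - 2 * v $ 0"
  proof -
    have "(\<Sum>i<n. (w i)\<^sup>2) = (\<Sum>i<n. v $ i * v $ i) + (\<Sum>i<n. if i = 0 then 1 - 2 * v $ 0 else 0)"
      unfolding sum.distrib[symmetric]
      by (intro sum.cong refl) (auto simp: w_def power2_eq_square algebra_simps)
    then show ?thesis using ssv n by simp
  qed
  have "(\<Sum>i<n. (w i)\<^sup>2) \<noteq> 0"
  proof
    assume "(\<Sum>i<n. (w i)\<^sup>2) = 0"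
    then have "\<forall>i<n. w i = 0" by (auto simp: sum_nonneg_eq_0_iff)
    then have "v = unit_vec n 0" using v(1) by (auto simp: w_def)
    then show False using False by simp
  qed
  then have c: "c * (\<Sum>i<n. (w i)\<^sup>2) = 2" "c * (1 - v $ 0) = 1"
    using ss by (auto simp: c_def field_simps)
  have QQ: "Q * Q = 1\<^sub>m n"
  proof (rule eq_matI)
    fix i j assume "i < dim_row (1\<^sub>m n :: real mat)" "j < dim_col (1\<^sub>m n :: real mat)"
    then have ij: "i < n" "j < n" by auto
    have "(Q * Q) $$ (i, j) = (\<Sum>k<n. (if k = i then (if i = j then 1 else 0) - c * w i * w j else 0)
        - (if k = j then c * w i * w j else 0) + c * w i * w j * (c * (w k)\<^sup>2))"
      using ij by (subst mult_mat_index)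
        (auto simp: Q_def algebra_simps power2_eq_square intro!: sum.cong)
    also have "\<dots> = (if i = j then 1 else 0) - 2 * c * w i * w j + c * w i * w j * (c * (\<Sum>k<n. (w k)\<^sup>2))"
      using ij by (simp add: sum.distrib sum_subtractf sum_distrib_left)
    also have "\<dots> = 1\<^sub>m n $$ (i, j)" unfolding c(1) using ij by simp
    finally show "(Q * Q) $$ (i, j) = 1\<^sub>m n $$ (i, j)" .
  qed (auto simp: Q_def)
  moreover have "Q *\<^sub>v unit_vec n 0 = v"
  proof (rule eq_vecI)
    fix i assume "i < dim_vec v"
    then have i: "i < n" using v by auto
    have "(Q *\<^sub>v unit_vec n 0) $ i = Q $$ (i, 0)"
      using i n by (simp add: Q_def scalar_prod_right_unit)
    also have "\<dots> = (if i = 0 then 1 else 0) + w i * (c * (1 - v $ 0))"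
      using i n by (simp add: Q_def w_def algebra_simps)
    also have "\<dots> = v $ i" unfolding c(2) by (simp add: w_def)
    finally show "(Q *\<^sub>v unit_vec n 0) $ i = v $ i" .
  qed (use v in \<open>auto simp: Q_def\<close>)
  moreover have "Q \<in> sym_mats n"
    by (rule sym_matsI) (auto simp: Q_def transpose_mat_def)
  ultimately show ?thesis by blast
qed

text \<open>Deflation: a reflection that moves an eigenvector to the first coordinate axis makes the
  first row and column of \<open>A\<close> vanish off the diagonal, and the remaining block is smaller.\<close>

lemma orthonormal_diagonalization:
  assumes "A \<in> sym_mats n"
  shows "\<exists>U l. U \<in> carrier_mat n n \<and> U\<^sup>T * U = 1\<^sub>m n \<and> A = U * mat_diag n l * U\<^sup>T"
  using assms
proof (induction n arbitrary: A)
  case 0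
  then show ?case
    by (intro exI[of _ "1\<^sub>m 0"] exI[of _ "\<lambda>_. 0"]) (auto simp: sym_mats_def)
next
  case (Suc n A)
  note d = sym_matsD[OF Suc.prems]
  let ?m = "Suc n"
  obtain e x where x: "x \<in> carrier_vec ?m" "x \<noteq> 0\<^sub>v ?m" "A *\<^sub>v x = e \<cdot>\<^sub>v x"
    using symmetric_has_real_eigenvector[OF Suc.prems] by auto
  define r where "r = sqrt (x \<bullet> x)"
  have "x \<bullet> x \<noteq> 0" using scalar_prod_self_eq_0 x by blast
  then have r: "r > 0" "r * r = x \<bullet> x"
    using scalar_prod_self_nonneg[of x] by (auto simp: r_def)
  define v where "v = (1 / r) \<cdot>\<^sub>v x"
  have v: "v \<in> carrier_vec ?m" using x by (simp add: v_def)
  have vv: "v \<bullet> v = 1"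
    using x r by (simp add: v_def r(2)[symmetric])
  have Av: "A *\<^sub>v v = e \<cdot>\<^sub>v v"
  proof -
    have "A \<in> carrier_mat ?m ?m" using d by auto
    then show ?thesis
      using x by (simp add: v_def mult_mat_vec smult_smult_assoc mult.commute)
  qed
  obtain Q where Q: "Q \<in> sym_mats ?m" "Q * Q = 1\<^sub>m ?m" "Q *\<^sub>v unit_vec ?m 0 = v"
    using householder[OF v vv] by auto
  note dQ = sym_matsD[OF Q(1)]
  define B where "B = Q * A * Q"
  have B: "B \<in> sym_mats ?m"
    using d dQ by (intro sym_matsI) (auto simp: B_def ring_dim)
  note dB = sym_matsD[OF B]
  have "B *\<^sub>v unit_vec ?m 0 = Q *\<^sub>v (A *\<^sub>v v)"
    using d dQ carrier_vecD[OF v] by (simp add: B_def mult_vec_assoc_dim Q(3))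
  also have "\<dots> = e \<cdot>\<^sub>v (Q *\<^sub>v v)"
    unfolding Av by (rule mult_mat_vec[of Q ?m ?m]) (use dQ v in auto)
  also have "Q *\<^sub>v v = (Q * Q) *\<^sub>v unit_vec ?m 0"
    unfolding Q(3)[symmetric] using dQ by (simp add: mult_vec_assoc_dim)
  finally have Be: "B *\<^sub>v unit_vec ?m 0 = e \<cdot>\<^sub>v unit_vec ?m 0" using Q(2) by simp
  have B0: "B $$ (i, 0) = (if i = 0 then e else 0)" if "i < ?m" for i
  proof -
    have "row B i \<in> carrier_vec ?m" using dB by (auto intro!: carrier_vecI)
    then show ?thesis
      using arg_cong[OF Be, of "\<lambda>w. w $ i"] that dB by (simp add: scalar_prod_right_unit)
  qed
  define C where "C = mat n n (\<lambda>(i, j). B $$ (Suc i, Suc j))"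
  have "C \<in> sym_mats n"
    by (rule sym_matsI) (auto simp: C_def sym_mats_index[OF B])
  then obtain V l where V: "V \<in> carrier_mat n n" "V\<^sup>T * V = 1\<^sub>m n"
      "C = V * mat_diag n l * V\<^sup>T"
    using Suc.IH by blast
  define W where "W = mat ?m ?m (\<lambda>(i, j). case (i, j) of (Suc i', Suc j') \<Rightarrow> V $$ (i', j')
      | (0, 0) \<Rightarrow> 1 | _ \<Rightarrow> 0)"
  define l' where "l' k = (case k of 0 \<Rightarrow> e | Suc k' \<Rightarrow> l k')" for k
  have V_orth: "(\<Sum>k<n. V $$ (k, i) * V $$ (k, j)) = (if i = j then 1 else 0)" if "i < n" "j < n" for i j
    using arg_cong[OF V(2), of "\<lambda>M. M $$ (i, j)"] that V(1)
    by (simp add: mult_mat_index del: index_mult_mat(1))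
  have V_C: "(\<Sum>k<n. V $$ (i, k) * l k * V $$ (j, k)) = B $$ (Suc i, Suc j)" if "i < n" "j < n" for i j
  proof -
    have "C $$ (i, j) = (\<Sum>k<n. V $$ (i, k) * l k * V $$ (j, k))"
      using V(1) that unfolding V(3) by (subst mult_diag_mult_index) auto
    then show ?thesis using that by (simp add: C_def)
  qed
  have WW: "W\<^sup>T * W = 1\<^sub>m ?m"
  proof (rule eq_matI)
    fix i j assume ij: "i < dim_row (1\<^sub>m ?m :: real mat)" "j < dim_col (1\<^sub>m ?m :: real mat)"
    show "(W\<^sup>T * W) $$ (i, j) = 1\<^sub>m ?m $$ (i, j)"
      using ij V_orth
      by (subst mult_mat_index)
        (auto simp: W_def sum.lessThan_Suc_shift simp del: sum.lessThan_Suc split: nat.split)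
  qed (auto simp: W_def)
  have W: "W \<in> carrier_mat ?m ?m" by (simp add: W_def)
  have WB: "B = W * mat_diag ?m l' * W\<^sup>T"
  proof (rule eq_matI)
    fix i j assume "i < dim_row (W * mat_diag ?m l' * W\<^sup>T)"
      "j < dim_col (W * mat_diag ?m l' * W\<^sup>T)"
    then have ij: "i < ?m" "j < ?m" using W by auto
    have "(W * mat_diag ?m l' * W\<^sup>T) $$ (i, j)
        = (\<Sum>k<?m. W $$ (i, k) * l' k * W $$ (j, k))"
      using ij W by (subst mult_diag_mult_index) auto
    also have "\<dots> = B $$ (i, j)"
      using ij B0 V_C sym_mats_index[OF B, of 0 j]
      by (auto simp: W_def l'_def sum.lessThan_Suc_shift simp del: sum.lessThan_Suc split: nat.split)
    finally show "B $$ (i, j) = (W * mat_diag ?m l' * W\<^sup>T) $$ (i, j)" ..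
  qed (use W dB in auto)
  define U where "U = Q * W"
  have [simp]: "dim_row W = ?m" "dim_col W = ?m" using W by auto
  have "U \<in> carrier_mat ?m ?m" using dQ by (auto simp: U_def)
  moreover have "U\<^sup>T * U = 1\<^sub>m ?m"
    using dQ by (simp add: U_def ring_dim inverse_cancel_left[OF Q(2)] WW)
  moreover have "A = U * mat_diag ?m l' * U\<^sup>T"
  proof -
    have "A = Q * B * Q"
      using d dQ by (simp add: B_def ring_dim inverse_cancel_left[OF Q(2)] Q(2))
    also have "\<dots> = U * mat_diag ?m l' * U\<^sup>T"
      unfolding WB U_def using dQ by (simp add: ring_dim)
    finally show ?thesis .
  qed
  ultimately show ?case by blast
qed

lemma decreasing_enumeration:
  fixes l :: "nat \<Rightarrow> real"
  shows "\<exists>\<pi>. bij_betw \<pi> {..<n} {..<n} \<and> (\<forall>i j. i \<le> j \<and> j < n \<longrightarrow> l (\<pi> j) \<le> l (\<pi> i))"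
proof -
  define xs where "xs = sort_key (\<lambda>i. - l i) [0..<n]"
  have xs: "distinct xs" "set xs = {..<n}" "length xs = n" by (auto simp: xs_def)
  have "bij_betw (\<lambda>i. xs ! i) {..<n} {..<n}"
    by (rule bij_betw_nth[OF xs(1)]) (simp_all only: xs)
  moreover have "l (xs ! j) \<le> l (xs ! i)" if "i \<le> j" "j < n" for i j
    using sorted_nth_mono[of "map (\<lambda>i. - l i) xs" i j] that xs(3)
    by (auto simp: xs_def)
  ultimately show ?thesis by blast
qed

theorem eigendecomposition_exists:
  assumes "A \<in> sym_mats n"
  shows "\<exists>U l. eigendecomposition n A U (mat_diag n l)"
proof -
  obtain V l where V: "V \<in> carrier_mat n n" "V\<^sup>T * V = 1\<^sub>m n"
      "A = V * mat_diag n l * V\<^sup>T"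
    using orthonormal_diagonalization[OF assms] by blast
  obtain \<pi> where \<pi>: "bij_betw \<pi> {..<n} {..<n}" "\<And>i j. i \<le> j \<Longrightarrow> j < n \<Longrightarrow> l (\<pi> j) \<le> l (\<pi> i)"
    using decreasing_enumeration[of n l] by blast
  define U where "U = mat n n (\<lambda>(i, j). V $$ (i, \<pi> j))"
  have U: "U \<in> carrier_mat n n" by (simp add: U_def)
  have \<pi>n: "\<pi> i < n" if "i < n" for i using \<pi>(1) that bij_betwE by fastforce
  have \<pi>_inj: "\<pi> i = \<pi> j \<longleftrightarrow> i = j" if "i < n" "j < n" for i j
    using \<pi>(1) that by (auto simp: bij_betw_def inj_on_def)
  have UU: "U\<^sup>T * U = 1\<^sub>m n"
  proof (rule eq_matI)
    fix i j assume "i < dim_row (1\<^sub>m n :: real mat)" "j < dim_col (1\<^sub>m n :: real mat)"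
    then have ij: "i < n" "j < n" by auto
    have "(U\<^sup>T * U) $$ (i, j) = (V\<^sup>T * V) $$ (\<pi> i, \<pi> j)"
      using ij \<pi>n V(1) by (subst (1 2) mult_mat_index) (auto simp: U_def)
    then show "(U\<^sup>T * U) $$ (i, j) = 1\<^sub>m n $$ (i, j)"
      using ij \<pi>n \<pi>_inj unfolding V(2) by simp
  qed (auto simp: U_def)
  have "A = U * mat_diag n (l \<circ> \<pi>) * U\<^sup>T"
  proof (rule eq_matI)
    fix i j assume "i < dim_row (U * mat_diag n (l \<circ> \<pi>) * U\<^sup>T)"
      "j < dim_col (U * mat_diag n (l \<circ> \<pi>) * U\<^sup>T)"
    then have ij: "i < n" "j < n" using U by auto
    have "A $$ (i, j) = (\<Sum>k<n. V $$ (i, k) * l k * V $$ (j, k))"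
      unfolding V(3) using ij V(1) by (subst mult_diag_mult_index) auto
    also have "\<dots> = (\<Sum>k<n. V $$ (i, \<pi> k) * l (\<pi> k) * V $$ (j, \<pi> k))"
      by (rule sum.reindex_bij_betw[OF \<pi>(1), symmetric])
    also have "\<dots> = (U * mat_diag n (l \<circ> \<pi>) * U\<^sup>T) $$ (i, j)"
      using ij by (subst mult_diag_mult_index) (auto simp: U_def)
    finally show "A $$ (i, j) = (U * mat_diag n (l \<circ> \<pi>) * U\<^sup>T) $$ (i, j)" .
  qed (use U sym_matsD[OF assms] in auto)
  moreover have "U * U\<^sup>T = 1\<^sub>m n"
    by (rule mat_mult_left_right_inverse[OF _ U UU]) (use U in auto)
  ultimately have "eigendecomposition n A U (mat_diag n (l \<circ> \<pi>))"
    using U UU \<pi>(2) by (auto simp: eigendecomposition_def diagonal_mat_def mat_diag_def)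
  then show ?thesis by blast
qed

lemma eigendecomposition_mat_diag:
  assumes "eigendecomposition n A U L"
  obtains l where "L = mat_diag n l"
proof -
  have "L = mat_diag n (\<lambda>i. L $$ (i, i))"
    using assms by (intro eq_matI) (auto simp: eigendecomposition_def diagonal_mat_def mat_diag_def)
  then show ?thesis by (rule that)
qed

lemma eigendecompositionD:
  assumes "eigendecomposition n A U (mat_diag n l)"
  shows "U \<in> carrier_mat n n" "U\<^sup>T * U = 1\<^sub>m n" "A = U * mat_diag n l * U\<^sup>T"
    "U * U\<^sup>T = 1\<^sub>m n" "A \<in> carrier_mat n n"
    "i \<le> j \<Longrightarrow> j < n \<Longrightarrow> l j \<le> l i"
proof -
  show U: "U \<in> carrier_mat n n" "A = U * mat_diag n l * U\<^sup>T"
    "U\<^sup>T * U = 1\<^sub>m n" "U * U\<^sup>T = 1\<^sub>m n"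
    using assms unfolding eigendecomposition_def by blast+
  show "A \<in> carrier_mat n n" using U(1) unfolding U(2) by auto
  show "l j \<le> l i" if "i \<le> j" "j < n"
    using assms that unfolding eigendecomposition_def by (metis le_less_trans mat_diag_index)
qed

section \<open>Square roots of positive semi-definite matrices\<close>

lemma transpose_mat_diag [simp]: "transpose_mat (mat_diag n l) = mat_diag n (l :: nat \<Rightarrow> real)"
  by (rule eq_matI) auto

lemma mat_diag_sym: "mat_diag n l \<in> sym_mats n"
  by (rule sym_matsI) auto

lemma mat_diag_mult_vec_index:
  fixes v :: "real vec"
  assumes "v \<in> carrier_vec n" "i < n"
  shows "(mat_diag n l *\<^sub>v v) $ i = l i * v $ i"
proof -
  have "(mat_diag n l *\<^sub>v v) $ i = (\<Sum>k<n. mat_diag n l $$ (i, k) * v $ k)"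
    using carrier_vecD[OF assms(1)] assms(2) by (subst mult_mat_vec_index) auto
  also have "\<dots> = (\<Sum>k<n. if k = i then l i * v $ i else 0)"
    using assms(2) by (intro sum.cong refl) auto
  finally show ?thesis using assms(2) by simp
qed

lemma quad_mat_diag:
  fixes v :: "real vec"
  assumes "v \<in> carrier_vec n"
  shows "v \<bullet> (mat_diag n l *\<^sub>v v) = (\<Sum>i<n. l i * (v $ i)\<^sup>2)"
  using assms
  by (auto simp: scalar_prod_sum mat_diag_mult_vec_index power2_eq_square simp del: index_mult_mat_vec intro!: sum.cong)

lemma psd_mat_diag: "(\<And>i. i < n \<Longrightarrow> 0 \<le> l i) \<Longrightarrow> mat_diag n l \<in> psd_mats n"
  using mat_diag_sym[of n l] by (auto simp: psd_mats_def quad_mat_diag intro!: sum_nonneg)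

lemma pd_mat_diag:
  assumes "\<And>i. i < n \<Longrightarrow> 0 < l i"
  shows "mat_diag n l \<in> pd_mats n"
proof -
  have "0 < (\<Sum>i<n. l i * (v $ i)\<^sup>2)" if v: "v \<in> carrier_vec n" "v \<noteq> 0\<^sub>v n" for v
  proof -
    obtain i where i: "i < n" "v $ i \<noteq> 0" using v by (metis carrier_vecD eq_vecI index_zero_vec)
    then have "0 < l i * (v $ i)\<^sup>2" using assms by simp
    then show ?thesis
      using i by (intro sum_pos2[of _ i]) (auto simp: less_imp_le assms)
  qed
  then show ?thesis using mat_diag_sym[of n l] by (auto simp: pd_mats_def quad_mat_diag)
qed

lemma pd_congruence:
  assumes A: "A \<in> pd_mats n" and X: "X \<in> carrier_mat n m" and Y: "Y \<in> carrier_mat m n" "Y * X = 1\<^sub>m m"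
  shows "X\<^sup>T * A * X \<in> pd_mats m"
proof -
  have "0 < v \<bullet> ((X\<^sup>T * A * X) *\<^sub>v v)" if v: "v \<in> carrier_vec m" "v \<noteq> 0\<^sub>v m" for v
  proof -
    have "X *\<^sub>v v \<noteq> 0\<^sub>v n"
    proof
      assume "X *\<^sub>v v = 0\<^sub>v n"
      then have "(Y * X) *\<^sub>v v = Y *\<^sub>v 0\<^sub>v n"
        using X Y(1) v mult_vec_assoc_dim[of Y X v] by simp
      moreover have "Y *\<^sub>v 0\<^sub>v n = 0\<^sub>v m" using Y(1) by (intro eq_vecI) auto
      ultimately show False using Y v by simp
    qed
    moreover have "X *\<^sub>v v \<in> carrier_vec n" using X by (auto intro!: carrier_vecI)
    ultimately show ?thesis
      using A X v pd_matsD[OF A] by (subst quad_congruence[of A n X m]) (auto simp: pd_mats_def)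
  qed
  then show ?thesis using sym_congruence[OF pd_sym[OF A] X] by (auto simp: pd_mats_def)
qed

lemma orth_cancel:
  fixes U :: "real mat"
  assumes "U \<in> carrier_mat n n" "U\<^sup>T * U = 1\<^sub>m n"
  shows "(U * mat_diag n f * U\<^sup>T) * (U * mat_diag n g * U\<^sup>T)
    = U * mat_diag n (\<lambda>i. f i * g i) * U\<^sup>T"
proof -
  have "(U * mat_diag n f * U\<^sup>T) * (U * mat_diag n g * U\<^sup>T)
     = U * (mat_diag n f * mat_diag n g) * U\<^sup>T"
    using assms(1) by (simp add: mult_assoc_dim inverse_cancel_left[OF assms(2)] del: mat_diag_diag)
  then show ?thesis by simp
qed

lemma eigenvalue_quad:
  fixes U :: "real mat"
  assumes "U \<in> carrier_mat n n" "U\<^sup>T * U = 1\<^sub>m n" "A = U * mat_diag n l * U\<^sup>T"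
  shows "U\<^sup>T * A * U = mat_diag n l"
  using assms(1) unfolding assms(3)
  by (simp add: mult_assoc_dim inverse_cancel_left[OF assms(2)] assms(2))

lemma psd_eigenvalues:
  assumes "A \<in> psd_mats n" "U \<in> carrier_mat n n" "U\<^sup>T * U = 1\<^sub>m n"
    "A = U * mat_diag n l * U\<^sup>T" "i < n"
  shows "0 \<le> l i"
  using psd_diag_nonneg[OF psd_congruence[OF assms(1,2)] assms(5)] eigenvalue_quad[OF assms(2-4)] assms(5)
  by simp

lemma pd_eigenvalues:
  assumes "A \<in> pd_mats n" "U \<in> carrier_mat n n" "U\<^sup>T * U = 1\<^sub>m n"
    "A = U * mat_diag n l * U\<^sup>T" "i < n"
  shows "0 < l i"
  using pd_diag_pos[OF pd_congruence[OF assms(1,2) _ assms(3)] assms(5)] eigenvalue_quad[OF assms(2-4)] assms(2,5)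
  by simp

lemma spectral_root:
  assumes A: "A \<in> psd_mats n" and U: "U \<in> carrier_mat n n" "U\<^sup>T * U = 1\<^sub>m n" "A = U * mat_diag n l * U\<^sup>T"
  defines "B \<equiv> U * mat_diag n (\<lambda>i. sqrt (l i)) * U\<^sup>T"
  shows "B \<in> psd_mats n" "B * B = A"
proof -
  have l: "0 \<le> l i" if "i < n" for i by (rule psd_eigenvalues[OF A U that])
  show "B \<in> psd_mats n"
    using psd_congruence[OF psd_mat_diag, of n "\<lambda>i. sqrt (l i)" "U\<^sup>T" n] U(1) l by (simp add: B_def)
  have "mat_diag n (\<lambda>i. sqrt (l i) * sqrt (l i)) = mat_diag n l"
    by (rule eq_matI) (auto simp: l)
  then show "B * B = A" unfolding B_def orth_cancel[OF U(1,2)] by (simp add: U(3))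
qed

lemma psd_root_exists:
  assumes "A \<in> psd_mats n"
  shows "\<exists>P \<in> psd_mats n. P * P = A"
proof -
  obtain U l where ev: "eigendecomposition n A U (mat_diag n l)"
    using eigendecomposition_exists[OF psd_sym[OF assms]] by blast
  show ?thesis using spectral_root[OF assms eigendecompositionD(1-3)[OF ev]] by blast
qed

text \<open>The trace of \<open>E\<^sup>2\<close> is the sum of the squared entries of \<open>E\<close>.\<close>

lemma sym_trace_square_eq_0:
  assumes "E \<in> sym_mats n" "mat_trace (E * E) = 0"
  shows "E = 0\<^sub>m n n"
proof -
  have "\<forall>i<n. (\<Sum>j<n. (E $$ (i, j))\<^sup>2) = 0"
    using assms(2) unfolding trace_square_sym[OF assms(1)]
    by (subst (asm) sum_nonneg_eq_0_iff) (auto intro: sum_nonneg)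
  then have "\<forall>i<n. \<forall>j<n. E $$ (i, j) = 0"
    by (auto simp: sum_nonneg_eq_0_iff)
  then show ?thesis using sym_matsD[OF assms(1)] by (intro eq_matI) auto
qed

lemma gram_trace_eq_0:
  fixes X :: "real mat"
  assumes "mat_trace (X\<^sup>T * X) = 0"
  shows "X = 0\<^sub>m (dim_row X) (dim_col X)"
proof -
  have "(\<Sum>j<dim_col X. \<Sum>i<dim_row X. (X $$ (i, j))\<^sup>2) = 0"
    using assms by (simp add: mat_trace_mult power2_eq_square)
  then have "\<forall>j<dim_col X. (\<Sum>i<dim_row X. (X $$ (i, j))\<^sup>2) = 0"
    by (subst (asm) sum_nonneg_eq_0_iff) (auto intro: sum_nonneg)
  then have "\<forall>j<dim_col X. \<forall>i<dim_row X. X $$ (i, j) = 0"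
    by (auto simp: sum_nonneg_eq_0_iff)
  then show ?thesis by (intro eq_matI) auto
qed

lemma sym_add: "A \<in> sym_mats n \<Longrightarrow> B \<in> sym_mats n \<Longrightarrow> A + B \<in> sym_mats n"
  by (rule sym_matsI) (auto simp: sym_mats_def transpose_add[of _ n n])

lemma quad_add:
  fixes v :: "real vec"
  assumes "A \<in> sym_mats n" "B \<in> sym_mats n" "v \<in> carrier_vec n"
  shows "v \<bullet> ((A + B) *\<^sub>v v) = v \<bullet> (A *\<^sub>v v) + v \<bullet> (B *\<^sub>v v)"
proof -
  have c: "A \<in> carrier_mat n n" "B \<in> carrier_mat n n" using assms by (auto simp: sym_mats_def)
  then show ?thesis
    using assms(3) by (simp add: add_mult_distrib_mat_vec[of _ n n] scalar_prod_add_distrib[of _ n])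
qed

lemma psd_add:
  assumes "A \<in> psd_mats n" "B \<in> psd_mats n"
  shows "A + B \<in> psd_mats n"
  using assms sym_add[OF psd_sym psd_sym, OF assms]
  by (auto simp: psd_mats_def quad_add[of A n B])

lemma pd_add:
  assumes "A \<in> pd_mats n" "B \<in> pd_mats n"
  shows "A + B \<in> pd_mats n"
  using assms sym_add[OF pd_sym pd_sym, OF assms]
  by (auto simp: pd_mats_def quad_add[of A n B] add_pos_pos)

lemma pd_smult:
  assumes A: "A \<in> pd_mats n" and c: "c > 0"
  shows "c \<cdot>\<^sub>m A \<in> pd_mats n"
proof -
  have cA: "A \<in> carrier_mat n n" using A by (auto simp: pd_mats_def sym_mats_def)
  have "0 < v \<bullet> ((c \<cdot>\<^sub>m A) *\<^sub>v v)" if v: "v \<in> carrier_vec n" "v \<noteq> 0\<^sub>v n" for v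
  proof -
    have "(c \<cdot>\<^sub>m A) *\<^sub>v v = c \<cdot>\<^sub>v (A *\<^sub>v v)"
      using cA v by (intro eq_vecI) (auto simp: scalar_prod_def sum_distrib_left mult_ac)
    moreover have "0 < v \<bullet> (A *\<^sub>v v)" using A v by (auto simp: pd_mats_def)
    ultimately show ?thesis using cA v c by simp
  qed
  moreover have "c \<cdot>\<^sub>m A \<in> sym_mats n"
    using pd_matsD[OF A] cA by (intro sym_matsI) (auto simp: sym_mats_index[OF pd_sym[OF A]] intro!: eq_matI)
  ultimately show ?thesis by (auto simp: pd_mats_def)
qed

lemma sym_minus: "A \<in> sym_mats n \<Longrightarrow> B \<in> sym_mats n \<Longrightarrow> A - B \<in> sym_mats n"
  by (rule sym_matsI) (auto simp: sym_mats_def transpose_minus[of _ n n])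

lemma psd_sandwich:
  assumes "X \<in> psd_mats n" "E \<in> sym_mats n"
  shows "E * X * E \<in> psd_mats n"
  using psd_congruence[OF assms(1), of E n] sym_matsD[OF assms(2)] by auto

text \<open>With \<open>X = P\<^sup>2\<close>, the trace of \<open>E X E\<close> is the sum of the squared entries of \<open>P E\<close>.\<close>

lemma psd_sandwich_trace_eq_0:
  assumes X: "X \<in> psd_mats n" and E: "E \<in> sym_mats n" and 0: "mat_trace (E * X * E) = 0"
  shows "X * E = 0\<^sub>m n n"
proof -
  obtain P where P: "P \<in> psd_mats n" "P * P = X" using psd_root_exists[OF X] by blast
  note d = psd_matsD[OF P(1)] sym_matsD[OF E]
  have "transpose_mat (P * E) * (P * E) = E * X * E"
    using d by (simp add: ring_dim P(2)[symmetric])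
  then have "P * E = 0\<^sub>m n n" using gram_trace_eq_0[of "P * E"] 0 d by simp
  then have "P * (P * E) = 0\<^sub>m n n" using d by simp
  then show ?thesis using d by (simp add: ring_dim P(2)[symmetric])
qed

text \<open>Comes from \<open>X\<^sup>2 - Y\<^sup>2 = X (X - Y) + (X - Y) Y\<close>. For positive semi-definite \<open>X\<close> and \<open>Y\<close> both
  terms on the right are non-negative, so they are controlled by the difference of the
  squares. This gives uniqueness of square roots and also their Lipschitz continuity.\<close>

lemma square_difference_trace:
  assumes X: "X \<in> sym_mats n" and Y: "Y \<in> sym_mats n"
  shows "mat_trace ((X - Y) * (X * X - Y * Y)) =
    mat_trace ((X - Y) * X * (X - Y)) + mat_trace ((X - Y) * Y * (X - Y))"
proof -
  note d = sym_matsD[OF X] sym_matsD[OF Y]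
  have "mat_trace ((X - Y) * Y * (X - Y)) = mat_trace ((X - Y) * (X - Y) * Y)"
    using d mat_trace_commute[of "X - Y" "Y * (X - Y)"] mat_trace_commute[of "(X - Y) * (X - Y)" Y]
      mat_trace_commute[of "(X - Y) * Y" "X - Y"]
    by (simp add: mult_assoc_dim)
  moreover have "X * X - Y * Y = X * (X - Y) + (X - Y) * Y"
    using d by (simp add: ring_dim) (intro eq_matI, auto)
  then have "(X - Y) * (X * X - Y * Y) = (X - Y) * X * (X - Y) + (X - Y) * (X - Y) * Y"
    using d by (simp add: mult_assoc_dim mult_add_dim)
  ultimately show ?thesis using d by (simp add: mat_trace_add)
qed

lemma psd_root_unique:
  assumes X: "X \<in> psd_mats n" and Y: "Y \<in> psd_mats n" and eq: "X * X = Y * Y"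
  shows "X = Y"
proof -
  note d = psd_matsD[OF X] psd_matsD[OF Y]
  define E where "E = X - Y"
  have E: "E \<in> sym_mats n" unfolding E_def by (intro sym_minus psd_sym X Y)
  note dE = sym_matsD[OF E]
  have "mat_trace (E * X * E) + mat_trace (E * Y * E) = 0"
  proof -
    have "X * X - Y * Y = 0\<^sub>m n n" using eq d by auto
    then have "mat_trace (E * (X * X - Y * Y)) = 0" using dE by (simp add: mat_trace_def)
    then show ?thesis
      using square_difference_trace[OF psd_sym[OF X] psd_sym[OF Y]] by (simp add: E_def)
  qed
  then have "mat_trace (E * X * E) = 0" "mat_trace (E * Y * E) = 0"
    using psd_trace_nonneg[OF psd_sandwich[OF X E]] psd_trace_nonneg[OF psd_sandwich[OF Y E]] by auto
  then have "X * E = 0\<^sub>m n n" "Y * E = 0\<^sub>m n n"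
    using psd_sandwich_trace_eq_0 X Y E by auto
  then have "E * E = 0\<^sub>m n n"
    using d minus_mult_dim[of X Y E] by (simp add: E_def[symmetric] dE)
  then have "E = 0\<^sub>m n n"
    using sym_trace_square_eq_0[OF E] by (simp add: mat_trace_def)
  then have "X - Y = 0\<^sub>m n n" by (simp add: E_def)
  then have "\<And>i j. i < n \<Longrightarrow> j < n \<Longrightarrow> X $$ (i, j) - Y $$ (i, j) = 0"
    using d by (metis index_minus_mat(1) index_zero_mat(1))
  then show ?thesis using d by (intro eq_matI) auto
qed

lemma psd_sqrt_eqI:
  assumes "B \<in> psd_mats n" "B * B = A"
  shows "psd_sqrt A = B"
proof -
  have "dim_row A = n" using assms psd_matsD[OF assms(1)] by auto
  then show ?thesis
    unfolding psd_sqrt_def using assms psd_root_unique by (intro the_equality) auto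
qed

lemma
  assumes "A \<in> psd_mats n"
  shows psd_sqrt_psd: "psd_sqrt A \<in> psd_mats n" and psd_sqrt_square: "psd_sqrt A * psd_sqrt A = A"
proof -
  obtain P where "P \<in> psd_mats n" "P * P = A" using psd_root_exists[OF assms] by blast
  then show "psd_sqrt A \<in> psd_mats n" "psd_sqrt A * psd_sqrt A = A"
    using psd_sqrt_eqI by auto
qed

text \<open>With \<open>A = P\<^sup>2\<close>, the trace of \<open>A B\<close> is that of the positive semi-definite matrix \<open>P B P\<close>.\<close>

lemma trace_product_psd_nonneg:
  assumes A: "A \<in> psd_mats n" and B: "B \<in> psd_mats n"
  shows "0 \<le> mat_trace (A * B)"
proof -
  obtain P where P: "P \<in> psd_mats n" "P * P = A" using psd_root_exists[OF A] by blast
  note d = psd_matsD[OF P(1)] psd_matsD[OF B]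
  have "mat_trace (A * B) = mat_trace (P * B * P)"
    using d mat_trace_commute[of P "P * B"] by (simp add: P(2)[symmetric] mult_assoc_dim)
  then show ?thesis using psd_trace_nonneg[OF psd_sandwich[OF B psd_sym[OF P(1)]]] by simp
qed

section \<open>Positive definite matrices\<close>

lemma mat_inv_eqI:
  assumes A: "A \<in> carrier_mat n n" and B: "B \<in> carrier_mat n n" and AB: "A * B = 1\<^sub>m n"
  shows "mat_inv A = B"
proof -
  have BA: "B * A = 1\<^sub>m n" by (rule mat_mult_left_right_inverse[OF A B AB])
  have "A \<in> Units (ring_mat TYPE(real) n n)"
    unfolding Units_def ring_mat_def using A B AB BA by auto
  then obtain C where C: "mat_inverse A = Some C" using mat_inverse(1)[OF A, of n] by (cases "mat_inverse A") auto
  then have C': "A * C = 1\<^sub>m n" "C \<in> carrier_mat n n" using mat_inverse(2)[OF A] by auto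
  have "B * (A * C) = C"
    using inverse_cancel_left[OF BA, of C] A B C' by auto
  then have "B = C" using C' B by auto
  then show ?thesis using C by (simp add: mat_inv_def)
qed

lemma pd_diagonalization:
  assumes "A \<in> pd_mats n"
  obtains U l where "U \<in> carrier_mat n n" "U\<^sup>T * U = 1\<^sub>m n" "U * U\<^sup>T = 1\<^sub>m n"
    "A = U * mat_diag n l * U\<^sup>T" "\<And>i. i < n \<Longrightarrow> 0 < l i"
proof -
  obtain U l where "eigendecomposition n A U (mat_diag n l)"
    using eigendecomposition_exists[OF pd_sym[OF assms]] by blast
  then have U: "U \<in> carrier_mat n n" "U\<^sup>T * U = 1\<^sub>m n" "A = U * mat_diag n l * U\<^sup>T"
      "U * U\<^sup>T = 1\<^sub>m n"
    by (auto simp: eigendecomposition_def)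
  show ?thesis using that[OF U(1,2,4,3)] pd_eigenvalues[OF assms U(1-3)] by blast
qed

lemma pd_sqrt:
  assumes "A \<in> pd_mats n"
  shows "psd_sqrt A \<in> pd_mats n"
proof -
  obtain U l where U: "U \<in> carrier_mat n n" "U\<^sup>T * U = 1\<^sub>m n" "U * U\<^sup>T = 1\<^sub>m n"
    "A = U * mat_diag n l * U\<^sup>T" and l: "\<And>i. i < n \<Longrightarrow> 0 < l i"
    using pd_diagonalization[OF assms] by blast
  have "U * mat_diag n (\<lambda>i. sqrt (l i)) * U\<^sup>T \<in> pd_mats n"
    using pd_congruence[OF pd_mat_diag, of n "\<lambda>i. sqrt (l i)" "U\<^sup>T" n U] U l by simp
  then show ?thesis using psd_sqrt_eqI[OF spectral_root[OF pd_psd[OF assms] U(1,2,4)]] by simp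
qed

lemma
  assumes A: "A \<in> pd_mats n"
  shows pd_inv: "mat_inv A \<in> pd_mats n"
    and pd_inv_right: "A * mat_inv A = 1\<^sub>m n"
    and pd_inv_left: "mat_inv A * A = 1\<^sub>m n"
proof -
  obtain U l where U: "U \<in> carrier_mat n n" "U\<^sup>T * U = 1\<^sub>m n" "U * U\<^sup>T = 1\<^sub>m n"
    "A = U * mat_diag n l * U\<^sup>T" and l: "\<And>i. i < n \<Longrightarrow> 0 < l i"
    using pd_diagonalization[OF assms] by blast
  note d = pd_matsD[OF A]
  define B where "B = U * mat_diag n (\<lambda>i. 1 / l i) * U\<^sup>T"
  have B: "B \<in> carrier_mat n n" using U(1) by (auto simp: B_def)
  have "mat_diag n (\<lambda>i. l i * (1 / l i)) = 1\<^sub>m n"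
    using l by (intro eq_matI) (auto simp: less_imp_neq[symmetric])
  then have AB: "A * B = 1\<^sub>m n"
    unfolding U(4) B_def orth_cancel[OF U(1,2)] using U(1,3) by simp
  have inv: "mat_inv A = B" using mat_inv_eqI[OF _ B AB] d by auto
  have BA: "B * A = 1\<^sub>m n" by (rule mat_mult_left_right_inverse[OF _ B AB]) (use d in auto)
  have "B\<^sup>T * A * B \<in> pd_mats n"
    by (rule pd_congruence[OF A B _ AB]) (use d in auto)
  moreover have "B\<^sup>T * A * B = B"
  proof -
    have "B\<^sup>T = B" using U(1) by (simp add: B_def ring_dim)
    then show ?thesis using B d by (simp add: mult_assoc_dim AB)
  qed
  ultimately show "mat_inv A \<in> pd_mats n" "A * mat_inv A = 1\<^sub>m n" "mat_inv A * A = 1\<^sub>m n"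
    using inv AB BA by auto
qed

lemma quad_minus_smult_one:
  assumes "A \<in> carrier_mat n n" "v \<in> carrier_vec n"
  shows "v \<bullet> ((A - c \<cdot>\<^sub>m 1\<^sub>m n) *\<^sub>v v) = v \<bullet> (A *\<^sub>v v) - c * (v \<bullet> (v :: real vec))"
proof -
  have "(A - c \<cdot>\<^sub>m 1\<^sub>m n) *\<^sub>v v = A *\<^sub>v v - (c \<cdot>\<^sub>m 1\<^sub>m n) *\<^sub>v v"
    using assms by (intro minus_mult_distrib_mat_vec) auto
  also have "(c \<cdot>\<^sub>m 1\<^sub>m n) *\<^sub>v v = c \<cdot>\<^sub>v v"
    using assms by (intro eq_vecI) auto
  also have "v \<bullet> (A *\<^sub>v v - c \<cdot>\<^sub>v v) = v \<bullet> (A *\<^sub>v v) - v \<bullet> (c \<cdot>\<^sub>v v)"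
    using assms by (intro scalar_prod_minus_distrib[of _ n]) auto
  finally show ?thesis using assms by simp
qed

text \<open>The constant is a lower bound for the eigenvalues; it quantifies positive definiteness in
  the perturbation estimates.\<close>

lemma pd_dominates_scalar:
  assumes "A \<in> pd_mats n"
  shows "\<exists>c>0. A - c \<cdot>\<^sub>m 1\<^sub>m n \<in> psd_mats n"
proof -
  obtain U l where U: "U \<in> carrier_mat n n" "U\<^sup>T * U = 1\<^sub>m n" "U * U\<^sup>T = 1\<^sub>m n"
    "A = U * mat_diag n l * U\<^sup>T" and l: "\<And>i. i < n \<Longrightarrow> 0 < l i"
    using pd_diagonalization[OF assms] by blast
  \<comment> \<open>The extra element keeps the set non-empty when \<open>n = 0\<close>.\<close>
  define c where "c = Min (insert 1 (l ` {..<n}))"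
  have c: "0 < c" "\<And>i. i < n \<Longrightarrow> c \<le> l i" using l by (auto simp: c_def)
  have "U * mat_diag n (\<lambda>i. l i - c) * U\<^sup>T \<in> psd_mats n"
    using psd_congruence[OF psd_mat_diag, of n "\<lambda>i. l i - c" "U\<^sup>T" n] U(1) c by simp
  moreover have "mat_diag n (\<lambda>i. l i - c) = mat_diag n l - c \<cdot>\<^sub>m 1\<^sub>m n" by (intro eq_matI) auto
  then have "U * mat_diag n (\<lambda>i. l i - c) * U\<^sup>T = A - c \<cdot>\<^sub>m 1\<^sub>m n"
    unfolding U(4) using U(1) by (simp add: minus_mult_dim mult_minus_dim mult_smult_dim smult_mult_dim U(3))
  ultimately show ?thesis using c by auto
qed

section \<open>Entrywise convergence of matrices\<close>

text \<open>The dimensions of \<open>X t\<close> are required only eventually, because families of perturbations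
  are constrained for positive times only.\<close>

definition mat_tendsto :: "nat \<Rightarrow> nat \<Rightarrow> ('a \<Rightarrow> real mat) \<Rightarrow> real mat \<Rightarrow> 'a filter \<Rightarrow> bool" where
  "mat_tendsto n m X A F \<longleftrightarrow> A \<in> carrier_mat n m \<and> (\<forall>\<^sub>F t in F. X t \<in> carrier_mat n m) \<and>
     (\<forall>i<n. \<forall>j<m. ((\<lambda>t. X t $$ (i, j)) \<longlongrightarrow> A $$ (i, j)) F)"

lemma mat_tendstoI:
  assumes "A \<in> carrier_mat n m" "\<forall>\<^sub>F t in F. X t \<in> carrier_mat n m"
    "\<And>i j. i < n \<Longrightarrow> j < m \<Longrightarrow> ((\<lambda>t. X t $$ (i, j)) \<longlongrightarrow> A $$ (i, j)) F"
  shows "mat_tendsto n m X A F"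
  using assms by (simp add: mat_tendsto_def)

lemma mat_tendstoD:
  assumes "mat_tendsto n m X A F"
  shows "A \<in> carrier_mat n m" "\<forall>\<^sub>F t in F. X t \<in> carrier_mat n m"
    "\<And>i j. i < n \<Longrightarrow> j < m \<Longrightarrow> ((\<lambda>t. X t $$ (i, j)) \<longlongrightarrow> A $$ (i, j)) F"
  using assms by (simp_all add: mat_tendsto_def)

lemma mat_tendsto_const: "A \<in> carrier_mat n m \<Longrightarrow> mat_tendsto n m (\<lambda>_. A) A F"
  by (simp add: mat_tendsto_def)

lemma mat_tendsto_cong:
  assumes "mat_tendsto n m X A F" "\<forall>\<^sub>F t in F. X t = Y t"
  shows "mat_tendsto n m Y A F"
proof (rule mat_tendstoI)
  show "\<forall>\<^sub>F t in F. Y t \<in> carrier_mat n m"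
    using assms(2) mat_tendstoD(2)[OF assms(1)] by eventually_elim simp
  fix i j assume ij: "i < n" "j < m"
  have "\<forall>\<^sub>F t in F. X t $$ (i, j) = Y t $$ (i, j)" using assms(2) by eventually_elim simp
  then show "((\<lambda>t. Y t $$ (i, j)) \<longlongrightarrow> A $$ (i, j)) F"
    by (rule Lim_transform_eventually[OF mat_tendstoD(3)[OF assms(1) ij]])
qed (rule mat_tendstoD(1)[OF assms(1)])

lemma mat_tendsto_mult:
  assumes X: "mat_tendsto n m X A F" and Y: "mat_tendsto m k Y B F"
  shows "mat_tendsto n k (\<lambda>t. X t * Y t) (A * B) F"
proof (rule mat_tendstoI)
  note d = mat_tendstoD[OF X] mat_tendstoD[OF Y]
  show "A * B \<in> carrier_mat n k" using d by auto
  show "\<forall>\<^sub>F t in F. X t * Y t \<in> carrier_mat n k" using d(2,5) by eventually_elim auto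
  fix i j assume ij: "i < n" "j < k"
  have "((\<lambda>t. \<Sum>l<m. X t $$ (i, l) * Y t $$ (l, j)) \<longlongrightarrow> (\<Sum>l<m. A $$ (i, l) * B $$ (l, j))) F"
    using ij d by (intro tendsto_intros) auto
  moreover have "\<forall>\<^sub>F t in F. (\<Sum>l<m. X t $$ (i, l) * Y t $$ (l, j)) = (X t * Y t) $$ (i, j)"
    using d(2,5) by eventually_elim (use ij in \<open>auto simp: scalar_prod_def atLeast0LessThan\<close>)
  ultimately show "((\<lambda>t. (X t * Y t) $$ (i, j)) \<longlongrightarrow> (A * B) $$ (i, j)) F"
    using ij d(1,4) by (auto simp: scalar_prod_def atLeast0LessThan elim: Lim_transform_eventually)
qed

lemma mat_tendsto_add:
  assumes X: "mat_tendsto n m X A F" and Y: "mat_tendsto n m Y B F"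
  shows "mat_tendsto n m (\<lambda>t. X t + Y t) (A + B) F"
proof (rule mat_tendstoI)
  note d = mat_tendstoD[OF X] mat_tendstoD[OF Y]
  show "A + B \<in> carrier_mat n m" using d by auto
  show "\<forall>\<^sub>F t in F. X t + Y t \<in> carrier_mat n m" using d(2,5) by eventually_elim auto
  fix i j assume ij: "i < n" "j < m"
  have "((\<lambda>t. X t $$ (i, j) + Y t $$ (i, j)) \<longlongrightarrow> A $$ (i, j) + B $$ (i, j)) F"
    using ij d by (intro tendsto_intros) auto
  moreover have "\<forall>\<^sub>F t in F. X t $$ (i, j) + Y t $$ (i, j) = (X t + Y t) $$ (i, j)"
    using d(2,5) by eventually_elim (use ij in auto)
  ultimately show "((\<lambda>t. (X t + Y t) $$ (i, j)) \<longlongrightarrow> (A + B) $$ (i, j)) F"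
    using ij d(1,4) by (auto elim: Lim_transform_eventually)
qed

lemma mat_tendsto_smult:
  assumes c: "(c \<longlongrightarrow> c0) F" and X: "mat_tendsto n m X A F"
  shows "mat_tendsto n m (\<lambda>t. c t \<cdot>\<^sub>m X t) (c0 \<cdot>\<^sub>m A) F"
proof (rule mat_tendstoI)
  note d = mat_tendstoD[OF X]
  show "c0 \<cdot>\<^sub>m A \<in> carrier_mat n m" using d by auto
  show "\<forall>\<^sub>F t in F. c t \<cdot>\<^sub>m X t \<in> carrier_mat n m" using d(2) by eventually_elim auto
  fix i j assume ij: "i < n" "j < m"
  have "((\<lambda>t. c t * X t $$ (i, j)) \<longlongrightarrow> c0 * A $$ (i, j)) F"
    using ij d c by (intro tendsto_intros) auto
  moreover have "\<forall>\<^sub>F t in F. c t * X t $$ (i, j) = (c t \<cdot>\<^sub>m X t) $$ (i, j)"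
    using d(2) by eventually_elim (use ij in auto)
  ultimately show "((\<lambda>t. (c t \<cdot>\<^sub>m X t) $$ (i, j)) \<longlongrightarrow> (c0 \<cdot>\<^sub>m A) $$ (i, j)) F"
    using ij d(1) by (auto elim: Lim_transform_eventually)
qed

lemma mat_tendsto_trace:
  assumes X: "mat_tendsto n n X A F"
  shows "((\<lambda>t. mat_trace (X t)) \<longlongrightarrow> mat_trace A) F"
proof -
  note d = mat_tendstoD[OF X]
  have "((\<lambda>t. \<Sum>i<n. X t $$ (i, i)) \<longlongrightarrow> (\<Sum>i<n. A $$ (i, i))) F"
    using d by (intro tendsto_intros) auto
  moreover have "\<forall>\<^sub>F t in F. (\<Sum>i<n. X t $$ (i, i)) = mat_trace (X t)"
    using d(2) by eventually_elim (auto simp: mat_trace_def)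
  ultimately show ?thesis using d(1) by (auto simp: mat_trace_def elim: Lim_transform_eventually)
qed

lemma tendsto_det:
  assumes X: "mat_tendsto n n X A F"
  shows "((\<lambda>t. det (X t)) \<longlongrightarrow> det A) F"
proof -
  note d = mat_tendstoD[OF X]
  have "((\<lambda>t. \<Sum>p\<in>{p. p permutes {0..<n}}. signof p * (\<Prod>i = 0..<n. X t $$ (i, p i)))
    \<longlongrightarrow> (\<Sum>p\<in>{p. p permutes {0..<n}}. signof p * (\<Prod>i = 0..<n. A $$ (i, p i)))) F"
    by (intro tendsto_intros d(3)) (auto simp: permutes_in_image)
  moreover have "\<forall>\<^sub>F t in F. (\<Sum>p\<in>{p. p permutes {0..<n}}. signof p * (\<Prod>i = 0..<n. X t $$ (i, p i))) = det (X t)"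
    using d(2) by eventually_elim (simp add: det_def')
  ultimately show ?thesis using det_def'[OF d(1)] by (auto elim: Lim_transform_eventually)
qed

lemma mat_tendsto_adjugate:
  assumes X: "mat_tendsto n n X A F"
  shows "mat_tendsto n n (\<lambda>t. adj_mat (X t)) (adj_mat A) F"
proof (rule mat_tendstoI)
  note d = mat_tendstoD[OF X]
  show "adj_mat A \<in> carrier_mat n n" using adj_mat(1)[OF d(1)] .
  show "\<forall>\<^sub>F t in F. adj_mat (X t) \<in> carrier_mat n n"
    using d(2) by eventually_elim (rule adj_mat(1))
  fix i j assume ij: "i < n" "j < n"
  have "mat_tendsto (n - 1) (n - 1) (\<lambda>t. mat_delete (X t) j i) (mat_delete A j i) F"
  proof (rule mat_tendstoI)
    show "mat_delete A j i \<in> carrier_mat (n - 1) (n - 1)" using mat_delete_carrier[OF d(1)] .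
    show "\<forall>\<^sub>F t in F. mat_delete (X t) j i \<in> carrier_mat (n - 1) (n - 1)"
      using d(2) by eventually_elim (rule mat_delete_carrier)
    fix r s assume rs: "r < n - 1" "s < n - 1"
    let ?r = "if r < j then r else Suc r" and ?s = "if s < i then s else Suc s"
    have lim: "((\<lambda>t. X t $$ (?r, ?s)) \<longlongrightarrow> A $$ (?r, ?s)) F" using rs by (intro d(3)) auto
    have ev: "\<forall>\<^sub>F t in F. X t $$ (?r, ?s) = mat_delete (X t) j i $$ (r, s)"
      using d(2) by eventually_elim (use rs in \<open>auto simp: mat_delete_def\<close>)
    have entry: "mat_delete A j i $$ (r, s) = A $$ (?r, ?s)"
      using rs d(1) by (auto simp: mat_delete_def)
    show "((\<lambda>t. mat_delete (X t) j i $$ (r, s)) \<longlongrightarrow> mat_delete A j i $$ (r, s)) F"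
      unfolding entry by (rule Lim_transform_eventually[OF lim ev])
  qed
  then have lim: "((\<lambda>t. cofactor (X t) j i) \<longlongrightarrow> cofactor A j i) F"
    unfolding cofactor_def by (intro tendsto_mult tendsto_const tendsto_det)
  have ev: "\<forall>\<^sub>F t in F. cofactor (X t) j i = adj_mat (X t) $$ (i, j)"
    using d(2) by eventually_elim (use ij in \<open>auto simp: adj_mat_def\<close>)
  have entry: "adj_mat A $$ (i, j) = cofactor A j i" using ij d(1) by (auto simp: adj_mat_def)
  show "((\<lambda>t. adj_mat (X t) $$ (i, j)) \<longlongrightarrow> adj_mat A $$ (i, j)) F"
    unfolding entry by (rule Lim_transform_eventually[OF lim ev])
qed

lemma mat_inv_adjugate:
  assumes "A \<in> carrier_mat n n" "det A \<noteq> 0"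
  shows "mat_inv A = (1 / det A) \<cdot>\<^sub>m adj_mat A"
  using assms adj_mat[OF assms(1)]
  by (intro mat_inv_eqI[OF assms(1)]) (auto simp: mult_smult_distrib[OF assms(1)] intro!: eq_matI)

text \<open>By Cramer's rule the inverse is a rational function of the entries.\<close>

lemma mat_tendsto_inv:
  assumes X: "mat_tendsto n n X A F" and A: "A \<in> pd_mats n"
  shows "mat_tendsto n n (\<lambda>t. mat_inv (X t)) (mat_inv A) F"
proof -
  note d = mat_tendstoD[OF X]
  have "det A * det (mat_inv A) = 1"
    using det_mult[OF d(1), of "mat_inv A"] pd_inv_right[OF A] pd_matsD[OF pd_inv[OF A]] by auto
  then have 0: "det A \<noteq> 0" by auto
  have "mat_tendsto n n (\<lambda>t. (1 / det (X t)) \<cdot>\<^sub>m adj_mat (X t)) ((1 / det A) \<cdot>\<^sub>m adj_mat A) F"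
    by (intro mat_tendsto_smult[OF _ mat_tendsto_adjugate[OF X]] tendsto_divide tendsto_const tendsto_det[OF X] 0)
  moreover have "\<forall>\<^sub>F t in F. (1 / det (X t)) \<cdot>\<^sub>m adj_mat (X t) = mat_inv (X t)"
    using d(2) tendsto_imp_eventually_ne[OF tendsto_det[OF X] 0]
    by eventually_elim (simp add: mat_inv_adjugate)
  ultimately show ?thesis
    unfolding mat_inv_adjugate[OF d(1) 0] by (rule mat_tendsto_cong)
qed

text \<open>A crude operator norm bound, which suffices because it tends to zero with the entries.\<close>

lemma abs_quad_le:
  fixes E :: "real mat"
  assumes E: "E \<in> carrier_mat n n" and v: "v \<in> carrier_vec n"
  shows "\<bar>v \<bullet> (E *\<^sub>v v)\<bar> \<le> (\<Sum>i<n. \<Sum>j<n. \<bar>E $$ (i, j)\<bar>) * (v \<bullet> v)"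
proof -
  have vv: "v \<bullet> v = (\<Sum>i<n. (v $ i)\<^sup>2)" using v by (simp add: scalar_prod_sum power2_eq_square)
  have le: "\<bar>v $ i * v $ j\<bar> \<le> v \<bullet> v" if "i < n" "j < n" for i j
  proof -
    have "(v $ k)\<^sup>2 \<le> v \<bullet> v" if "k < n" for k
      unfolding vv using that by (intro member_le_sum) auto
    then have "\<bar>v $ i\<bar> \<le> sqrt (v \<bullet> v)" "\<bar>v $ j\<bar> \<le> sqrt (v \<bullet> v)"
      using that by (auto intro!: real_le_rsqrt)
    then have "\<bar>v $ i\<bar> * \<bar>v $ j\<bar> \<le> sqrt (v \<bullet> v) * sqrt (v \<bullet> v)"
      by (intro mult_mono) (auto simp: scalar_prod_self_nonneg)
    then show ?thesis by (simp add: abs_mult scalar_prod_self_nonneg)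
  qed
  have "v \<bullet> (E *\<^sub>v v) = (\<Sum>i<n. \<Sum>j<n. E $$ (i, j) * (v $ i * v $ j))"
    using E v carrier_vecD[OF v]
    by (simp add: scalar_prod_sum mult_mat_vec_index sum_distrib_left mult_ac del: index_mult_mat_vec)
  then have "\<bar>v \<bullet> (E *\<^sub>v v)\<bar> \<le> (\<Sum>i<n. \<Sum>j<n. \<bar>E $$ (i, j)\<bar> * \<bar>v $ i * v $ j\<bar>)"
    by (auto simp flip: abs_mult intro!: order_trans[OF sum_abs] sum_mono)
  also have "\<dots> \<le> (\<Sum>i<n. \<Sum>j<n. \<bar>E $$ (i, j)\<bar> * (v \<bullet> v))"
    using le by (intro sum_mono mult_left_mono) auto
  also have "\<dots> = (\<Sum>i<n. \<Sum>j<n. \<bar>E $$ (i, j)\<bar>) * (v \<bullet> v)" by (simp add: sum_distrib_right)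
  finally show ?thesis .
qed

lemma eventually_pd:
  assumes X: "mat_tendsto n n X A F" and A: "A \<in> pd_mats n" and sym: "\<forall>\<^sub>F t in F. X t \<in> sym_mats n"
  shows "\<forall>\<^sub>F t in F. X t \<in> pd_mats n"
proof -
  note d = mat_tendstoD[OF X]
  obtain c where c: "c > 0" "A - c \<cdot>\<^sub>m 1\<^sub>m n \<in> psd_mats n" using pd_dominates_scalar[OF A] by blast
  have "((\<lambda>t. \<Sum>i<n. \<Sum>j<n. \<bar>X t $$ (i, j) - A $$ (i, j)\<bar>) \<longlongrightarrow> (\<Sum>i<n. \<Sum>j<n. \<bar>A $$ (i, j) - A $$ (i, j)\<bar>)) F"
    by (intro tendsto_intros d(3)) auto
  then have "\<forall>\<^sub>F t in F. (\<Sum>i<n. \<Sum>j<n. \<bar>X t $$ (i, j) - A $$ (i, j)\<bar>) < c"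
    using c(1) by (intro order_tendstoD(2)) auto
  then show ?thesis using sym
  proof eventually_elim
    case (elim t)
    have dX: "X t \<in> carrier_mat n n" using elim(2) by (simp add: sym_mats_def)
    have "0 < v \<bullet> (X t *\<^sub>v v)" if v: "v \<in> carrier_vec n" "v \<noteq> 0\<^sub>v n" for v
    proof -
      have "0 < v \<bullet> v"
        using scalar_prod_self_eq_0[OF _ v(1)] scalar_prod_self_nonneg[of v] v(2) by fastforce
      then have "(\<Sum>i<n. \<Sum>j<n. \<bar>X t $$ (i, j) - A $$ (i, j)\<bar>) * (v \<bullet> v) < c * (v \<bullet> v)"
        using elim(1) by simp
      moreover have "\<bar>v \<bullet> ((X t - A) *\<^sub>v v)\<bar> \<le> (\<Sum>i<n. \<Sum>j<n. \<bar>X t $$ (i, j) - A $$ (i, j)\<bar>) * (v \<bullet> v)"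
        using abs_quad_le[OF minus_carrier_mat[OF d(1)] v(1), of "X t"] dX d(1) by simp
      moreover have "v \<bullet> ((X t - A) *\<^sub>v v) = v \<bullet> (X t *\<^sub>v v) - v \<bullet> (A *\<^sub>v v)"
      proof -
        have "(X t - A) *\<^sub>v v = X t *\<^sub>v v - A *\<^sub>v v"
          by (rule minus_mult_distrib_mat_vec[OF dX d(1) v(1)])
        then show ?thesis
          using dX d(1) v(1) by (simp add: scalar_prod_minus_distrib[of _ n])
      qed
      moreover have "0 \<le> v \<bullet> ((A - c \<cdot>\<^sub>m 1\<^sub>m n) *\<^sub>v v)"
        using c(2) v(1) unfolding psd_mats_def by blast
      ultimately show ?thesis using quad_minus_smult_one[OF d(1) v(1), of c] by linarith
    qed
    then show ?case using elim(2) by (auto simp: pd_mats_def)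
  qed
qed

text \<open>Put \<open>E = P - Q\<close> and \<open>D = P\<^sup>2 - Q\<^sup>2\<close>. The identity \<open>square_difference_trace\<close> gives
  \<open>c \<langle>E, E\<rangle> \<le> \<langle>E, D\<rangle>\<close> in the Frobenius inner product; the bound follows from
  \<open>0 \<le> \<langle>c E - D, c E - D\<rangle>\<close>.\<close>

lemma psd_sqrt_lipschitz:
  assumes P: "P \<in> sym_mats n" and Q: "Q \<in> psd_mats n"
    and c: "c > 0" "P - c \<cdot>\<^sub>m 1\<^sub>m n \<in> psd_mats n"
  shows "c\<^sup>2 * (\<Sum>i<n. \<Sum>j<n. ((P - Q) $$ (i, j))\<^sup>2) \<le> (\<Sum>i<n. \<Sum>j<n. ((P * P - Q * Q) $$ (i, j))\<^sup>2)"
proof -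
  define E where "E = P - Q"
  define D where "D = P * P - Q * Q"
  note d = sym_matsD[OF P] psd_matsD[OF Q]
  have E: "E \<in> sym_mats n" unfolding E_def by (intro sym_minus P psd_sym Q)
  have D: "D \<in> sym_mats n" unfolding D_def
    using d by (intro sym_minus) (auto intro!: sym_matsI simp: ring_dim)
  note dE = sym_matsD[OF E] sym_matsD[OF D]
  have "0 \<le> mat_trace (E * (P - c \<cdot>\<^sub>m 1\<^sub>m n) * E)"
    by (rule psd_trace_nonneg[OF psd_sandwich[OF c(2) E]])
  then have "c * mat_trace (E * E) \<le> mat_trace (E * P * E)"
    using d dE by (simp add: ring_dim trace_dim)
  also have "\<dots> \<le> mat_trace (E * D)"
    using square_difference_trace[OF P psd_sym[OF Q]] psd_trace_nonneg[OF psd_sandwich[OF Q E]]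
    by (simp add: E_def D_def)
  finally have 1: "c * (\<Sum>i<n. \<Sum>j<n. (E $$ (i, j))\<^sup>2) \<le> (\<Sum>i<n. \<Sum>j<n. E $$ (i, j) * D $$ (i, j))"
    using dE sym_mats_index[OF D] by (simp add: trace_square_sym[OF E] mat_trace_mult)
  have "0 \<le> (\<Sum>i<n. \<Sum>j<n. (c * E $$ (i, j) - D $$ (i, j))\<^sup>2)" by (auto intro!: sum_nonneg)
  also have "\<dots> = c\<^sup>2 * (\<Sum>i<n. \<Sum>j<n. (E $$ (i, j))\<^sup>2) + (\<Sum>i<n. \<Sum>j<n. (D $$ (i, j))\<^sup>2)
      - 2 * c * (\<Sum>i<n. \<Sum>j<n. E $$ (i, j) * D $$ (i, j))"
    by (simp add: power2_diff sum.distrib sum_subtractf sum_distrib_left power_mult_distrib mult_ac)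
  finally have 2: "0 \<le> c\<^sup>2 * (\<Sum>i<n. \<Sum>j<n. (E $$ (i, j))\<^sup>2) + (\<Sum>i<n. \<Sum>j<n. (D $$ (i, j))\<^sup>2)
      - 2 * c * (\<Sum>i<n. \<Sum>j<n. E $$ (i, j) * D $$ (i, j))" .
  have "c\<^sup>2 * e \<le> f" if "c * e \<le> x" "0 \<le> c\<^sup>2 * e + f - 2 * c * x" for e f x
  proof -
    have "c * (c * e) \<le> c * x" using mult_left_mono[OF that(1), of c] c(1) by linarith
    moreover have "c\<^sup>2 * e = c * (c * e)" "2 * c * x = 2 * (c * x)" by (simp_all add: power2_eq_square)
    ultimately show ?thesis using that(2) by linarith
  qed
  from this[OF 1 2] show ?thesis by (simp add: E_def D_def)
qed

lemma mat_tendsto_sqrt: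
  assumes X: "mat_tendsto n n X A F" and A: "A \<in> pd_mats n" and psd: "\<forall>\<^sub>F t in F. X t \<in> psd_mats n"
  shows "mat_tendsto n n (\<lambda>t. psd_sqrt (X t)) (psd_sqrt A) F"
proof (rule mat_tendstoI)
  note d = mat_tendstoD[OF X]
  have P: "psd_sqrt A \<in> pd_mats n" by (rule pd_sqrt[OF A])
  note dP = pd_matsD[OF P]
  show "psd_sqrt A \<in> carrier_mat n n" using dP by auto
  show "\<forall>\<^sub>F t in F. psd_sqrt (X t) \<in> carrier_mat n n"
    using psd by eventually_elim (metis carrier_matI psd_matsD(1,2) psd_sqrt_psd)
  obtain c where c: "c > 0" "psd_sqrt A - c \<cdot>\<^sub>m 1\<^sub>m n \<in> psd_mats n"
    using pd_dominates_scalar[OF P] by blast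
  have lim: "((\<lambda>t. (\<Sum>i<n. \<Sum>j<n. (A $$ (i, j) - X t $$ (i, j))\<^sup>2) / c\<^sup>2) \<longlongrightarrow>
      (\<Sum>i<n. \<Sum>j<n. (A $$ (i, j) - A $$ (i, j))\<^sup>2) / c\<^sup>2) F"
    using c(1) by (intro tendsto_intros d(3)) auto
  fix i j assume ij: "i < n" "j < n"
  have "((\<lambda>t. (psd_sqrt A $$ (i, j) - psd_sqrt (X t) $$ (i, j))\<^sup>2) \<longlongrightarrow> 0) F"
  proof (rule tendsto_sandwich[OF _ _ tendsto_const])
    show "((\<lambda>t. (\<Sum>i<n. \<Sum>j<n. (A $$ (i, j) - X t $$ (i, j))\<^sup>2) / c\<^sup>2) \<longlongrightarrow> 0) F" using lim by simp
    show "\<forall>\<^sub>F t in F. (psd_sqrt A $$ (i, j) - psd_sqrt (X t) $$ (i, j))\<^sup>2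
        \<le> (\<Sum>i<n. \<Sum>j<n. (A $$ (i, j) - X t $$ (i, j))\<^sup>2) / c\<^sup>2"
      using psd
    proof eventually_elim
      case (elim t)
      let ?Q = "psd_sqrt (X t)"
      note Q = psd_sqrt_psd[OF elim] psd_sqrt_square[OF elim]
      have "(psd_sqrt A $$ (i, j) - ?Q $$ (i, j))\<^sup>2 \<le> (\<Sum>j<n. (psd_sqrt A $$ (i, j) - ?Q $$ (i, j))\<^sup>2)"
        using ij by (intro member_le_sum) auto
      also have "\<dots> \<le> (\<Sum>i<n. \<Sum>j<n. (psd_sqrt A $$ (i, j) - ?Q $$ (i, j))\<^sup>2)"
        using ij by (intro member_le_sum[of i _ "\<lambda>i. \<Sum>j<n. (psd_sqrt A $$ (i, j) - ?Q $$ (i, j))\<^sup>2"]) (auto intro: sum_nonneg)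
      finally have "c\<^sup>2 * (psd_sqrt A $$ (i, j) - ?Q $$ (i, j))\<^sup>2
          \<le> c\<^sup>2 * (\<Sum>i<n. \<Sum>j<n. (psd_sqrt A $$ (i, j) - ?Q $$ (i, j))\<^sup>2)"
        by (intro mult_left_mono) auto
      also have "\<dots> \<le> (\<Sum>i<n. \<Sum>j<n. (A $$ (i, j) - X t $$ (i, j))\<^sup>2)"
        using psd_sqrt_lipschitz[OF pd_sym[OF P] Q(1) c] psd_matsD[OF Q(1)] psd_matsD[OF elim]
        by (simp add: Q(2) psd_sqrt_square[OF pd_psd[OF A]])
      finally show ?case using c(1) by (simp add: field_simps)
    qed
  qed auto
  then have "((\<lambda>t. sqrt ((psd_sqrt A $$ (i, j) - psd_sqrt (X t) $$ (i, j))\<^sup>2)) \<longlongrightarrow> sqrt 0) F"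
    by (rule tendsto_real_sqrt)
  then have "((\<lambda>t. psd_sqrt A $$ (i, j) - psd_sqrt (X t) $$ (i, j)) \<longlongrightarrow> 0) F"
    by (simp add: tendsto_rabs_zero_iff)
  from tendsto_diff[OF tendsto_const[of "psd_sqrt A $$ (i, j)"] this]
  show "((\<lambda>t. psd_sqrt (X t) $$ (i, j)) \<longlongrightarrow> psd_sqrt A $$ (i, j)) F" by simp
qed

section \<open>The block diagonal part\<close>

lemma upper_left_dims [simp]: "dim_row (upper_left r c A) = r" "dim_col (upper_left r c A) = c"
  by (simp_all add: upper_left_def split_block_def Let_def)

lemma upper_left_index [simp]: "i < r \<Longrightarrow> j < c \<Longrightarrow> upper_left r c A $$ (i, j) = A $$ (i, j)"
  by (simp add: upper_left_def split_block_def Let_def)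

lemma lower_right_dims [simp]:
  "dim_row (lower_right r c A) = dim_row A - r" "dim_col (lower_right r c A) = dim_col A - c"
  by (simp_all add: lower_right_def split_block_def Let_def)

lemma lower_right_index [simp]:
  "i < dim_row A - r \<Longrightarrow> j < dim_col A - c \<Longrightarrow> lower_right r c A $$ (i, j) = A $$ (i + r, j + c)"
  by (simp add: lower_right_def split_block_def Let_def)

lemma diag_block_mat_pair: "diag_block_mat [A, B] = four_block_mat A (0\<^sub>m (dim_row A) (dim_col B)) (0\<^sub>m (dim_row B) (dim_col A)) B"
  by (simp only: diag_block_mat.simps(2)[of A "[B]"] diag_block_mat_singleton Let_def)

lemma diag_part_dims [simp]:
  "A \<in> carrier_mat (p + q) (p + q) \<Longrightarrow> dim_row (diag_part p A) = p + q"
  "A \<in> carrier_mat (p + q) (p + q) \<Longrightarrow> dim_col (diag_part p A) = p + q"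
  by (auto simp: diag_part_def diag_block_mat_pair simp del: diag_block_mat.simps)

lemma diag_part_index:
  assumes "A \<in> carrier_mat (p + q) (p + q)" "i < p + q" "j < p + q"
  shows "diag_part p A $$ (i, j) = (if (i < p) = (j < p) then A $$ (i, j) else 0)"
  using assms by (auto simp: diag_part_def diag_block_mat_pair simp del: diag_block_mat.simps)

text \<open>The block diagonal part of \<open>A\<close> is the mean of \<open>A\<close> and \<open>R A R\<close> with this reflection \<open>R\<close>,
  which makes positive definiteness and continuity of \<^const>\<open>diag_part\<close> evident.\<close>

definition block_reflection :: "nat \<Rightarrow> nat \<Rightarrow> real mat" where
  "block_reflection p n = mat_diag n (\<lambda>i. if i < p then 1 else - 1)"

lemma block_reflection_dims [simp]:
  "dim_row (block_reflection p n) = n" "dim_col (block_reflection p n) = n"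
  by (simp_all add: block_reflection_def)

lemma block_reflection_transpose [simp]: "transpose_mat (block_reflection p n) = block_reflection p n"
  by (simp add: block_reflection_def)

lemma block_reflection_square: "block_reflection p n * block_reflection p n = 1\<^sub>m n"
  unfolding block_reflection_def mat_diag_diag by (rule eq_matI) auto

lemma block_reflection_carrier: "block_reflection p n \<in> carrier_mat n n"
  by (auto intro!: carrier_matI)

lemma diag_part_reflection:
  assumes A: "A \<in> carrier_mat (p + q) (p + q)"
  shows "diag_part p A = (1 / 2) \<cdot>\<^sub>m (A + block_reflection p (p + q) * A * block_reflection p (p + q))"
proof (rule eq_matI)
  let ?n = "p + q" let ?R = "block_reflection p ?n"
  let ?e = "\<lambda>i. if i < p then 1 else - 1 :: real"
  fix i j assume "i < dim_row ((1 / 2) \<cdot>\<^sub>m (A + ?R * A * ?R))" "j < dim_col ((1 / 2) \<cdot>\<^sub>m (A + ?R * A * ?R))"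
  then have ij: "i < p + q" "j < p + q" using A by auto
  have "?R * A * ?R = mat ?n ?n (\<lambda>(i, j). ?e i * A $$ (i, j) * ?e j)"
    using A unfolding block_reflection_def mat_diag_mult_left[OF A]
    by (subst mat_diag_mult_right[of _ ?n ?n]) (auto intro!: eq_matI)
  then show "diag_part p A $$ (i, j) = ((1 / 2) \<cdot>\<^sub>m (A + ?R * A * ?R)) $$ (i, j)"
    using ij A by (subst diag_part_index[OF A]) auto
qed (use A in auto)

lemma diag_part_pd:
  assumes A: "A \<in> pd_mats (p + q)"
  shows "diag_part p A \<in> pd_mats (p + q)"
proof -
  let ?R = "block_reflection p (p + q)"
  have c: "A \<in> carrier_mat (p + q) (p + q)" using A by (auto simp: pd_mats_def sym_mats_def)
  have "?R * A * ?R \<in> pd_mats (p + q)"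
    using pd_congruence[OF A block_reflection_carrier block_reflection_carrier block_reflection_square] by simp
  then show ?thesis unfolding diag_part_reflection[OF c] using A by (intro pd_smult pd_add) auto
qed

lemma diag_part_trace:
  assumes "A \<in> carrier_mat (p + q) (p + q)"
  shows "mat_trace (diag_part p A) = mat_trace A"
  using assms by (auto simp: mat_trace_def diag_part_index[OF assms])

lemma diag_part_trace_mult:
  assumes A: "A \<in> carrier_mat (p + q) (p + q)" and B: "B \<in> carrier_mat (p + q) (p + q)"
  shows "mat_trace (diag_part p A * B) = mat_trace (diag_part p B * A)"
  using A B diag_part_dims[OF A] diag_part_dims[OF B]
  by (auto simp: mat_trace_mult diag_part_index[OF A] diag_part_index[OF B])
    (subst sum.swap, auto intro!: sum.cong)

lemma diag_part_add_smult:
  assumes A: "A \<in> carrier_mat (p + q) (p + q)" and B: "B \<in> carrier_mat (p + q) (p + q)"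
  shows "diag_part p (A + t \<cdot>\<^sub>m B) = diag_part p A + t \<cdot>\<^sub>m diag_part p B"
proof -
  have AB: "A + t \<cdot>\<^sub>m B \<in> carrier_mat (p + q) (p + q)" using A B by auto
  show ?thesis
    using A B by (intro eq_matI) (auto simp: diag_part_index[OF A] diag_part_index[OF B] diag_part_index[OF AB] diag_part_dims[OF AB] simp del: diag_part_dims
      simp: diag_part_dims[OF A] diag_part_dims[OF B])
qed

lemma mat_tendsto_diag_part:
  assumes X: "mat_tendsto (p + q) (p + q) X A F"
  shows "mat_tendsto (p + q) (p + q) (\<lambda>t. diag_part p (X t)) (diag_part p A) F"
proof (rule mat_tendsto_cong)
  note d = mat_tendstoD[OF X]
  let ?R = "block_reflection p (p + q)"
  show "mat_tendsto (p + q) (p + q) (\<lambda>t. (1 / 2) \<cdot>\<^sub>m (X t + ?R * X t * ?R)) (diag_part p A) F"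
    unfolding diag_part_reflection[OF d(1)]
    by (intro mat_tendsto_smult mat_tendsto_add mat_tendsto_mult[where m = "p + q"] mat_tendsto_const X
        block_reflection_carrier tendsto_const)
  show "\<forall>\<^sub>F t in F. (1 / 2) \<cdot>\<^sub>m (X t + ?R * X t * ?R) = diag_part p (X t)"
    using d(2) by eventually_elim (simp add: diag_part_reflection)
qed

section \<open>The optimal transport map between centred Gaussians\<close>

text \<open>The root of \<open>A\<^sup>1\<^sup>/\<^sup>2 B A\<^sup>1\<^sup>/\<^sup>2\<close> is \<open>A\<^sup>1\<^sup>/\<^sup>2 J\<^sup>-\<^sup>1 A\<^sup>1\<^sup>/\<^sup>2\<close>: squaring the latter produces \<open>J\<^sup>-\<^sup>1 A J\<^sup>-\<^sup>1 = B\<close>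
  in the middle.\<close>

lemma trace_sqrt_transport:
  assumes A: "A \<in> psd_mats n" and B: "B \<in> psd_mats n" and J: "J \<in> pd_mats n" and eq: "J * B * J = A"
  shows "mat_trace (psd_sqrt (psd_sqrt A * B * psd_sqrt A)) = mat_trace (B * J)"
proof -
  define R where "R = psd_sqrt A"
  have R: "R \<in> psd_mats n" "R * R = A" using psd_sqrt_psd[OF A] psd_sqrt_square[OF A] by (simp_all add: R_def)
  let ?Ji = "mat_inv J"
  note d = psd_matsD[OF R(1)] psd_matsD[OF B] pd_matsD[OF J] pd_matsD[OF pd_inv[OF J]]
  note J_left = pd_inv_left[OF J] and J_right = pd_inv_right[OF J]
  have K: "R * ?Ji * R \<in> psd_mats n"
    by (rule psd_sandwich[OF pd_psd[OF pd_inv[OF J]] psd_sym[OF R(1)]])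
  have RR: "R * (R * X) = J * (B * (J * X))" if "dim_row X = n" for X
  proof -
    have "R * (R * X) = A * X" using d that by (simp add: R(2)[symmetric] mult_assoc_dim)
    then show ?thesis using d that by (simp add: eq[symmetric] mult_assoc_dim)
  qed
  have "(R * ?Ji * R) * (R * ?Ji * R) = R * B * R"
    using d by (simp add: mult_assoc_dim RR inverse_cancel_left[OF J_left] inverse_cancel_left[OF J_right])
  then have "psd_sqrt (R * B * R) = R * ?Ji * R" by (rule psd_sqrt_eqI[OF K])
  moreover have "mat_trace (R * ?Ji * R) = mat_trace (B * J)"
  proof -
    have "mat_trace (R * ?Ji * R) = mat_trace (?Ji * (R * R))"
      using d mat_trace_commute[of R "?Ji * R"] by (simp add: mult_assoc_dim)
    also have "?Ji * (R * R) = B * J"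
      unfolding R(2) eq[symmetric] using d by (simp add: mult_assoc_dim inverse_cancel_left[OF J_left])
    finally show ?thesis .
  qed
  ultimately show ?thesis by (simp add: R_def)
qed

text \<open>The variational formula for the fidelity: the right-hand side is linear in \<open>A\<close> and \<open>B\<close>,
  and at \<open>Z = J\<close> it equals the left-hand side. The difference of the two sides is the trace
  of \<open>B (J - Z) Z\<^sup>-\<^sup>1 (J - Z)\<close>.\<close>

lemma transport_trace_le:
  assumes B: "B \<in> psd_mats n" and J: "J \<in> pd_mats n" and eq: "J * B * J = A" and Z: "Z \<in> pd_mats n"
  shows "2 * mat_trace (B * J) \<le> mat_trace (A * mat_inv Z) + mat_trace (B * Z)"
proof -
  let ?Zi = "mat_inv Z"
  note d = psd_matsD[OF B] pd_matsD[OF J] pd_matsD[OF Z] pd_matsD[OF pd_inv[OF Z]]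
  note Z_left = pd_inv_left[OF Z] and Z_right = pd_inv_right[OF Z]
  have "J - Z \<in> sym_mats n" by (intro sym_minus pd_sym J Z)
  then have "(J - Z) * ?Zi * (J - Z) \<in> psd_mats n" by (rule psd_sandwich[OF pd_psd[OF pd_inv[OF Z]]])
  then have "0 \<le> mat_trace (B * ((J - Z) * ?Zi * (J - Z)))" by (rule trace_product_psd_nonneg[OF B])
  also have "B * ((J - Z) * ?Zi * (J - Z)) = B * (J * (?Zi * J)) - B * J - (B * J - B * Z)"
    using d by (simp add: ring_dim Z_left Z_right inverse_cancel_left[OF Z_left] inverse_cancel_left[OF Z_right])
  also have "mat_trace \<dots> = mat_trace (B * (J * (?Zi * J))) - 2 * mat_trace (B * J) + mat_trace (B * Z)"
    using d by (simp add: trace_dim)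
  also have "mat_trace (B * (J * (?Zi * J))) = mat_trace (A * ?Zi)"
    unfolding eq[symmetric] using d mat_trace_commute[of "B * (J * ?Zi)" J] by (simp add: mult_assoc_dim)
  finally show ?thesis by simp
qed

lemma
  assumes S: "S \<in> pd_mats (p + q)"
  shows J_mat_pd: "J_mat p S \<in> pd_mats (p + q)"
    and J_mat_transports: "J_mat p S * diag_part p S * J_mat p S = S"
proof -
  let ?n = "p + q"
  define R where "R = psd_sqrt (diag_part p S)"
  have B: "diag_part p S \<in> pd_mats ?n" by (rule diag_part_pd[OF S])
  have R: "R \<in> pd_mats ?n" "R * R = diag_part p S"
    using pd_sqrt[OF B] psd_sqrt_square[OF pd_psd[OF B]] by (simp_all add: R_def)
  let ?Ri = "mat_inv R"
  note d = pd_matsD[OF R(1)] pd_matsD[OF S] pd_matsD[OF pd_inv[OF R(1)]]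
  note R_left = pd_inv_left[OF R(1)] and R_right = pd_inv_right[OF R(1)]
  have c: "R \<in> carrier_mat ?n ?n" "?Ri \<in> carrier_mat ?n ?n" using d by auto
  have M: "R * S * R \<in> pd_mats ?n"
    using pd_congruence[OF S c R_left] d by simp
  define K where "K = psd_sqrt (R * S * R)"
  have K: "K \<in> pd_mats ?n" "K * K = R * S * R"
    using pd_sqrt[OF M] psd_sqrt_square[OF pd_psd[OF M]] by (simp_all add: K_def)
  note dK = pd_matsD[OF K(1)]
  have J: "J_mat p S = ?Ri * K * ?Ri" by (simp add: J_mat_def R_def K_def Let_def)
  show "J_mat p S \<in> pd_mats ?n"
    unfolding J using pd_congruence[OF K(1) c(2,1) R_right] d by simp
  have KK: "K * (K * X) = R * (S * (R * X))" if "dim_row X = ?n" for X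
  proof -
    have "K * (K * X) = (K * K) * X" using dK that by (simp add: mult_assoc_dim)
    then show ?thesis unfolding K(2) using d that by (simp add: mult_assoc_dim)
  qed
  show "J_mat p S * diag_part p S * J_mat p S = S"
    unfolding J R(2)[symmetric] using d dK
    by (simp add: mult_assoc_dim KK inverse_cancel_left[OF R_left] inverse_cancel_left[OF R_right] R_left R_right)
qed

text \<open>The trace of \<open>(S\<^sup>1\<^sup>/\<^sup>2 S\<^sub>0 S\<^sup>1\<^sup>/\<^sup>2)\<^sup>1\<^sup>/\<^sup>2\<close> for positive definite \<open>S\<close>, expressed through the
  transport map so that the variational formula applies.\<close>

definition fidelity :: "nat \<Rightarrow> real mat \<Rightarrow> real" where
  "fidelity p S = mat_trace (diag_part p S * J_mat p S)"

lemma dW2_diag_part: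
  assumes S: "S \<in> pd_mats (p + q)"
  shows "dW2 S (diag_part p S) = 2 * mat_trace S - 2 * fidelity p S"
proof -
  have "S \<in> carrier_mat (p + q) (p + q)" using pd_matsD[OF S] by auto
  then show ?thesis
    using trace_sqrt_transport[OF pd_psd[OF S] pd_psd[OF diag_part_pd[OF S]] J_mat_pd[OF S] J_mat_transports[OF S]]
    by (simp add: dW2_def fidelity_def diag_part_trace)
qed

lemma fidelity_eq:
  assumes S: "S \<in> pd_mats (p + q)"
  shows "2 * fidelity p S = mat_trace (S * mat_inv (J_mat p S)) + mat_trace (diag_part p S * J_mat p S)"
proof -
  note J = J_mat_pd[OF S] and dd = pd_matsD[OF diag_part_pd[OF S]]
  note d = pd_matsD[OF J] pd_matsD[OF pd_inv[OF J]]
  have "mat_trace (S * mat_inv (J_mat p S)) = mat_trace (J_mat p S * diag_part p S * J_mat p S * mat_inv (J_mat p S))"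
    by (simp add: J_mat_transports[OF S])
  also have "\<dots> = mat_trace (diag_part p S * J_mat p S)"
    using d dd mat_trace_commute[of "J_mat p S" "diag_part p S"]
    by (simp add: mult_assoc_dim pd_inv_right[OF J])
  finally show ?thesis by (simp add: fidelity_def)
qed

lemma mat_tendsto_J_mat:
  assumes X: "mat_tendsto (p + q) (p + q) X S F" and S: "S \<in> pd_mats (p + q)"
    and pd: "\<forall>\<^sub>F t in F. X t \<in> pd_mats (p + q)"
  shows "mat_tendsto (p + q) (p + q) (\<lambda>t. J_mat p (X t)) (J_mat p S) F"
proof -
  let ?n = "p + q"
  have B: "diag_part p S \<in> pd_mats ?n" by (rule diag_part_pd[OF S])
  have R: "mat_tendsto ?n ?n (\<lambda>t. psd_sqrt (diag_part p (X t))) (psd_sqrt (diag_part p S)) F"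
    by (rule mat_tendsto_sqrt[OF mat_tendsto_diag_part[OF X] B])
      (use pd in eventually_elim, rule pd_psd[OF diag_part_pd])
  note Ri = mat_tendsto_inv[OF R pd_sqrt[OF B]]
  have M: "R * T * R \<in> pd_mats ?n" if "R \<in> pd_mats ?n" "T \<in> pd_mats ?n" for R T
    using pd_congruence[OF that(2) _ _ pd_inv_left[OF that(1)]] pd_matsD[OF that(1)] pd_matsD[OF pd_inv[OF that(1)]]
    by (metis carrier_matI)
  have "mat_tendsto ?n ?n (\<lambda>t. psd_sqrt (psd_sqrt (diag_part p (X t)) * X t * psd_sqrt (diag_part p (X t))))
      (psd_sqrt (psd_sqrt (diag_part p S) * S * psd_sqrt (diag_part p S))) F"
    by (rule mat_tendsto_sqrt[OF mat_tendsto_mult[OF mat_tendsto_mult[OF R X] R] M[OF pd_sqrt[OF B] S]])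
      (use pd in eventually_elim, intro pd_psd M pd_sqrt diag_part_pd)
  from mat_tendsto_mult[OF mat_tendsto_mult[OF Ri this] Ri]
  show ?thesis by (simp add: J_mat_def Let_def)
qed

text \<open>The right-hand side of the variational formula is linear in the matrix. Its value at the
  perturbed matrix with \<open>Z = J\<close>, and at \<open>S\<close> with \<open>Z\<close> the transport map of the perturbed
  matrix, bound the difference quotient from above and from below by the same expression
  \<open>g\<close>, evaluated at two maps with a common limit.\<close>

lemma fidelity_derivative:
  assumes S: "S \<in> pd_mats (p + q)" and H: "\<And>t. 0 < t \<Longrightarrow> H t \<in> sym_mats (p + q)"
    and lim: "mat_tendsto (p + q) (p + q) H K (at_right 0)"
    and pd: "\<forall>\<^sub>F t in at_right 0. S + t \<cdot>\<^sub>m H t \<in> pd_mats (p + q)"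
    and St: "mat_tendsto (p + q) (p + q) (\<lambda>t. S + t \<cdot>\<^sub>m H t) S (at_right 0)"
  shows "((\<lambda>t. (fidelity p (S + t \<cdot>\<^sub>m H t) - fidelity p S) / t) \<longlongrightarrow>
    mat_trace ((diag_part p (J_mat p S) + mat_inv (J_mat p S)) * K) / 2) (at_right 0)"
proof -
  let ?n = "p + q"
  let ?J = "\<lambda>t. J_mat p (S + t \<cdot>\<^sub>m H t)"
  define g where "g Z T = (mat_trace (T * mat_inv Z) + mat_trace (diag_part p T * Z)) / 2" for Z T
  have dS: "S \<in> carrier_mat ?n ?n" using pd_matsD[OF S] by auto
  have dK: "K \<in> carrier_mat ?n ?n" by (rule mat_tendstoD(1)[OF lim])
  note J = J_mat_pd[OF S]
  have g_lin: "g Z (S + t \<cdot>\<^sub>m T) = g Z S + t * g Z T" if "Z \<in> pd_mats ?n" "T \<in> carrier_mat ?n ?n" for Z T t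
    using that dS diag_part_dims[OF that(2)] diag_part_dims[OF dS] pd_matsD[OF that(1)] pd_matsD[OF pd_inv[OF that(1)]]
    by (simp add: g_def diag_part_add_smult[OF dS that(2)] add_mult_dim smult_mult_dim trace_dim field_simps)
  have g_lim: "((\<lambda>t. g (Z t) (H t)) \<longlongrightarrow> g (J_mat p S) K) (at_right 0)"
    if "mat_tendsto ?n ?n Z (J_mat p S) (at_right 0)" for Z
    unfolding g_def
    by (intro tendsto_divide tendsto_add mat_tendsto_trace[of ?n] mat_tendsto_mult[where m = ?n]
        mat_tendsto_inv that lim J mat_tendsto_diag_part tendsto_const) simp
  have val: "g (J_mat p S) K = mat_trace ((diag_part p (J_mat p S) + mat_inv (J_mat p S)) * K) / 2"
  proof -
    note d = pd_matsD[OF J] pd_matsD[OF pd_inv[OF J]]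
    have c: "J_mat p S \<in> carrier_mat ?n ?n" using d by auto
    show ?thesis
      using d dK diag_part_dims[OF c] mat_trace_commute[of K "mat_inv (J_mat p S)"]
      by (simp add: g_def add_mult_dim trace_dim diag_part_trace_mult[OF dK c])
  qed
  have "((\<lambda>t. (fidelity p (S + t \<cdot>\<^sub>m H t) - fidelity p S) / t) \<longlongrightarrow> g (J_mat p S) K) (at_right 0)"
  proof (rule tendsto_sandwich)
    have pos: "\<forall>\<^sub>F t in at_right (0 :: real). 0 < t" by (rule eventually_at_right_less)
    show "((\<lambda>t. g (?J t) (H t)) \<longlongrightarrow> g (J_mat p S) K) (at_right 0)"
      by (rule g_lim[OF mat_tendsto_J_mat[OF St S pd]])
    show "((\<lambda>t. g (J_mat p S) (H t)) \<longlongrightarrow> g (J_mat p S) K) (at_right 0)"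
      by (rule g_lim[OF mat_tendsto_const]) (use pd_matsD[OF J] in auto)
    show "\<forall>\<^sub>F t in at_right 0. g (?J t) (H t) \<le> (fidelity p (S + t \<cdot>\<^sub>m H t) - fidelity p S) / t"
      using pos pd
    proof eventually_elim
      case (elim t)
      have "H t \<in> carrier_mat ?n ?n" using H[OF elim(1)] by (simp add: sym_mats_def)
      then have "g (?J t) (S + t \<cdot>\<^sub>m H t) = g (?J t) S + t * g (?J t) (H t)"
        by (rule g_lin[OF J_mat_pd[OF elim(2)]])
      moreover have "fidelity p (S + t \<cdot>\<^sub>m H t) = g (?J t) (S + t \<cdot>\<^sub>m H t)"
        using fidelity_eq[OF elim(2)] by (simp add: g_def)
      moreover have "fidelity p S \<le> g (?J t) S"
        using transport_trace_le[OF pd_psd[OF diag_part_pd[OF S]] J J_mat_transports[OF S] J_mat_pd[OF elim(2)]]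
        by (simp add: g_def fidelity_def)
      ultimately show ?case using elim(1) by (simp add: field_simps)
    qed
    show "\<forall>\<^sub>F t in at_right 0. (fidelity p (S + t \<cdot>\<^sub>m H t) - fidelity p S) / t \<le> g (J_mat p S) (H t)"
      using pos pd
    proof eventually_elim
      case (elim t)
      have "H t \<in> carrier_mat ?n ?n" using H[OF elim(1)] by (simp add: sym_mats_def)
      then have "g (J_mat p S) (S + t \<cdot>\<^sub>m H t) = fidelity p S + t * g (J_mat p S) (H t)"
        using fidelity_eq[OF S] g_lin[OF J] by (simp add: g_def)
      moreover have "fidelity p (S + t \<cdot>\<^sub>m H t) \<le> g (J_mat p S) (S + t \<cdot>\<^sub>m H t)"
        using transport_trace_le[OF pd_psd[OF diag_part_pd[OF elim(2)]] J_mat_pd[OF elim(2)] J_mat_transports[OF elim(2)] J]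
        by (simp add: g_def fidelity_def)
      ultimately show ?case using elim(1) by (simp add: field_simps)
    qed
  qed
  then show ?thesis unfolding val .
qed

section \<open>Perturbation of simple eigenvalues\<close>

text \<open>The bathtub principle. With \<open>c\<close> the \<open>m\<close>-th largest value, \<open>(z\<^sub>k - c) w\<^sub>k\<close> is at most
  \<open>z\<^sub>k - c\<close> for \<open>k < m\<close> and at most zero afterwards.\<close>

lemma weighted_sum_le_leading_sum:
  fixes z w :: "nat \<Rightarrow> real"
  assumes z: "\<And>i j. i \<le> j \<Longrightarrow> j < n \<Longrightarrow> z j \<le> z i"
    and w: "\<And>k. k < n \<Longrightarrow> 0 \<le> w k" "\<And>k. k < n \<Longrightarrow> w k \<le> 1"
    and sum: "(\<Sum>k<n. w k) = real m" and m: "m \<le> n"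
  shows "(\<Sum>k<n. z k * w k) \<le> (\<Sum>k<m. z k)"
proof (cases m)
  case 0
  then have "\<forall>k<n. w k = 0" using sum w(1) sum_nonneg_eq_0_iff[of "{..<n}" w] by auto
  then show ?thesis using 0 by simp
next
  case (Suc m')
  define c where "c = z m'"
  have "(\<Sum>k<n. z k * w k) = (\<Sum>k<n. (z k - c) * w k) + c * real m"
    unfolding sum[symmetric] by (simp add: sum_distrib_left sum.distrib[symmetric] algebra_simps)
  also have "(\<Sum>k<n. (z k - c) * w k) \<le> (\<Sum>k<n. if k < m then z k - c else 0)"
  proof (rule sum_mono)
    fix k assume "k \<in> {..<n}"
    then have k: "k < n" by simp
    show "(z k - c) * w k \<le> (if k < m then z k - c else 0)"
    proof (cases "k < m")
      case True
      then have "0 \<le> z k - c" using z[of k m'] Suc m by (simp add: c_def)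
      then show ?thesis using True mult_left_mono[OF w(2)[OF k], of "z k - c"] by simp
    next
      case False
      then have "z k - c \<le> 0" using z[of m' k] Suc k by (simp add: c_def)
      then show ?thesis using False w(1)[OF k] by (simp add: mult_nonpos_nonneg)
    qed
  qed
  also have "(\<Sum>k<n. if k < m then z k - c else 0) = (\<Sum>k<m. z k - c)"
    by (rule sum.mono_neutral_cong_right) (use m in auto)
  also have "\<dots> = (\<Sum>k<m. z k) - c * real m" by (simp add: sum_subtractf)
  finally show ?thesis by simp
qed

lemma orthonormal_columns:
  fixes W :: "real mat"
  assumes "W \<in> carrier_mat n m" "W\<^sup>T * W = 1\<^sub>m m" "i < m" "j < m"
  shows "(\<Sum>k<n. W $$ (k, i) * W $$ (k, j)) = (if i = j then 1 else 0)"
proof -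
  have "(W\<^sup>T * W) $$ (i, j) = (\<Sum>k<n. W $$ (k, i) * W $$ (k, j))"
    using assms(1,3,4) by (subst mult_mat_index) auto
  then show ?thesis using assms by simp
qed

lemma orthonormal_columns_square:
  fixes W :: "real mat"
  assumes "W \<in> carrier_mat n m" "W\<^sup>T * W = 1\<^sub>m m" "i < m"
  shows "(\<Sum>k<n. (W $$ (k, i))\<^sup>2) = 1"
  using orthonormal_columns[OF assms(1,2,3,3)] by (simp add: power2_eq_square)

lemma quad_column:
  fixes V A :: "real mat"
  assumes "V \<in> carrier_mat n m" "A \<in> carrier_mat n n" "i < m"
  shows "(V\<^sup>T * A * V) $$ (i, i) = col V i \<bullet> (A *\<^sub>v col V i)"
  using assms unfolding mult_mat_vec_def by (simp add: mult_assoc_dim)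

text \<open>Ky Fan's principle. In the eigenbasis of \<open>B\<close> the sum of the first \<open>k\<close> eigenvalues of \<open>B\<close>
  is a sum of diagonal entries of \<open>A\<close> plus an error. The diagonal entries of \<open>A\<close> are
  averages of its eigenvalues with weights that are squares of the entries of an orthogonal
  matrix, so the first \<open>k\<close> of them sum to at most the sum of the \<open>k\<close> largest eigenvalues.\<close>

lemma eigenvalue_sum_perturbation:
  assumes A: "eigendecomposition n A U (mat_diag n l)" and B: "eigendecomposition n B V (mat_diag n m)"
    and k: "k \<le> n"
  shows "(\<Sum>i<k. m i) \<le> (\<Sum>i<k. l i) + real k * (\<Sum>i<n. \<Sum>j<n. \<bar>(B - A) $$ (i, j)\<bar>)"
proof -
  note U = eigendecompositionD(1,2,4,3)[OF A] and V = eigendecompositionD(1,2,4,3)[OF B]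
  note l = eigendecompositionD(6)[OF A]
  define W where "W = U\<^sup>T * V"
  have W: "W \<in> carrier_mat n n" "W\<^sup>T \<in> carrier_mat n n"
    using U V by (auto simp: W_def)
  have WW: "W\<^sup>T * W = 1\<^sub>m n" "transpose_mat (W\<^sup>T) * W\<^sup>T = 1\<^sub>m n"
    using U V by (simp_all add: W_def ring_dim inverse_cancel_left[OF U(3)] inverse_cancel_left[OF V(3)])
  have AB: "A \<in> carrier_mat n n" "B \<in> carrier_mat n n" using U(1,4) V(1,4) by auto
  define N where "N = (\<Sum>i<n. \<Sum>j<n. \<bar>(B - A) $$ (i, j)\<bar>)"
  have m_le: "m i \<le> (\<Sum>j<n. l j * (W $$ (j, i))\<^sup>2) + N" if i: "i < n" for i
  proof -
    have "m i = (V\<^sup>T * B * V) $$ (i, i)"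
      using eigenvalue_quad[OF V(1,2,4)] i by simp
    also have "V\<^sup>T * B * V = V\<^sup>T * A * V + V\<^sup>T * (B - A) * V"
    proof -
      have "A + (B - A) = B" using AB by (intro eq_matI) auto
      moreover have "V\<^sup>T * (A + D) * V = V\<^sup>T * A * V + V\<^sup>T * D * V"
        if "D \<in> carrier_mat n n" for D
        using that AB(1) V(1) by (simp add: mult_add_dim add_mult_dim)
      ultimately show ?thesis using minus_carrier_mat[OF AB(1), of B] by metis
    qed
    also have "(V\<^sup>T * A * V + V\<^sup>T * (B - A) * V) $$ (i, i)
        = (V\<^sup>T * A * V) $$ (i, i) + (V\<^sup>T * (B - A) * V) $$ (i, i)"
      using V(1) i by simp
    also have "V\<^sup>T * A * V = W\<^sup>T * mat_diag n l * W"
      unfolding U(4) W_def using U(1) V(1) by (simp add: ring_dim)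
    also have "(W\<^sup>T * mat_diag n l * W) $$ (i, i) = (\<Sum>j<n. l j * (W $$ (j, i))\<^sup>2)"
      using W i by (subst mult_diag_mult_index) (auto simp: power2_eq_square mult_ac)
    also have "(V\<^sup>T * (B - A) * V) $$ (i, i) \<le> N"
    proof -
      have "col V i \<in> carrier_vec n" using V(1) by auto
      moreover have "col V i \<bullet> col V i = 1"
        using orthonormal_columns[OF V(1,2) i i] V(1) i by (simp add: scalar_prod_sum)
      ultimately show ?thesis
        using abs_quad_le[of "B - A" n "col V i"] AB V(1) i by (simp add: quad_column[OF V(1)] N_def minus_carrier_mat del: index_minus_mat(1) index_mult_mat(1))
    qed
    finally show ?thesis by simp
  qed
  have "(\<Sum>i<k. m i) \<le> (\<Sum>i<k. (\<Sum>j<n. l j * (W $$ (j, i))\<^sup>2) + N)"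
    using m_le k by (intro sum_mono) auto
  also have "\<dots> = (\<Sum>j<n. l j * (\<Sum>i<k. (W $$ (j, i))\<^sup>2)) + real k * N"
    by (simp add: sum.distrib sum_distrib_left) (rule sum.swap)
  also have "(\<Sum>j<n. l j * (\<Sum>i<k. (W $$ (j, i))\<^sup>2)) \<le> (\<Sum>j<k. l j)"
  proof (rule weighted_sum_le_leading_sum[OF l _ _ _ k])
    fix j assume j: "j < n"
    have "(\<Sum>i<k. (W $$ (j, i))\<^sup>2) \<le> (\<Sum>i<n. (W $$ (j, i))\<^sup>2)"
      using k by (intro sum_mono2) auto
    then show "(\<Sum>i<k. (W $$ (j, i))\<^sup>2) \<le> 1"
      using orthonormal_columns_square[OF W(2) WW(2) j] W(1) j by simp
  next
    have "(\<Sum>j<n. \<Sum>i<k. (W $$ (j, i))\<^sup>2) = (\<Sum>i<k. \<Sum>j<n. (W $$ (j, i))\<^sup>2)" by (rule sum.swap)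
    also have "\<dots> = (\<Sum>i<k. 1)"
      using k by (intro sum.cong refl orthonormal_columns_square[OF W(1) WW(1)]) auto
    finally show "(\<Sum>j<n. \<Sum>i<k. (W $$ (j, i))\<^sup>2) = real k" by simp
  qed (auto intro: sum_nonneg)
  finally show ?thesis by (simp add: N_def)
qed

text \<open>An eigenvalue is the difference of two consecutive sums of leading eigenvalues, with
  errors proportional to \<open>k\<close> and \<open>k + 1\<close>.\<close>

lemma eigenvalue_lipschitz:
  assumes A: "eigendecomposition n A U (mat_diag n l)" and B: "eigendecomposition n B V (mat_diag n m)"
    and k: "k < n"
  shows "\<bar>m k - l k\<bar> \<le> real (2 * k + 1) * (\<Sum>i<n. \<Sum>j<n. \<bar>(B - A) $$ (i, j)\<bar>)"
proof -
  define N where "N = (\<Sum>i<n. \<Sum>j<n. \<bar>(B - A) $$ (i, j)\<bar>)"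
  have c: "A \<in> carrier_mat n n" "B \<in> carrier_mat n n"
    using A B by (auto simp: eigendecomposition_def)
  have N: "N = (\<Sum>i<n. \<Sum>j<n. \<bar>(A - B) $$ (i, j)\<bar>)"
    unfolding N_def using c by (intro sum.cong refl) (auto simp: abs_minus_commute)
  have 1: "(\<Sum>i<r. m i) \<le> (\<Sum>i<r. l i) + real r * N" "(\<Sum>i<r. l i) \<le> (\<Sum>i<r. m i) + real r * N" if "r \<le> n" for r
    using eigenvalue_sum_perturbation[OF A B that] eigenvalue_sum_perturbation[OF B A that] N
    by (simp_all add: N_def)
  show ?thesis
    using 1[of k] 1[of "Suc k"] k by (simp add: N_def[symmetric] abs_le_iff algebra_simps)
qed

lemma tendsto_zero_bound:
  fixes f g :: "'a \<Rightarrow> real"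
  assumes "\<forall>\<^sub>F t in F. \<bar>f t\<bar> \<le> g t" "(g \<longlongrightarrow> 0) F"
  shows "(f \<longlongrightarrow> 0) F"
proof (rule tendsto_sandwich[of "\<lambda>t. - g t" f F g 0])
  show "((\<lambda>t. - g t) \<longlongrightarrow> 0) F" using tendsto_minus[OF assms(2)] by simp
qed (use assms in \<open>auto elim: eventually_mono\<close>)

text \<open>Expand the perturbed eigenvectors in the unperturbed eigenbasis, \<open>W = U\<^sup>T V\<close>. The
  eigenvalue equation becomes \<open>(m\<^sub>k - l\<^sub>j) W\<^sub>j\<^sub>k = t (G W)\<^sub>j\<^sub>k\<close> with \<open>G = U\<^sup>T H U\<close>. For \<open>j \<noteq> k\<close> the
  factor on the left stays away from zero, so \<open>W\<^sub>j\<^sub>k\<close> tends to zero and \<open>W\<^sub>k\<^sub>k\<^sup>2\<close> tends to one.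
  The equation with \<open>j = k\<close>, multiplied by \<open>W\<^sub>k\<^sub>k\<close>, then yields the derivative. The product
  with \<open>W\<^sub>k\<^sub>k\<close> is needed because the sign of an eigenvector is arbitrary, so \<open>W\<^sub>k\<^sub>k\<close> itself may
  have no limit.\<close>

lemma simple_eigenvalue_derivative:
  assumes A: "eigendecomposition n A U (mat_diag n l)"
    and distinct: "\<And>i j. i < n \<Longrightarrow> j < n \<Longrightarrow> i \<noteq> j \<Longrightarrow> l i \<noteq> l j"
    and H: "mat_tendsto n n H K (at_right 0)"
    and B: "\<And>t. 0 < t \<Longrightarrow> eigendecomposition n (A + t \<cdot>\<^sub>m H t) (V t) (mat_diag n (m t))"
    and k: "k < n"
  shows "((\<lambda>t. (m t k - l k) / t) \<longlongrightarrow> (U\<^sup>T * K * U) $$ (k, k)) (at_right 0)"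
proof -
  let ?F = "at_right (0 :: real)"
  note U = eigendecompositionD(1,2,4,3)[OF A]
  have c: "A \<in> carrier_mat n n" using U(1,4) by auto
  have pos: "\<forall>\<^sub>F t in ?F. 0 < t" by (rule eventually_at_right_less)
  have id: "((\<lambda>t. t) \<longlongrightarrow> 0) ?F" by (rule tendsto_ident_at)
  note dH = mat_tendstoD[OF H]
  define G where "G t = U\<^sup>T * H t * U" for t
  define W where "W t = U\<^sup>T * V t" for t
  have G: "mat_tendsto n n G (U\<^sup>T * K * U) ?F"
    unfolding G_def by (intro mat_tendsto_mult[where m = n] mat_tendsto_const H) (use U(1) in auto)
  have m_lim: "((\<lambda>t. m t k) \<longlongrightarrow> l k) ?F"
  proof -
    have "((\<lambda>t. m t k - l k) \<longlongrightarrow> 0) ?F"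
    proof (rule tendsto_zero_bound)
      show "\<forall>\<^sub>F t in ?F. \<bar>m t k - l k\<bar> \<le> real (2 * k + 1) * (\<Sum>i<n. \<Sum>j<n. t * \<bar>H t $$ (i, j)\<bar>)"
        using pos dH(2)
      proof eventually_elim
        case (elim t)
        have "\<bar>(A + t \<cdot>\<^sub>m H t - A) $$ (i, j)\<bar> = t * \<bar>H t $$ (i, j)\<bar>" if "i < n" "j < n" for i j
          using that c elim by (simp add: abs_mult)
        then show ?case using eigenvalue_lipschitz[OF A B[OF elim(1)] k] by simp
      qed
      have "((\<lambda>t. real (2 * k + 1) * (\<Sum>i<n. \<Sum>j<n. t * \<bar>H t $$ (i, j)\<bar>)) \<longlongrightarrow>
          real (2 * k + 1) * (\<Sum>i<n. \<Sum>j<n. 0 * \<bar>K $$ (i, j)\<bar>)) ?F"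
        by (intro tendsto_mult tendsto_const tendsto_sum tendsto_rabs id dH(3)) auto
      then show "((\<lambda>t. real (2 * k + 1) * (\<Sum>i<n. \<Sum>j<n. t * \<bar>H t $$ (i, j)\<bar>)) \<longlongrightarrow> 0) ?F" by simp
    qed
    then show ?thesis by (rule LIM_zero_cancel)
  qed
  have facts: "\<forall>\<^sub>F t in ?F. (\<forall>j<n. (m t k - l j) * W t $$ (j, k) = t * (\<Sum>i<n. G t $$ (j, i) * W t $$ (i, k)))
      \<and> (\<Sum>j<n. (W t $$ (j, k))\<^sup>2) = 1 \<and> (\<forall>j<n. \<bar>W t $$ (j, k)\<bar> \<le> 1)"
    using pos dH(2)
  proof eventually_elim
    case (elim t)
    note V = eigendecompositionD(1,2,4,3)[OF B[OF elim(1)]]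
    have W: "W t \<in> carrier_mat n n" using U V by (auto simp: W_def)
    have WW: "transpose_mat (W t) * W t = 1\<^sub>m n"
      using U V by (simp add: W_def ring_dim inverse_cancel_left[OF U(3)])
    have sq: "(\<Sum>j<n. (W t $$ (j, k))\<^sup>2) = 1" by (rule orthonormal_columns_square[OF W WW k])
    have "\<bar>W t $$ (j, k)\<bar> \<le> 1" if "j < n" for j
    proof -
      have "(W t $$ (j, k))\<^sup>2 \<le> (\<Sum>j<n. (W t $$ (j, k))\<^sup>2)" using that by (intro member_le_sum) auto
      then show ?thesis unfolding sq by (simp add: abs_square_le_1)
    qed
    moreover have "(m t k - l j) * W t $$ (j, k) = t * (\<Sum>i<n. G t $$ (j, i) * W t $$ (i, k))" if j: "j < n" for j
    proof -
      have GW: "G t * W t = U\<^sup>T * (H t * V t)"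
        using U V elim by (simp add: G_def W_def ring_dim inverse_cancel_left[OF U(3)])
      have "W t * mat_diag n (m t) = U\<^sup>T * ((A + t \<cdot>\<^sub>m H t) * V t)"
        unfolding V(4) using U V(1) by (simp add: W_def mult_assoc_dim V(2))
      also have "\<dots> = mat_diag n l * W t + t \<cdot>\<^sub>m (G t * W t)"
        unfolding GW U(4) using U V(1) elim
        by (simp add: W_def add_mult_dim mult_add_dim smult_mult_dim mult_smult_dim mult_assoc_dim
            inverse_cancel_left[OF U(2)])
      finally have "(W t * mat_diag n (m t)) $$ (j, k) = (mat_diag n l * W t + t \<cdot>\<^sub>m (G t * W t)) $$ (j, k)" by simp
      moreover have "(G t * W t) $$ (j, k) = (\<Sum>i<n. G t $$ (j, i) * W t $$ (i, k))"
        using j k U(1) W by (subst mult_mat_index) (auto simp: G_def)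
      ultimately show ?thesis
        using j k W U(1) by (simp add: mat_diag_mult_left[OF W] mat_diag_mult_right[OF W] G_def algebra_simps del: index_mult_mat(1))
    qed
    ultimately show ?case using sq by blast
  qed
  have W_off: "((\<lambda>t. W t $$ (j, k)) \<longlongrightarrow> 0) ?F" if j: "j < n" "j \<noteq> k" for j
  proof -
    have gap: "l k - l j \<noteq> 0" using distinct[OF k j(1)] j(2) by simp
    have gap_lim: "((\<lambda>t. m t k - l j) \<longlongrightarrow> l k - l j) ?F" by (intro tendsto_diff m_lim tendsto_const)
    show ?thesis
    proof (rule tendsto_zero_bound)
      show "\<forall>\<^sub>F t in ?F. \<bar>W t $$ (j, k)\<bar> \<le> t * (\<Sum>i<n. \<bar>G t $$ (j, i)\<bar>) / \<bar>m t k - l j\<bar>"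
        using facts pos tendsto_imp_eventually_ne[OF gap_lim gap]
      proof eventually_elim
        case (elim t)
        have "\<bar>m t k - l j\<bar> * \<bar>W t $$ (j, k)\<bar> = t * \<bar>\<Sum>i<n. G t $$ (j, i) * W t $$ (i, k)\<bar>"
          using elim j(1) by (simp flip: abs_mult) (simp add: abs_mult)
        also have "\<bar>\<Sum>i<n. G t $$ (j, i) * W t $$ (i, k)\<bar> \<le> (\<Sum>i<n. \<bar>G t $$ (j, i)\<bar>)"
        proof (rule order_trans[OF sum_abs sum_mono])
          fix i assume "i \<in> {..<n}"
          then show "\<bar>G t $$ (j, i) * W t $$ (i, k)\<bar> \<le> \<bar>G t $$ (j, i)\<bar>"
            using elim(1) by (simp add: abs_mult mult_left_le)
        qed
        finally show ?case using elim(2,3) by (simp add: field_simps)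
      qed
      have "((\<lambda>t. t * (\<Sum>i<n. \<bar>G t $$ (j, i)\<bar>) / \<bar>m t k - l j\<bar>) \<longlongrightarrow>
          0 * (\<Sum>i<n. \<bar>(U\<^sup>T * K * U) $$ (j, i)\<bar>) / \<bar>l k - l j\<bar>) ?F"
        using gap j(1)
        by (intro tendsto_divide tendsto_mult tendsto_sum tendsto_rabs id gap_lim mat_tendstoD(3)[OF G]) auto
      then show "((\<lambda>t. t * (\<Sum>i<n. \<bar>G t $$ (j, i)\<bar>) / \<bar>m t k - l j\<bar>) \<longlongrightarrow> 0) ?F" by simp
    qed
  qed
  have W_diag: "((\<lambda>t. (W t $$ (k, k))\<^sup>2) \<longlongrightarrow> 1) ?F"
  proof -
    have "((\<lambda>t. 1 - (\<Sum>j\<in>{..<n} - {k}. (W t $$ (j, k))\<^sup>2)) \<longlongrightarrow> 1 - (\<Sum>j\<in>{..<n} - {k}. 0\<^sup>2)) ?F"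
      by (intro tendsto_diff tendsto_const tendsto_sum tendsto_power W_off) auto
    moreover have "\<forall>\<^sub>F t in ?F. 1 - (\<Sum>j\<in>{..<n} - {k}. (W t $$ (j, k))\<^sup>2) = (W t $$ (k, k))\<^sup>2"
      using facts
    proof eventually_elim
      case (elim t)
      then have "(\<Sum>j<n. (W t $$ (j, k))\<^sup>2) = 1" by blast
      then show ?case using k by (subst (asm) sum.remove[of _ k]) auto
    qed
    ultimately show ?thesis by (simp add: Lim_transform_eventually)
  qed
  have "((\<lambda>t. G t $$ (k, k) + (\<Sum>i\<in>{..<n} - {k}. G t $$ (k, i) * (W t $$ (i, k) * W t $$ (k, k))) / (W t $$ (k, k))\<^sup>2)
      \<longlongrightarrow> (U\<^sup>T * K * U) $$ (k, k) + (\<Sum>i\<in>{..<n} - {k}. (U\<^sup>T * K * U) $$ (k, i) * 0) / 1) ?F"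
  proof (intro tendsto_add tendsto_divide tendsto_sum tendsto_mult W_diag mat_tendstoD(3)[OF G] k)
    fix i assume i: "i \<in> {..<n} - {k}"
    show "((\<lambda>t. W t $$ (i, k) * W t $$ (k, k)) \<longlongrightarrow> 0) ?F"
    proof (rule tendsto_zero_bound)
      show "\<forall>\<^sub>F t in ?F. \<bar>W t $$ (i, k) * W t $$ (k, k)\<bar> \<le> \<bar>W t $$ (i, k)\<bar>"
        using facts by eventually_elim (use k in \<open>simp add: abs_mult mult_left_le\<close>)
      show "((\<lambda>t. \<bar>W t $$ (i, k)\<bar>) \<longlongrightarrow> 0) ?F"
        using W_off[of i] i by (simp add: tendsto_rabs_zero)
    qed
  qed auto
  moreover have "\<forall>\<^sub>F t in ?F. G t $$ (k, k) + (\<Sum>i\<in>{..<n} - {k}. G t $$ (k, i) * (W t $$ (i, k) * W t $$ (k, k))) / (W t $$ (k, k))\<^sup>2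
      = (m t k - l k) / t"
    using facts pos tendsto_imp_eventually_ne[OF W_diag one_neq_zero]
  proof eventually_elim
    case (elim t)
    define w where "w = W t $$ (k, k)"
    have w: "w \<noteq> 0" using elim(3) by (simp add: w_def)
    have "(m t k - l k) * w = t * (\<Sum>i<n. G t $$ (k, i) * W t $$ (i, k))"
      using elim(1) k by (simp add: w_def)
    also have "(\<Sum>i<n. G t $$ (k, i) * W t $$ (i, k)) = G t $$ (k, k) * w + (\<Sum>i\<in>{..<n} - {k}. G t $$ (k, i) * W t $$ (i, k))"
      using k by (simp add: sum.remove[of _ k] w_def)
    finally have "(m t k - l k) / t = G t $$ (k, k) + (\<Sum>i\<in>{..<n} - {k}. G t $$ (k, i) * W t $$ (i, k)) / w"
      using w elim(2) by (simp add: field_simps)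
    also have "(\<Sum>i\<in>{..<n} - {k}. G t $$ (k, i) * W t $$ (i, k)) / w
        = (\<Sum>i\<in>{..<n} - {k}. G t $$ (k, i) * (W t $$ (i, k) * w)) / w\<^sup>2"
      using w by (simp add: sum_distrib_right[symmetric] mult.assoc[symmetric] power2_eq_square)
    finally show ?case by (simp add: w_def)
  qed
  ultimately show ?thesis by (simp add: Lim_transform_eventually)
qed

section \<open>The smallest fidelity among couplings\<close>

text \<open>The projection \<open>P = W W\<^sup>T\<close> satisfies \<open>P\<^sub>k\<^sub>k\<^sup>2 \<le> (P\<^sup>2)\<^sub>k\<^sub>k = P\<^sub>k\<^sub>k\<close>, and \<open>P\<^sub>k\<^sub>k\<close> is the sum on the
  left.\<close>

lemma bessel_rows:
  fixes W :: "real mat"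
  assumes W: "W \<in> carrier_mat n m" "W\<^sup>T * W = 1\<^sub>m m" and k: "k < n"
  shows "(\<Sum>i<m. (W $$ (k, i))\<^sup>2) \<le> 1"
proof -
  define P where "P = W * W\<^sup>T"
  have P: "P \<in> sym_mats n" using W(1) by (intro sym_matsI) (auto simp: P_def ring_dim)
  note d = sym_matsD[OF P]
  have PP: "P * P = P"
    using W(1) by (simp add: P_def mult_assoc_dim inverse_cancel_left[OF W(2)])
  have Pkk: "P $$ (k, k) = (\<Sum>i<m. (W $$ (k, i))\<^sup>2)"
    using W(1) k unfolding P_def by (subst mult_mat_index) (auto simp: power2_eq_square)
  have "P $$ (k, k) = (\<Sum>j<n. P $$ (k, j) * P $$ (j, k))"
    using d k mult_mat_index[of k P k P] by (simp add: PP)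
  also have "\<dots> \<ge> P $$ (k, k) * P $$ (k, k)"
  proof (rule member_le_sum[of k "{..<n}" "\<lambda>j. P $$ (k, j) * P $$ (j, k)"])
    fix j assume "j \<in> {..<n} - {k}"
    then show "0 \<le> P $$ (k, j) * P $$ (j, k)" using sym_mats_index[OF P k, of j] by simp
  qed (use k in auto)
  finally have "P $$ (k, k) * P $$ (k, k) \<le> P $$ (k, k)" .
  then have "P $$ (k, k) \<le> 1"
    using mult_strict_left_mono[of 1 "P $$ (k, k)" "P $$ (k, k)"] by (cases "P $$ (k, k) \<le> 1") auto
  then show ?thesis unfolding Pkk .
qed

text \<open>Summation by parts: a non-negative decreasing sequence is a non-negative combination of
  the indicator functions of initial segments. The induction keeps the last partial sum as a
  lower bound.\<close>

lemma abel_comparison: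
  fixes \<alpha> c d :: "nat \<Rightarrow> real"
  assumes \<alpha>: "\<And>i j. i \<le> j \<Longrightarrow> j < p \<Longrightarrow> \<alpha> j \<le> \<alpha> i" "\<And>i. i < p \<Longrightarrow> 0 \<le> \<alpha> i"
    and cd: "\<And>m. m \<le> p \<Longrightarrow> (\<Sum>i<m. d i) \<le> (\<Sum>i<m. c i)"
  shows "(\<Sum>i<p. \<alpha> i * d i) \<le> (\<Sum>i<p. \<alpha> i * c i)"
proof -
  have "\<alpha> m * (\<Sum>i<Suc m. c i - d i) \<le> (\<Sum>i<Suc m. \<alpha> i * (c i - d i))" if "m < p" for m
    using that
  proof (induction m)
    case (Suc m)
    have "0 \<le> (\<Sum>i<Suc m. c i - d i)" using cd[of "Suc m"] Suc.prems by (simp add: sum_subtractf)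
    then have "\<alpha> (Suc m) * (\<Sum>i<Suc m. c i - d i) \<le> \<alpha> m * (\<Sum>i<Suc m. c i - d i)"
      using \<alpha>(1)[of m "Suc m"] Suc.prems by (intro mult_right_mono) auto
    also have "\<dots> \<le> (\<Sum>i<Suc m. \<alpha> i * (c i - d i))" using Suc by simp
    finally show ?case
      unfolding sum.lessThan_Suc[of _ "Suc m"] distrib_left by simp
  qed simp
  note step = this
  show ?thesis
  proof (cases p)
    case (Suc m)
    have "0 \<le> \<alpha> m * (\<Sum>i<Suc m. c i - d i)"
      using cd[of "Suc m"] \<alpha>(2)[of m] Suc by (intro mult_nonneg_nonneg) (auto simp: sum_subtractf)
    then have "0 \<le> (\<Sum>i<p. \<alpha> i * (c i - d i))" using step[of m] Suc by simp
    then show ?thesis by (simp add: right_diff_distrib sum_subtractf)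
  qed simp
qed

text \<open>The right-hand side is the trace of a product of two symmetric matrices, one with
  eigenvalues \<open>z\<close>, the other with eigenvalues \<open>\<alpha>\<close> and eigenvectors the columns of \<open>W\<close>. Such
  a trace is smallest when the large eigenvalues of one matrix meet the small ones of the
  other. Summation by parts reduces this to constant weights on initial segments, where it
  is the bathtub principle for \<open>- z\<close>.\<close>

lemma opposite_order_trace:
  fixes W :: "real mat"
  assumes W: "W \<in> carrier_mat n p" "W\<^sup>T * W = 1\<^sub>m p" and pn: "p \<le> n"
    and \<alpha>: "\<And>i j. i \<le> j \<Longrightarrow> j < p \<Longrightarrow> \<alpha> j \<le> \<alpha> i" "\<And>i. i < p \<Longrightarrow> 0 \<le> \<alpha> i"
    and z: "\<And>i j. i \<le> j \<Longrightarrow> j < n \<Longrightarrow> z i \<le> z j"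
  shows "(\<Sum>i<p. \<alpha> i * z i) \<le> (\<Sum>k<n. z k * (\<Sum>i<p. \<alpha> i * (W $$ (k, i))\<^sup>2))"
proof -
  have "(\<Sum>i<p. \<alpha> i * z i) \<le> (\<Sum>i<p. \<alpha> i * (\<Sum>k<n. z k * (W $$ (k, i))\<^sup>2))"
  proof (rule abel_comparison[OF \<alpha>])
    fix m assume m: "m \<le> p"
    have "(\<Sum>k<n. - z k * (\<Sum>i<m. (W $$ (k, i))\<^sup>2)) \<le> (\<Sum>k<m. - z k)"
    proof (rule weighted_sum_le_leading_sum)
      fix k assume k: "k < n"
      have "(\<Sum>i<m. (W $$ (k, i))\<^sup>2) \<le> (\<Sum>i<p. (W $$ (k, i))\<^sup>2)"
        using m by (intro sum_mono2) auto
      then show "(\<Sum>i<m. (W $$ (k, i))\<^sup>2) \<le> 1" using bessel_rows[OF W k] by simp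
    next
      have "(\<Sum>k<n. \<Sum>i<m. (W $$ (k, i))\<^sup>2) = (\<Sum>i<m. \<Sum>k<n. (W $$ (k, i))\<^sup>2)" by (rule sum.swap)
      also have "\<dots> = (\<Sum>i<m. 1)"
        using m by (intro sum.cong refl orthonormal_columns_square[OF W]) auto
      finally show "(\<Sum>k<n. \<Sum>i<m. (W $$ (k, i))\<^sup>2) = real m" by simp
    qed (use z m pn in \<open>auto intro: sum_nonneg\<close>)
    moreover have "(\<Sum>k<n. - z k * (\<Sum>i<m. (W $$ (k, i))\<^sup>2)) = - (\<Sum>i<m. \<Sum>k<n. z k * (W $$ (k, i))\<^sup>2)"
      by (subst sum.swap) (simp add: sum_distrib_left sum_negf)
    ultimately show "(\<Sum>i<m. z i) \<le> (\<Sum>i<m. \<Sum>k<n. z k * (W $$ (k, i))\<^sup>2)"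
      by (simp add: sum_negf)
  qed
  also have "\<dots> = (\<Sum>k<n. z k * (\<Sum>i<p. \<alpha> i * (W $$ (k, i))\<^sup>2))"
    by (simp add: sum_distrib_left) (subst sum.swap, simp add: mult_ac)
  finally show ?thesis .
qed

text \<open>Normalizing the columns of \<open>Y\<close> makes them orthonormal.\<close>

lemma opposite_order_trace_gram:
  fixes Y :: "real mat"
  assumes Y: "Y \<in> carrier_mat n p" "Y\<^sup>T * Y = mat_diag p \<alpha>" and pn: "p \<le> n"
    and \<alpha>: "\<And>i j. i \<le> j \<Longrightarrow> j < p \<Longrightarrow> \<alpha> j \<le> \<alpha> i" "\<And>i. i < p \<Longrightarrow> 0 < \<alpha> i"
    and z: "\<And>i j. i \<le> j \<Longrightarrow> j < n \<Longrightarrow> z i \<le> z j"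
  shows "(\<Sum>i<p. \<alpha> i * z i) \<le> (\<Sum>k<n. z k * (Y * Y\<^sup>T) $$ (k, k))"
proof -
  define D where "D = mat_diag p (\<lambda>i. 1 / sqrt (\<alpha> i))"
  define W where "W = Y * D"
  have W: "W \<in> carrier_mat n p" using Y(1) by (auto simp: W_def D_def)
  have D_cancel: "D * mat_diag p \<alpha> * D = 1\<^sub>m p"
    unfolding D_def mat_diag_diag by (rule eq_matI) (auto dest: \<alpha>(2))
  have "W\<^sup>T * W = D * (Y\<^sup>T * Y) * D"
    using Y(1) by (simp add: W_def D_def ring_dim)
  also have "\<dots> = 1\<^sub>m p"
    unfolding Y(2) by (rule D_cancel)
  finally have WW: "W\<^sup>T * W = 1\<^sub>m p" .
  have "(Y * Y\<^sup>T) $$ (k, k) = (\<Sum>i<p. \<alpha> i * (W $$ (k, i))\<^sup>2)" if k: "k < n" for k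
  proof -
    have "W $$ (k, i) = Y $$ (k, i) * (1 / sqrt (\<alpha> i))" if "i < p" for i
      using Y(1) k that by (simp add: W_def D_def mat_diag_mult_right[OF Y(1)])
    then have "\<alpha> i * (W $$ (k, i))\<^sup>2 = Y $$ (k, i) * Y $$ (k, i)" if "i < p" for i
      using \<alpha>(2)[OF that] that by (simp add: power_mult_distrib power_divide power2_eq_square)
    then show ?thesis
      using Y(1) k by (subst mult_mat_index) auto
  qed
  then show ?thesis
    using opposite_order_trace[OF W WW pn \<alpha>(1) less_imp_le[OF \<alpha>(2)] z] by simp
qed

text \<open>Equivalent to \<open>(sqrt d - sqrt g)\<^sup>2 \<ge> 0\<close>.\<close>

lemma sqrt_tangent_le:
  fixes g d :: real
  assumes "0 < g" "0 \<le> d"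
  shows "sqrt d \<le> sqrt g + (d - g) / (2 * sqrt g)"
proof -
  have "0 \<le> (sqrt d - sqrt g)\<^sup>2" by simp
  then have "2 * (sqrt d * sqrt g) \<le> d + g" using assms by (simp add: power2_diff)
  moreover have "sqrt g * (2 * sqrt g) = 2 * g" "sqrt d * (2 * sqrt g) = 2 * (sqrt d * sqrt g)"
    using assms by simp_all
  ultimately have "sqrt d * (2 * sqrt g) \<le> sqrt g * (2 * sqrt g) + (d - g)" by linarith
  then have "sqrt d \<le> (sqrt g * (2 * sqrt g) + (d - g)) / (2 * sqrt g)"
    using assms by (simp add: pos_le_divide_eq)
  then show ?thesis using assms by (simp add: add_divide_distrib)
qed

lemma trace_psd_sqrt:
  assumes C: "C \<in> psd_mats n" and V: "V \<in> carrier_mat n n" "V\<^sup>T * V = 1\<^sub>m n"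
    "C = V * mat_diag n \<gamma> * V\<^sup>T"
  shows "mat_trace (psd_sqrt C) = (\<Sum>k<n. sqrt (\<gamma> k))"
proof -
  have "psd_sqrt C = V * mat_diag n (\<lambda>k. sqrt (\<gamma> k)) * V\<^sup>T"
    by (rule psd_sqrt_eqI[OF spectral_root[OF C V]])
  moreover have "mat_trace (V * mat_diag n (\<lambda>k. sqrt (\<gamma> k)) * V\<^sup>T) = mat_trace (mat_diag n (\<lambda>k. sqrt (\<gamma> k)))"
    using V(1) mat_trace_commute[of "V * mat_diag n (\<lambda>k. sqrt (\<gamma> k))" "V\<^sup>T"]
    by (simp add: inverse_cancel_left[OF V(2)])
  ultimately show ?thesis by (simp add: mat_trace_def)
qed

text \<open>Let \<open>\<gamma>\<close> be the eigenvalues of the sum \<open>C\<close> and \<open>\<delta>\<close> the aligned sums of \<open>\<alpha>\<close> and \<open>\<beta>\<close>. By the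
  tangent inequality, \<open>\<Sum> sqrt \<gamma>\<^sub>k - \<Sum> sqrt \<delta>\<^sub>k\<close> is at least \<open>\<Sum> z\<^sub>k (\<gamma>\<^sub>k - \<delta>\<^sub>k)\<close> where
  \<open>z\<^sub>k = 1 / (2 sqrt \<gamma>\<^sub>k)\<close> increases with \<open>k\<close>. In the eigenbasis of \<open>C\<close> the number \<open>\<Sum> z\<^sub>k \<gamma>\<^sub>k\<close>
  splits into one trace for each Gram matrix, and the trace inequality for opposite orders
  applies to both. Some \<open>\<gamma>\<^sub>k\<close> may vanish, therefore the argument runs with \<open>\<gamma>\<^sub>k + \<epsilon>\<close> and
  \<open>\<delta>\<^sub>k + \<epsilon>\<close>.\<close>

lemma trace_sqrt_sum_of_grams:
  fixes X Y :: "real mat" and \<alpha> \<beta> :: "nat \<Rightarrow> real"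
  assumes X: "X \<in> carrier_mat n p" "X\<^sup>T * X = mat_diag p \<alpha>"
    and Y: "Y \<in> carrier_mat n q" "Y\<^sup>T * Y = mat_diag q \<beta>"
    and pq: "p \<le> q" "q \<le> n"
    and \<alpha>: "\<And>i j. i \<le> j \<Longrightarrow> j < p \<Longrightarrow> \<alpha> j \<le> \<alpha> i" "\<And>i. i < p \<Longrightarrow> 0 < \<alpha> i"
    and \<beta>: "\<And>i j. i \<le> j \<Longrightarrow> j < q \<Longrightarrow> \<beta> j \<le> \<beta> i" "\<And>i. i < q \<Longrightarrow> 0 < \<beta> i"
  shows "(\<Sum>k<q. sqrt ((if k < p then \<alpha> k else 0) + \<beta> k))
    \<le> mat_trace (psd_sqrt (X * X\<^sup>T + Y * Y\<^sup>T))"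
proof -
  define C where "C = X * X\<^sup>T + Y * Y\<^sup>T"
  have C: "C \<in> psd_mats n" unfolding C_def by (intro psd_add psd_gram[OF X(1)] psd_gram[OF Y(1)])
  obtain V \<gamma> where ev: "eigendecomposition n C V (mat_diag n \<gamma>)"
    using eigendecomposition_exists[OF psd_sym[OF C]] by blast
  note V = eigendecompositionD(1-4)[OF ev] and \<gamma>_mono = eigendecompositionD(6)[OF ev]
  have \<gamma>: "0 \<le> \<gamma> k" if "k < n" for k by (rule psd_eigenvalues[OF C V(1-3) that])
  define \<delta> where "\<delta> k = (if k < p then \<alpha> k else 0) + (if k < q then \<beta> k else 0)" for k
  have \<delta>: "0 \<le> \<delta> k" for k using \<alpha>(2)[of k] \<beta>(2)[of k] by (auto simp: \<delta>_def)
  have eps: "(\<Sum>k<n. sqrt (\<delta> k + \<epsilon>)) \<le> (\<Sum>k<n. sqrt (\<gamma> k + \<epsilon>))" if \<epsilon>: "0 < \<epsilon>" for \<epsilon>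
  proof -
    define z where "z k = 1 / (2 * sqrt (\<gamma> k + \<epsilon>))" for k
    have z: "z i \<le> z j" if "i \<le> j" "j < n" for i j
      using \<gamma>_mono[OF that] \<gamma>[of j] \<epsilon> that unfolding z_def
      by (intro divide_left_mono) (auto intro!: mult_pos_pos)
    define X' where "X' = V\<^sup>T * X"
    define Y' where "Y' = V\<^sup>T * Y"
    have X': "X' \<in> carrier_mat n p" "X'\<^sup>T * X' = mat_diag p \<alpha>"
      using X V by (simp_all add: X'_def ring_dim inverse_cancel_left[OF V(4)])
    have Y': "Y' \<in> carrier_mat n q" "Y'\<^sup>T * Y' = mat_diag q \<beta>"
      using Y V by (simp_all add: Y'_def ring_dim inverse_cancel_left[OF V(4)])
    have "V\<^sup>T * C * V = X' * X'\<^sup>T + Y' * Y'\<^sup>T"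
      unfolding C_def X'_def Y'_def using X(1) Y(1) V(1) by (simp add: ring_dim)
    then have "mat_diag n \<gamma> = X' * X'\<^sup>T + Y' * Y'\<^sup>T"
      using eigenvalue_quad[OF V(1-3)] by simp
    then have \<gamma>_eq: "\<gamma> k = (X' * X'\<^sup>T) $$ (k, k) + (Y' * Y'\<^sup>T) $$ (k, k)" if "k < n" for k
      using that X'(1) Y'(1) by (metis carrier_matD index_add_mat(1) index_mult_mat(2,3) index_transpose_mat(2,3) mat_diag_index)
    have "(\<Sum>k<n. z k * \<delta> k) = (\<Sum>k<n. if k < p then \<alpha> k * z k else 0) + (\<Sum>k<n. if k < q then \<beta> k * z k else 0)"
      unfolding \<delta>_def sum.distrib[symmetric] by (intro sum.cong refl) (auto simp: algebra_simps)
    also have "(\<Sum>k<n. if k < p then \<alpha> k * z k else 0) = (\<Sum>k<p. \<alpha> k * z k)"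
      by (rule sum.mono_neutral_cong_right) (use pq in auto)
    also have "(\<Sum>k<n. if k < q then \<beta> k * z k else 0) = (\<Sum>k<q. \<beta> k * z k)"
      by (rule sum.mono_neutral_cong_right) (use pq in auto)
    also have "(\<Sum>k<p. \<alpha> k * z k) + (\<Sum>k<q. \<beta> k * z k) \<le> (\<Sum>k<n. z k * \<gamma> k)"
    proof -
      have "(\<Sum>k<p. \<alpha> k * z k) \<le> (\<Sum>k<n. z k * (X' * X'\<^sup>T) $$ (k, k))"
        by (rule opposite_order_trace_gram[OF X' order_trans[OF pq] \<alpha> z])
      moreover have "(\<Sum>k<q. \<beta> k * z k) \<le> (\<Sum>k<n. z k * (Y' * Y'\<^sup>T) $$ (k, k))"
        by (rule opposite_order_trace_gram[OF Y' pq(2) \<beta> z])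
      moreover have "(\<Sum>k<n. z k * \<gamma> k) = (\<Sum>k<n. z k * (X' * X'\<^sup>T) $$ (k, k))
          + (\<Sum>k<n. z k * (Y' * Y'\<^sup>T) $$ (k, k))"
        unfolding sum.distrib[symmetric] distrib_left[symmetric] by (intro sum.cong refl) (simp only: \<gamma>_eq lessThan_iff)
      ultimately show ?thesis by linarith
    qed
    finally have "0 \<le> (\<Sum>k<n. z k * (\<gamma> k - \<delta> k))" by (simp add: right_diff_distrib sum_subtractf)
    also have "\<dots> \<le> (\<Sum>k<n. sqrt (\<gamma> k + \<epsilon>) - sqrt (\<delta> k + \<epsilon>))"
    proof (rule sum_mono)
      fix k assume "k \<in> {..<n}"
      then show "z k * (\<gamma> k - \<delta> k) \<le> sqrt (\<gamma> k + \<epsilon>) - sqrt (\<delta> k + \<epsilon>)"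
        using sqrt_tangent_le[of "\<gamma> k + \<epsilon>" "\<delta> k + \<epsilon>"] \<gamma>[of k] \<delta>[of k] \<epsilon>
        by (simp add: z_def diff_divide_distrib)
    qed
    finally show ?thesis by (simp add: sum_subtractf)
  qed
  have lim: "((\<lambda>\<epsilon>. \<Sum>k<n. sqrt (f k + \<epsilon>)) \<longlongrightarrow> (\<Sum>k<n. sqrt (f k + 0))) (at_right 0)" for f
    by (intro tendsto_sum tendsto_real_sqrt tendsto_add tendsto_const tendsto_ident_at)
  have "(\<Sum>k<n. sqrt (\<delta> k + 0)) \<le> (\<Sum>k<n. sqrt (\<gamma> k + 0))"
    by (rule tendsto_le[OF _ lim lim])
      (use eventually_at_right_less[of 0] eps in \<open>auto elim: eventually_mono\<close>)
  then have "(\<Sum>k<n. sqrt (\<delta> k)) \<le> mat_trace (psd_sqrt C)"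
    unfolding trace_psd_sqrt[OF C V(1-3)] by simp
  moreover have "(\<Sum>k<n. sqrt (\<delta> k)) = (\<Sum>k<q. sqrt ((if k < p then \<alpha> k else 0) + \<beta> k))"
    by (rule sum.mono_neutral_cong_right) (use pq in \<open>auto simp: \<delta>_def\<close>)
  ultimately show ?thesis by (simp add: C_def)
qed

text \<open>Orthogonal columns make the root of a Gram matrix explicit, also when the matrix is
  singular.\<close>

lemma psd_sqrt_gram:
  assumes N: "N \<in> carrier_mat n q" "N\<^sup>T * N = mat_diag q e" and e: "\<And>k. k < q \<Longrightarrow> 0 < e k"
  shows "psd_sqrt (N * N\<^sup>T) = N * mat_diag q (\<lambda>k. 1 / sqrt (e k)) * N\<^sup>T"
    and "mat_trace (psd_sqrt (N * N\<^sup>T)) = (\<Sum>k<q. sqrt (e k))"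
proof -
  let ?D = "mat_diag q (\<lambda>k. 1 / sqrt (e k))"
  have psd: "N * ?D * N\<^sup>T \<in> psd_mats n"
    using psd_congruence[OF psd_mat_diag, of q "\<lambda>k. 1 / sqrt (e k)" "N\<^sup>T" n] N(1) e
    by (simp add: less_imp_le)
  have NN: "N\<^sup>T * (N * X) = mat_diag q e * X" if "dim_row X = q" for X
    using N that by (metis carrier_matD index_transpose_mat(2,3) mult_assoc_dim)
  have DD: "?D * (mat_diag q e * ?D) = 1\<^sub>m q"
    unfolding mat_diag_diag by (rule eq_matI) (auto dest: e)
  have cancel: "?D * (mat_diag q e * (?D * X)) = X" if "dim_row X = q" for X
  proof -
    have "?D * (mat_diag q e * (?D * X)) = (?D * (mat_diag q e * ?D)) * X"
      using that by (simp add: mult_assoc_dim del: mat_diag_diag)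
    then show ?thesis using that unfolding DD by simp
  qed
  have "(N * ?D * N\<^sup>T) * (N * ?D * N\<^sup>T) = N * N\<^sup>T"
    using N(1) by (simp add: mult_assoc_dim NN cancel del: mat_diag_diag)
  then show eq: "psd_sqrt (N * N\<^sup>T) = N * ?D * N\<^sup>T"
    by (rule psd_sqrt_eqI[OF psd])
  have "mat_trace (N * ?D * N\<^sup>T) = mat_trace (mat_diag q e * ?D)"
    using N mat_trace_commute[of "N * ?D" "N\<^sup>T"] by (simp add: NN del: mat_diag_diag)
  also have "\<dots> = (\<Sum>k<q. sqrt (e k))"
    using e by (auto simp: mat_trace_def real_div_sqrt less_imp_le intro!: sum.cong)
  finally show "mat_trace (psd_sqrt (N * N\<^sup>T)) = (\<Sum>k<q. sqrt (e k))"
    unfolding eq .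
qed

section \<open>Block embeddings\<close>

text \<open>\<open>emb1\<close> and \<open>emb2\<close> are the isometric embeddings of the two coordinate blocks. They turn
  statements about blocks into identities of matrix products.\<close>

definition emb1 :: "nat \<Rightarrow> nat \<Rightarrow> real mat" where
  "emb1 p q = mat (p + q) p (\<lambda>(i, j). if i = j then 1 else 0)"

definition emb2 :: "nat \<Rightarrow> nat \<Rightarrow> real mat" where
  "emb2 p q = mat (p + q) q (\<lambda>(i, j). if i = j + p then 1 else 0)"

lemma emb_dims [simp]:
  "dim_row (emb1 p q) = p + q" "dim_col (emb1 p q) = p"
  "dim_row (emb2 p q) = p + q" "dim_col (emb2 p q) = q"
  by (simp_all add: emb1_def emb2_def)

lemma emb_carrier: "emb1 p q \<in> carrier_mat (p + q) p" "emb2 p q \<in> carrier_mat (p + q) q"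
  by (auto intro!: carrier_matI)

lemma emb1_transpose_mult:
  "dim_row M = p + q \<Longrightarrow> (emb1 p q)\<^sup>T * M = mat p (dim_col M) (\<lambda>(i, j). M $$ (i, j))"
proof (rule eq_matI)
  fix i j assume M: "dim_row M = p + q" and "i < dim_row (mat p (dim_col M) (\<lambda>(i, j). M $$ (i, j)))"
    "j < dim_col (mat p (dim_col M) (\<lambda>(i, j). M $$ (i, j)))"
  then have ij: "i < p" "j < dim_col M" by auto
  have "((emb1 p q)\<^sup>T * M) $$ (i, j) = (\<Sum>k<p + q. (emb1 p q)\<^sup>T $$ (i, k) * M $$ (k, j))"
    using M ij by (subst mult_mat_index) auto
  also have "\<dots> = (\<Sum>k<p + q. if k = i then M $$ (i, j) else 0)"
    using ij by (intro sum.cong refl) (auto simp: emb1_def)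
  finally show "((emb1 p q)\<^sup>T * M) $$ (i, j) = mat p (dim_col M) (\<lambda>(i, j). M $$ (i, j)) $$ (i, j)"
    using ij by simp
qed auto

lemma emb2_transpose_mult:
  "dim_row M = p + q \<Longrightarrow> (emb2 p q)\<^sup>T * M = mat q (dim_col M) (\<lambda>(i, j). M $$ (i + p, j))"
proof (rule eq_matI)
  fix i j assume M: "dim_row M = p + q" and "i < dim_row (mat q (dim_col M) (\<lambda>(i, j). M $$ (i + p, j)))"
    "j < dim_col (mat q (dim_col M) (\<lambda>(i, j). M $$ (i + p, j)))"
  then have ij: "i < q" "j < dim_col M" by auto
  have "((emb2 p q)\<^sup>T * M) $$ (i, j) = (\<Sum>k<p + q. (emb2 p q)\<^sup>T $$ (i, k) * M $$ (k, j))"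
    using M ij by (subst mult_mat_index) auto
  also have "\<dots> = (\<Sum>k<p + q. if k = i + p then M $$ (i + p, j) else 0)"
    using ij by (intro sum.cong refl) (auto simp: emb2_def)
  finally show "((emb2 p q)\<^sup>T * M) $$ (i, j) = mat q (dim_col M) (\<lambda>(i, j). M $$ (i + p, j)) $$ (i, j)"
    using ij by simp
qed auto

lemma mult_emb1: "dim_col M = p + q \<Longrightarrow> M * emb1 p q = mat (dim_row M) p (\<lambda>(i, j). M $$ (i, j))"
  using arg_cong[OF emb1_transpose_mult[of "M\<^sup>T" p q], of transpose_mat]
  by (simp add: transpose_mult_dim) (auto intro!: eq_matI)

lemma mult_emb2: "dim_col M = p + q \<Longrightarrow> M * emb2 p q = mat (dim_row M) q (\<lambda>(i, j). M $$ (i, j + p))"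
  using arg_cong[OF emb2_transpose_mult[of "M\<^sup>T" p q], of transpose_mat]
  by (simp add: transpose_mult_dim) (auto intro!: eq_matI)

lemma emb_orthonormal:
  "(emb1 p q)\<^sup>T * emb1 p q = 1\<^sub>m p" "(emb2 p q)\<^sup>T * emb2 p q = 1\<^sub>m q"
  "(emb1 p q)\<^sup>T * emb2 p q = 0\<^sub>m p q" "(emb2 p q)\<^sup>T * emb1 p q = 0\<^sub>m q p"
  unfolding emb1_transpose_mult[OF emb_dims(1)] emb2_transpose_mult[OF emb_dims(1)]
    emb1_transpose_mult[OF emb_dims(3)] emb2_transpose_mult[OF emb_dims(3)]
  by (auto simp: emb1_def emb2_def intro!: eq_matI)

lemma upper_left_emb: "A \<in> carrier_mat (p + q) (p + q) \<Longrightarrow> upper_left p p A = (emb1 p q)\<^sup>T * A * emb1 p q"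
  by (auto simp: emb1_transpose_mult mult_emb1 intro!: eq_matI)

lemma lower_right_emb: "A \<in> carrier_mat (p + q) (p + q) \<Longrightarrow> lower_right p p A = (emb2 p q)\<^sup>T * A * emb2 p q"
  by (auto simp: emb2_transpose_mult mult_emb2 intro!: eq_matI)

lemma emb1_mult:
  "dim_row A = p \<Longrightarrow> emb1 p q * A = mat (p + q) (dim_col A) (\<lambda>(i, j). if i < p then A $$ (i, j) else 0)"
proof (rule eq_matI)
  let ?R = "mat (p + q) (dim_col A) (\<lambda>(i, j). if i < p then A $$ (i, j) else 0)"
  fix i j assume A: "dim_row A = p" and "i < dim_row ?R" "j < dim_col ?R"
  then have ij: "i < p + q" "j < dim_col A" by auto
  have "(emb1 p q * A) $$ (i, j) = (\<Sum>k<p. emb1 p q $$ (i, k) * A $$ (k, j))"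
    using A ij by (subst mult_mat_index) auto
  also have "\<dots> = (\<Sum>k<p. if k = i then A $$ (i, j) else 0)"
    using ij by (intro sum.cong refl) (auto simp: emb1_def)
  finally show "(emb1 p q * A) $$ (i, j) = ?R $$ (i, j)" using ij by simp
qed auto

lemma emb2_mult:
  "dim_row A = q \<Longrightarrow> emb2 p q * A = mat (p + q) (dim_col A) (\<lambda>(i, j). if i < p then 0 else A $$ (i - p, j))"
proof (rule eq_matI)
  let ?R = "mat (p + q) (dim_col A) (\<lambda>(i, j). if i < p then 0 else A $$ (i - p, j))"
  fix i j assume A: "dim_row A = q" and "i < dim_row ?R" "j < dim_col ?R"
  then have ij: "i < p + q" "j < dim_col A" by auto
  have "(emb2 p q * A) $$ (i, j) = (\<Sum>k<q. emb2 p q $$ (i, k) * A $$ (k, j))"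
    using A ij by (subst mult_mat_index) auto
  also have "\<dots> = (\<Sum>k<q. if k = i - p then (if i < p then 0 else A $$ (i - p, j)) else 0)"
    using ij by (intro sum.cong refl) (auto simp: emb2_def)
  finally show "(emb2 p q * A) $$ (i, j) = ?R $$ (i, j)" using ij by auto
qed auto

lemma mult_emb1_transpose:
  "dim_col A = p \<Longrightarrow> A * (emb1 p q)\<^sup>T = mat (dim_row A) (p + q) (\<lambda>(i, j). if j < p then A $$ (i, j) else 0)"
  using arg_cong[OF emb1_mult[of "A\<^sup>T" p q], of transpose_mat]
  by (simp add: transpose_mult_dim) (auto intro!: eq_matI)

lemma mult_emb2_transpose:
  "dim_col A = q \<Longrightarrow> A * (emb2 p q)\<^sup>T = mat (dim_row A) (p + q) (\<lambda>(i, j). if j < p then 0 else A $$ (i, j - p))"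
  using arg_cong[OF emb2_mult[of "A\<^sup>T" q p], of transpose_mat]
  by (simp add: transpose_mult_dim) (auto intro!: eq_matI)

lemma four_block_mat_emb:
  assumes "A \<in> carrier_mat p p" "B \<in> carrier_mat p q" "C \<in> carrier_mat q p" "D \<in> carrier_mat q q"
  shows "four_block_mat A B C D =
    emb1 p q * A * (emb1 p q)\<^sup>T + emb1 p q * B * (emb2 p q)\<^sup>T
    + (emb2 p q * C * (emb1 p q)\<^sup>T + emb2 p q * D * (emb2 p q)\<^sup>T)"
  using assms
  by (intro eq_matI) (auto simp: emb1_mult emb2_mult mult_emb1_transpose mult_emb2_transpose)

lemma diag_block_mat_emb:
  assumes "A \<in> carrier_mat p p" "D \<in> carrier_mat q q"
  shows "diag_block_mat [A, D] =
    emb1 p q * A * (emb1 p q)\<^sup>T + emb2 p q * D * (emb2 p q)\<^sup>T"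
  unfolding diag_block_mat_pair using assms
  by (intro eq_matI) (auto simp: emb1_mult emb2_mult mult_emb1_transpose mult_emb2_transpose)

section \<open>The supremum in the denominator\<close>

text \<open>The smallest fidelity of \<open>S\<^sub>0\<close> with a coupling, when \<open>a\<close> and \<open>b\<close> are the eigenvalues of the
  diagonal blocks in decreasing order. The shorter sequence \<open>a\<close> is continued by zero.\<close>

definition aligned_fidelity :: "nat \<Rightarrow> nat \<Rightarrow> (nat \<Rightarrow> real) \<Rightarrow> (nat \<Rightarrow> real) \<Rightarrow> real" where
  "aligned_fidelity p q a b = (\<Sum>k<q. sqrt ((if k < p then (a k)\<^sup>2 else 0) + (b k)\<^sup>2))"

text \<open>\<open>Z\<close> is a square root of \<open>A\<close> up to an orthogonal factor, chosen so that its columns are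
  orthogonal.\<close>

lemma eigen_root:
  assumes A: "eigendecomposition n A U (mat_diag n l)" and l: "\<And>i. i < n \<Longrightarrow> 0 < l i"
    and Z_def: "Z = U * mat_diag n (\<lambda>i. sqrt (l i))"
  shows "Z \<in> carrier_mat n n" "Z * Z\<^sup>T = A" "Z\<^sup>T * Z = mat_diag n l"
    "Z\<^sup>T * A * Z = mat_diag n (\<lambda>i. (l i)\<^sup>2)"
proof -
  note U = eigendecompositionD(1-3)[OF A]
  let ?D = "mat_diag n (\<lambda>i. sqrt (l i))"
  have DD: "?D * ?D = mat_diag n l" unfolding mat_diag_diag by (rule eq_matI) (auto dest: l)
  show Z: "Z \<in> carrier_mat n n" using U(1) by (auto simp: Z_def)
  have "Z * Z\<^sup>T = U * (?D * ?D) * U\<^sup>T"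
    using U(1) by (simp add: Z_def transpose_mult_dim mult_assoc_dim del: mat_diag_diag)
  then show ZZ: "Z * Z\<^sup>T = A" unfolding DD U(3) .
  have "Z\<^sup>T * Z = ?D * ?D"
    using U(1) by (simp add: Z_def transpose_mult_dim mult_assoc_dim inverse_cancel_left[OF U(2)] del: mat_diag_diag)
  then show ZTZ: "Z\<^sup>T * Z = mat_diag n l" unfolding DD .
  have "Z\<^sup>T * A * Z = (Z\<^sup>T * Z) * (Z\<^sup>T * Z)"
    unfolding ZZ[symmetric] using Z by (simp add: mult_assoc_dim)
  then show "Z\<^sup>T * A * Z = mat_diag n (\<lambda>i. (l i)\<^sup>2)"
    unfolding ZTZ by (simp add: power2_eq_square)
qed

lemma square_mono_decreasing:
  fixes l :: "nat \<Rightarrow> real"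
  assumes "eigendecomposition n A U (mat_diag n l)" and "\<And>i. i < n \<Longrightarrow> 0 < l i" and "i \<le> j" "j < n"
  shows "(l j)\<^sup>2 \<le> (l i)\<^sup>2"
proof -
  have "l j \<le> l i" by (rule eigendecompositionD(6)[OF assms(1,3,4)])
  then show ?thesis using assms(2)[OF assms(4)] by (intro power_mono) auto
qed

text \<open>Factor the diagonal blocks as \<open>Z Z\<^sup>T\<close>. Then \<open>T\<^sup>1\<^sup>/\<^sup>2 S\<^sub>0 T\<^sup>1\<^sup>/\<^sup>2\<close> is the sum of the Gram matrices
  of \<open>X = T\<^sup>1\<^sup>/\<^sup>2 E Z\<^sub>1\<close> and \<open>Y = T\<^sup>1\<^sup>/\<^sup>2 F Z\<^sub>2\<close>. Since \<open>E\<^sup>T T E\<close> is the upper left block, the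
  columns of \<open>X\<close> are orthogonal with squared lengths \<open>a\<^sub>k\<^sup>2\<close>; likewise for \<open>Y\<close>.\<close>

lemma coupling_fidelity_ge:
  assumes T: "T \<in> psd_mats (p + q)" and pq: "p \<le> q"
    and e1: "eigendecomposition p (upper_left p p T) U1 (mat_diag p a)" and a: "\<And>i. i < p \<Longrightarrow> 0 < a i"
    and e2: "eigendecomposition q (lower_right p p T) U2 (mat_diag q b)" and b: "\<And>i. i < q \<Longrightarrow> 0 < b i"
  shows "aligned_fidelity p q a b \<le> mat_trace (psd_sqrt (psd_sqrt T * diag_part p T * psd_sqrt T))"
proof -
  let ?E = "emb1 p q" and ?F = "emb2 p q"
  define R where "R = psd_sqrt T"
  have R: "R \<in> psd_mats (p + q)" "R * R = T" using psd_sqrt_psd[OF T] psd_sqrt_square[OF T] by (simp_all add: R_def)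
  note dR = psd_matsD[OF R(1)]
  have cT: "T \<in> carrier_mat (p + q) (p + q)" using psd_matsD[OF T] by auto
  define Z1 where "Z1 = U1 * mat_diag p (\<lambda>i. sqrt (a i))"
  define Z2 where "Z2 = U2 * mat_diag q (\<lambda>i. sqrt (b i))"
  note z1 = eigen_root[OF e1 a Z1_def] and z2 = eigen_root[OF e2 b Z2_def]
  define X where "X = R * (?E * Z1)"
  define Y where "Y = R * (?F * Z2)"
  have XY: "X \<in> carrier_mat (p + q) p" "Y \<in> carrier_mat (p + q) q"
    using dR z1(1) z2(1) by (auto simp: X_def Y_def)
  have RR: "R * (R * M) = T * M" if "dim_row M = p + q" for M
    using dR that by (simp add: R(2)[symmetric] mult_assoc_dim)
  have "X\<^sup>T * X = Z1\<^sup>T * (?E\<^sup>T * T * ?E) * Z1"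
    using dR z1(1) cT by (simp add: X_def transpose_mult_dim mult_assoc_dim RR)
  then have XX: "X\<^sup>T * X = mat_diag p (\<lambda>i. (a i)\<^sup>2)"
    using z1(4) by (simp add: upper_left_emb[OF cT])
  have "Y\<^sup>T * Y = Z2\<^sup>T * (?F\<^sup>T * T * ?F) * Z2"
    using dR z2(1) cT by (simp add: Y_def transpose_mult_dim mult_assoc_dim RR)
  then have YY: "Y\<^sup>T * Y = mat_diag q (\<lambda>i. (b i)\<^sup>2)"
    using z2(4) by (simp add: lower_right_emb[OF cT])
  have "diag_part p T = ?E * (Z1 * Z1\<^sup>T) * ?E\<^sup>T + ?F * (Z2 * Z2\<^sup>T) * ?F\<^sup>T"
    unfolding diag_part_def using cT by (simp only: z1(2) z2(2)) (intro diag_block_mat_emb, auto intro!: carrier_matI)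
  then have "R * diag_part p T * R = X * X\<^sup>T + Y * Y\<^sup>T"
    using dR z1(1) z2(1) by (simp add: X_def Y_def transpose_mult_dim mult_assoc_dim add_mult_dim mult_add_dim)
  moreover have "aligned_fidelity p q a b \<le> mat_trace (psd_sqrt (X * X\<^sup>T + Y * Y\<^sup>T))"
    unfolding aligned_fidelity_def
    by (rule trace_sqrt_sum_of_grams[OF XY(1) XX XY(2) YY pq])
      (use square_mono_decreasing[OF e1 a] square_mono_decreasing[OF e2 b] a b in \<open>auto simp: zero_less_power2 less_imp_neq[symmetric]\<close>)
  ultimately show ?thesis by (simp add: R_def)
qed

lemma zero_mult_dim: "dim_row A = m \<Longrightarrow> 0\<^sub>m n m * A = (0\<^sub>m n (dim_col A) :: real mat)"
  by (rule left_mult_zero_mat) (auto intro!: carrier_matI)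

lemma mult_zero_dim: "dim_col A = m \<Longrightarrow> A * 0\<^sub>m m n = (0\<^sub>m (dim_row A) n :: real mat)"
  by (rule right_mult_zero_mat) (auto intro!: carrier_matI)

lemma add_zero_dim:
  fixes A :: "real mat"
  shows "dim_row A = n \<Longrightarrow> dim_col A = m \<Longrightarrow> A + 0\<^sub>m n m = A" "dim_row A = n \<Longrightarrow> dim_col A = m \<Longrightarrow> 0\<^sub>m n m + A = A"
  by auto

lemma psd_sqrt_mat_diag:
  assumes "\<And>i. i < n \<Longrightarrow> 0 \<le> l i"
  shows "psd_sqrt (mat_diag n l) = mat_diag n (\<lambda>i. sqrt (l i))"
proof (rule psd_sqrt_eqI)
  show "mat_diag n (\<lambda>i. sqrt (l i)) \<in> psd_mats n" using assms by (intro psd_mat_diag) auto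
  show "mat_diag n (\<lambda>i. sqrt (l i)) * mat_diag n (\<lambda>i. sqrt (l i)) = mat_diag n l"
    unfolding mat_diag_diag by (rule eq_matI) (auto dest: assms)
qed

text \<open>The matrix \<open>\<Pi>\<close> of the definition of \<open>\<Psi>\<^sub>m\<close> is a co-isometry because \<open>p \<le> q\<close>.\<close>

lemma truncation_facts:
  assumes pq: "p \<le> q"
  shows "upper_left p q (1\<^sub>m (p + q)) * transpose_mat (upper_left p q (1\<^sub>m (p + q))) = 1\<^sub>m p"
    and "transpose_mat (upper_left p q (1\<^sub>m (p + q))) * mat_diag p f * upper_left p q (1\<^sub>m (p + q))
      = mat_diag q (\<lambda>k. if k < p then f k else 0)"
proof -
  let ?P = "upper_left p q (1\<^sub>m (p + q)) :: real mat"
  have P: "?P $$ (i, j) = (if i = j then 1 else 0)" if "i < p" "j < q" for i j using that by simp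
  show "?P * ?P\<^sup>T = 1\<^sub>m p"
  proof (rule eq_matI)
    fix i j assume "i < dim_row (1\<^sub>m p :: real mat)" "j < dim_col (1\<^sub>m p :: real mat)"
    then have ij: "i < p" "j < p" by auto
    have "(?P * ?P\<^sup>T) $$ (i, j) = (\<Sum>k<q. ?P $$ (i, k) * ?P $$ (j, k))"
      using ij by (subst mult_mat_index) auto
    also have "\<dots> = (\<Sum>k<q. if k = i then (if i = j then 1 else 0) else 0)"
      using ij by (intro sum.cong refl) (auto simp: P)
    finally show "(?P * ?P\<^sup>T) $$ (i, j) = 1\<^sub>m p $$ (i, j)" using ij pq by simp
  qed auto
  show "?P\<^sup>T * mat_diag p f * ?P = mat_diag q (\<lambda>k. if k < p then f k else 0)"
  proof (rule eq_matI)
    fix i j assume "i < dim_row (mat_diag q (\<lambda>k. if k < p then f k else 0))"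
      "j < dim_col (mat_diag q (\<lambda>k. if k < p then f k else 0))"
    then have ij: "i < q" "j < q" by auto
    have "(?P\<^sup>T * mat_diag p f * ?P) $$ (i, j) = (\<Sum>k<p. ?P $$ (k, i) * f k * ?P $$ (k, j))"
      using ij by (subst mult_diag_mult_index) auto
    also have "\<dots> = (\<Sum>k<p. if k = i then (if i = j then f k else 0) else 0)"
      using ij by (intro sum.cong refl) (auto simp: P)
    finally show "(?P\<^sup>T * mat_diag p f * ?P) $$ (i, j)
        = mat_diag q (\<lambda>k. if k < p then f k else 0) $$ (i, j)" using ij by auto
  qed auto
qed

text \<open>\<open>Y\<close> stacks \<open>U\<^sub>1 \<Lambda>\<^sub>1\<^sup>1\<^sup>/\<^sup>2 \<Pi>\<close> on \<open>U\<^sub>2 \<Lambda>\<^sub>2\<^sup>1\<^sup>/\<^sup>2\<close>. It has only \<open>q\<close> columns, and they are orthogonal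
  for the standard inner product as well as for the one given by \<open>S\<^sub>0\<close>.\<close>

lemma Sigma_m_gram:
  assumes S: "S \<in> carrier_mat (p + q) (p + q)" and pq: "p \<le> q"
    and e1: "eigendecomposition p (upper_left p p S) U1 (mat_diag p a)" and a: "\<And>i. i < p \<Longrightarrow> 0 < a i"
    and e2: "eigendecomposition q (lower_right p p S) U2 (mat_diag q b)" and b: "\<And>i. i < q \<Longrightarrow> 0 < b i"
  shows "\<exists>Y \<in> carrier_mat (p + q) q.
    Sigma_m p q S U1 (mat_diag p a) U2 (mat_diag q b) = Y * Y\<^sup>T \<and>
    Y\<^sup>T * Y = mat_diag q (\<lambda>k. (if k < p then a k else 0) + b k) \<and>
    Y\<^sup>T * diag_part p S * Y = mat_diag q (\<lambda>k. (if k < p then (a k)\<^sup>2 else 0) + (b k)\<^sup>2)"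
proof -
  let ?E = "emb1 p q" and ?F = "emb2 p q" and ?P = "upper_left p q (1\<^sub>m (p + q)) :: real mat"
  define Z1 where "Z1 = U1 * mat_diag p (\<lambda>i. sqrt (a i))"
  define Z2 where "Z2 = U2 * mat_diag q (\<lambda>i. sqrt (b i))"
  note z1 = eigen_root[OF e1 a Z1_def] and z2 = eigen_root[OF e2 b Z2_def]
  have U: "dim_row U1 = p" "dim_col U1 = p" "dim_row U2 = q" "dim_col U2 = q"
    using e1 e2 by (auto simp: eigendecomposition_def)
  note cz = carrier_matD[OF z1(1)] carrier_matD[OF z2(1)]
  note PP = truncation_facts[OF pq]
  note EE = emb_orthonormal[of p q]
  define Y where "Y = ?E * (Z1 * ?P) + ?F * Z2"
  have E_cancel: "?E\<^sup>T * (?E * M) = M" "?F\<^sup>T * (?E * M) = 0\<^sub>m q (dim_col M)" if "dim_row M = p" for M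
    using inverse_cancel_left[OF EE(1), of M] mult_assoc_dim[of "?F\<^sup>T" ?E M] that
    by (simp_all add: EE zero_mult_dim)
  have F_cancel: "?F\<^sup>T * (?F * M) = M" "?E\<^sup>T * (?F * M) = 0\<^sub>m p (dim_col M)" if "dim_row M = q" for M
    using inverse_cancel_left[OF EE(2), of M] mult_assoc_dim[of "?E\<^sup>T" ?F M] that
    by (simp_all add: EE zero_mult_dim)
  have diag_add: "mat_diag q f + mat_diag q g = mat_diag q (\<lambda>k. f k + g k)" for f g :: "nat \<Rightarrow> real"
    by (intro eq_matI) auto
  have Y: "Y \<in> carrier_mat (p + q) q" by (auto simp: Y_def cz intro!: carrier_matI)
  have Psi: "Psi_m p q U1 (mat_diag p a) U2 (mat_diag q b) = Z1 * (?P * Z2\<^sup>T)"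
    using U a b by (simp add: Psi_m_def Z1_def Z2_def psd_sqrt_mat_diag less_imp_le mult_assoc_dim transpose_mult_dim)
  have PP_cancel: "?P * (?P\<^sup>T * M) = M" if "dim_row M = p" for M
    using inverse_cancel_left[OF PP(1), of M] that by simp
  have tY: "Y\<^sup>T = ?P\<^sup>T * (Z1\<^sup>T * ?E\<^sup>T) + Z2\<^sup>T * ?F\<^sup>T"
    unfolding Y_def using cz
    by (subst transpose_add[of _ "p + q" q]) (auto simp: transpose_mult_dim mult_assoc_dim intro!: carrier_matI)
  have "Sigma_m p q S U1 (mat_diag p a) U2 (mat_diag q b) = four_block_mat
      (Z1 * Z1\<^sup>T) (Z1 * (?P * Z2\<^sup>T))
      (Z2 * (?P\<^sup>T * Z1\<^sup>T)) (Z2 * Z2\<^sup>T)"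
    unfolding Sigma_m_def Psi using cz by (simp add: transpose_mult_dim mult_assoc_dim z1(2) z2(2))
  also have "\<dots> = Y * Y\<^sup>T"
  proof -
    have add4: "A + B + (C + D) = A + C + (B + D)"
      if "A \<in> carrier_mat (p + q) (p + q)" "B \<in> carrier_mat (p + q) (p + q)" "C \<in> carrier_mat (p + q) (p + q)"
         "D \<in> carrier_mat (p + q) (p + q)" for A B C D :: "real mat"
      using that by (intro eq_matI) auto
    show ?thesis
      using cz unfolding tY unfolding Y_def
      by (subst four_block_mat_emb)
        (auto simp: add_mult_dim mult_add_dim mult_assoc_dim PP_cancel intro!: carrier_matI add4)
  qed
  finally have "Sigma_m p q S U1 (mat_diag p a) U2 (mat_diag q b) = Y * Y\<^sup>T" .
  moreover have "Y\<^sup>T * Y = ?P\<^sup>T * (Z1\<^sup>T * Z1) * ?P + Z2\<^sup>T * Z2"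
    unfolding tY unfolding Y_def using cz
    by (simp add: add_mult_dim mult_add_dim mult_assoc_dim E_cancel F_cancel mult_zero_dim add_zero_dim)
  then have "Y\<^sup>T * Y = mat_diag q (\<lambda>k. (if k < p then a k else 0) + b k)"
    by (simp only: z1(3) z2(3) PP(2) diag_add)
  moreover have "Y\<^sup>T * diag_part p S * Y
      = ?P\<^sup>T * (Z1\<^sup>T * upper_left p p S * Z1) * ?P + Z2\<^sup>T * lower_right p p S * Z2"
  proof -
    have "diag_part p S = ?E * upper_left p p S * ?E\<^sup>T + ?F * lower_right p p S * ?F\<^sup>T"
      unfolding diag_part_def using S by (intro diag_block_mat_emb) (auto intro!: carrier_matI)
    then show ?thesis
      unfolding tY unfolding Y_def using cz S
      by (simp add: add_mult_dim mult_add_dim mult_assoc_dim E_cancel F_cancel mult_zero_dim add_zero_dim)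
  qed
  then have "Y\<^sup>T * diag_part p S * Y = mat_diag q (\<lambda>k. (if k < p then (a k)\<^sup>2 else 0) + (b k)\<^sup>2)"
    by (simp only: z1(4) z2(4) PP(2) diag_add)
  ultimately show ?thesis using Y by blast
qed

text \<open>\<open>\<Sigma>\<^sub>m\<close> has rank \<open>q\<close>, so for positive \<open>p\<close> there is no invertible transport map to it.
  Instead, with \<open>\<Sigma>\<^sub>m = Y Y\<^sup>T\<close> both orders of the product are Gram matrices \<open>N N\<^sup>T\<close> for which
  \<open>N\<^sup>T N\<close> is the same diagonal matrix: \<open>N = S\<^sub>0\<^sup>1\<^sup>/\<^sup>2 Y\<close>, respectively \<open>Y\<close> with rescaled columns.
  The first order occurs in \<^const>\<open>c2\<close>, the other one in \<^const>\<open>dW2\<close>.\<close>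

lemma Sigma_m_fidelity:
  assumes S: "S \<in> pd_mats (p + q)" and pq: "p \<le> q"
    and e1: "eigendecomposition p (upper_left p p S) U1 (mat_diag p a)" and a: "\<And>i. i < p \<Longrightarrow> 0 < a i"
    and e2: "eigendecomposition q (lower_right p p S) U2 (mat_diag q b)" and b: "\<And>i. i < q \<Longrightarrow> 0 < b i"
  defines "T \<equiv> Sigma_m p q S U1 (mat_diag p a) U2 (mat_diag q b)"
  shows "T \<in> psd_mats (p + q)"
    and "mat_trace (psd_sqrt (psd_sqrt T * diag_part p S * psd_sqrt T)) = aligned_fidelity p q a b"
    and "mat_trace (psd_sqrt (psd_sqrt (diag_part p S) * T * psd_sqrt (diag_part p S))) = aligned_fidelity p q a b"
proof -
  define e where "e k = (if k < p then a k else 0) + b k" for k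
  define f where "f k = (if k < p then (a k)\<^sup>2 else 0) + (b k)\<^sup>2" for k
  have e: "0 < e k" and f: "0 < f k" if "k < q" for k
    using a[of k] b[OF that] by (auto simp: e_def f_def intro!: add_pos_pos)
  have cS: "S \<in> carrier_mat (p + q) (p + q)" using pd_matsD[OF S] by auto
  have dS0: "dim_row (diag_part p S) = p + q" "dim_col (diag_part p S) = p + q"
    using diag_part_dims[OF cS] by auto
  obtain Y where Y: "Y \<in> carrier_mat (p + q) q" "T = Y * Y\<^sup>T"
      "Y\<^sup>T * Y = mat_diag q e" "Y\<^sup>T * diag_part p S * Y = mat_diag q f"
    using Sigma_m_gram[OF cS pq e1 a e2 b] unfolding T_def e_def[abs_def] f_def[abs_def] by blast
  have F: "aligned_fidelity p q a b = (\<Sum>k<q. sqrt (f k))" by (simp add: aligned_fidelity_def f_def)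
  show "T \<in> psd_mats (p + q)" unfolding Y(2) by (rule psd_gram[OF Y(1)])
  define N where "N = Y * mat_diag q (\<lambda>k. sqrt (f k) / sqrt (e k))"
  have N: "N \<in> carrier_mat (p + q) q" using Y(1) by (auto simp: N_def intro!: carrier_matI)
  have rootT: "psd_sqrt T = Y * mat_diag q (\<lambda>k. 1 / sqrt (e k)) * Y\<^sup>T"
    unfolding Y(2) by (rule psd_sqrt_gram(1)[OF Y(1,3) e])
  let ?D = "mat_diag q (\<lambda>k. 1 / sqrt (e k))" and ?G = "mat_diag q (\<lambda>k. sqrt (f k) / sqrt (e k))"
  have DfD: "?D * (mat_diag q f * ?D) = ?G * ?G"
    unfolding mat_diag_diag by (rule eq_matI) (auto dest: f e simp: less_imp_le)
  have "psd_sqrt T * diag_part p S * psd_sqrt T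
      = Y * (?D * ((Y\<^sup>T * diag_part p S * Y) * ?D)) * Y\<^sup>T"
    unfolding rootT using Y(1) dS0 by (simp add: mult_assoc_dim del: mat_diag_diag)
  also have "\<dots> = N * N\<^sup>T"
    unfolding Y(4) DfD using Y(1) by (simp add: N_def transpose_mult_dim mult_assoc_dim del: mat_diag_diag)
  finally have 1: "psd_sqrt T * diag_part p S * psd_sqrt T = N * N\<^sup>T" .
  have "N\<^sup>T * N = ?G * (Y\<^sup>T * Y) * ?G"
    using Y(1) by (simp add: N_def transpose_mult_dim mult_assoc_dim del: mat_diag_diag)
  also have "\<dots> = mat_diag q f"
  proof -
    have "x / y * (y * y) * (x / y) = x * x" if "y \<noteq> 0" for x y :: real using that by simp
    from this[of "sqrt (e k)" "sqrt (f k)" for k]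
    have "sqrt (f k) / sqrt (e k) * e k * (sqrt (f k) / sqrt (e k)) = f k" if "k < q" for k
      using e[OF that] f[OF that] by (metis abs_of_pos less_irrefl real_sqrt_eq_0_iff real_sqrt_mult_self)
    then show ?thesis unfolding Y(3) mat_diag_diag by (intro eq_matI) auto
  qed
  finally have NN: "N\<^sup>T * N = mat_diag q f" .
  show "mat_trace (psd_sqrt (psd_sqrt T * diag_part p S * psd_sqrt T)) = aligned_fidelity p q a b"
    unfolding 1 F by (rule psd_sqrt_gram(2)[OF N NN f])
  define R where "R = psd_sqrt (diag_part p S)"
  have S0: "diag_part p S \<in> psd_mats (p + q)" by (rule pd_psd[OF diag_part_pd[OF S]])
  have R: "R \<in> psd_mats (p + q)" "R * R = diag_part p S"
    using psd_sqrt_psd[OF S0] psd_sqrt_square[OF S0] by (simp_all add: R_def)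
  note dR = psd_matsD[OF R(1)]
  have M: "R * Y \<in> carrier_mat (p + q) q" using dR Y(1) by (auto intro!: carrier_matI)
  have "transpose_mat (R * Y) * (R * Y) = Y\<^sup>T * (R * R) * Y"
    using dR Y(1) by (simp add: transpose_mult_dim mult_assoc_dim)
  then have MM: "transpose_mat (R * Y) * (R * Y) = mat_diag q f" by (simp only: R(2) Y(4))
  have 2: "R * T * R = (R * Y) * transpose_mat (R * Y)"
    unfolding Y(2) using dR Y(1) by (simp add: transpose_mult_dim mult_assoc_dim)
  have "mat_trace (psd_sqrt (R * T * R)) = aligned_fidelity p q a b"
    unfolding 2 F by (rule psd_sqrt_gram(2)[OF M MM f])
  then show "mat_trace (psd_sqrt (psd_sqrt (diag_part p S) * T * psd_sqrt (diag_part p S))) = aligned_fidelity p q a b"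
    by (simp add: R_def)
qed

lemma trace_blocks:
  assumes "A \<in> carrier_mat (p + q) (p + q)"
  shows "mat_trace A = mat_trace (upper_left p p A) + mat_trace (lower_right p p A)"
proof -
  have "(\<Sum>i<p + m. A $$ (i, i)) = (\<Sum>i<p. A $$ (i, i)) + (\<Sum>i<m. A $$ (i + p, i + p))" for m
    by (induction m) (simp_all add: add.commute)
  then show ?thesis using assms by (simp add: mat_trace_def)
qed

lemma diag_part_cong:
  "upper_left p p A = upper_left p p B \<Longrightarrow> lower_right p p A = lower_right p p B \<Longrightarrow> diag_part p A = diag_part p B"
  by (simp add: diag_part_def)

lemma Sup_dW2:
  assumes S: "S \<in> pd_mats (p + q)" and pq: "p \<le> q"
    and e1: "eigendecomposition p (upper_left p p S) U1 (mat_diag p a)" and a: "\<And>i. i < p \<Longrightarrow> 0 < a i"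
    and e2: "eigendecomposition q (lower_right p p S) U2 (mat_diag q b)" and b: "\<And>i. i < q \<Longrightarrow> 0 < b i"
  shows "(SUP T \<in> Gamma_set p q (upper_left p p S) (lower_right p p S). dW2 T (diag_part p S))
    = 2 * mat_trace S - 2 * aligned_fidelity p q a b"
proof (rule cSup_eq_maximum)
  have cS: "S \<in> carrier_mat (p + q) (p + q)" using pd_matsD[OF S] by auto
  let ?T = "Sigma_m p q S U1 (mat_diag p a) U2 (mat_diag q b)"
  note T = Sigma_m_fidelity[OF S pq e1 a e2 b]
  have trace: "mat_trace T = mat_trace S" if "T \<in> Gamma_set p q (upper_left p p S) (lower_right p p S)" for T
  proof -
    have "T \<in> carrier_mat (p + q) (p + q)" using that by (auto simp: Gamma_set_def psd_mats_def sym_mats_def)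
    then show ?thesis using that cS by (simp add: trace_blocks[of _ p q] Gamma_set_def)
  qed
  have "upper_left p p ?T = upper_left p p S"
    using cS by (intro eq_matI) (auto simp: Sigma_m_def)
  moreover have "lower_right p p ?T = lower_right p p S"
    using cS by (intro eq_matI) (auto simp: Sigma_m_def Psi_m_def)
  ultimately have mem: "?T \<in> Gamma_set p q (upper_left p p S) (lower_right p p S)"
    using T(1) by (simp add: Gamma_set_def)
  have "dW2 ?T (diag_part p S) = 2 * mat_trace S - 2 * aligned_fidelity p q a b"
    using T(2) trace[OF mem] cS by (simp add: dW2_def diag_part_trace)
  then show "2 * mat_trace S - 2 * aligned_fidelity p q a b
      \<in> (\<lambda>T. dW2 T (diag_part p S)) ` Gamma_set p q (upper_left p p S) (lower_right p p S)"
    using mem by (metis image_eqI)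
  fix x assume "x \<in> (\<lambda>T. dW2 T (diag_part p S)) ` Gamma_set p q (upper_left p p S) (lower_right p p S)"
  then obtain T where x: "x = dW2 T (diag_part p S)" and mem: "T \<in> Gamma_set p q (upper_left p p S) (lower_right p p S)"
    by blast
  then have blocks: "T \<in> psd_mats (p + q)" "upper_left p p T = upper_left p p S" "lower_right p p T = lower_right p p S"
    by (auto simp: Gamma_set_def)
  have "aligned_fidelity p q a b \<le> mat_trace (psd_sqrt (psd_sqrt T * diag_part p T * psd_sqrt T))"
    using coupling_fidelity_ge[OF blocks(1) pq, unfolded blocks(2,3), OF e1 a e2 b] .
  then show "x \<le> 2 * mat_trace S - 2 * aligned_fidelity p q a b"
    using trace[OF mem] cS by (simp add: x dW2_def diag_part_trace diag_part_cong[OF blocks(2,3)])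
qed

lemma pd_blocks:
  assumes S: "S \<in> pd_mats (p + q)"
  shows "upper_left p p S \<in> pd_mats p" "lower_right p p S \<in> pd_mats q"
proof -
  have cS: "S \<in> carrier_mat (p + q) (p + q)" using pd_matsD[OF S] by auto
  show "upper_left p p S \<in> pd_mats p"
    unfolding upper_left_emb[OF cS]
    by (rule pd_congruence[OF S emb_carrier(1) _ emb_orthonormal(1)]) (auto intro!: carrier_matI)
  show "lower_right p p S \<in> pd_mats q"
    unfolding lower_right_emb[OF cS]
    by (rule pd_congruence[OF S emb_carrier(2) _ emb_orthonormal(2)]) (auto intro!: carrier_matI)
qed

lemma sym_blocks:
  assumes S: "S \<in> sym_mats (p + q)"
  shows "upper_left p p S \<in> sym_mats p" "lower_right p p S \<in> sym_mats q"
proof -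
  have cS: "S \<in> carrier_mat (p + q) (p + q)" using sym_matsD[OF S] by auto
  show "upper_left p p S \<in> sym_mats p"
    unfolding upper_left_emb[OF cS] by (rule sym_congruence[OF S emb_carrier(1)])
  show "lower_right p p S \<in> sym_mats q"
    unfolding lower_right_emb[OF cS] by (rule sym_congruence[OF S emb_carrier(2)])
qed

lemma eigenvalues_pos:
  assumes "A \<in> pd_mats n" "eigendecomposition n A U (mat_diag n l)" "i < n"
  shows "0 < l i"
  by (rule pd_eigenvalues[OF assms(1) eigendecompositionD(1-3)[OF assms(2)] assms(3)])

lemma D2_coeff_eq:
  assumes S: "S \<in> pd_mats (p + q)" and pq: "p \<le> q"
    and e1: "eigendecomposition p (upper_left p p S) U1 (mat_diag p a)"
    and e2: "eigendecomposition q (lower_right p p S) U2 (mat_diag q b)"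
  shows "D2_coeff p q S = (mat_trace S - fidelity p S) / (mat_trace S - aligned_fidelity p q a b)"
proof -
  note Sup = Sup_dW2[OF S pq e1 eigenvalues_pos[OF pd_blocks(1)[OF S] e1] e2 eigenvalues_pos[OF pd_blocks(2)[OF S] e2]]
  have "D2_coeff p q S = (2 * (mat_trace S - fidelity p S)) / (2 * (mat_trace S - aligned_fidelity p q a b))"
    unfolding D2_coeff_def dW2_diag_part[OF S] by (simp only: Sup right_diff_distrib)
  then show ?thesis by (simp only: mult_divide_mult_cancel_left_if) simp
qed

text \<open>An eigenvector has a non-zero coordinate in the eigenbasis, and the corresponding diagonal
  entry is its eigenvalue.\<close>

lemma spectrum_subset_eigenvalues:
  assumes A: "eigendecomposition n A U (mat_diag n l)"
  shows "spectrum A \<subseteq> l ` {..<n}"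
proof
  fix x assume "x \<in> spectrum A"
  note U = eigendecompositionD(1-4)[OF A] and c = eigendecompositionD(5)[OF A]
  obtain v where v: "v \<in> carrier_vec n" "v \<noteq> 0\<^sub>v n" "A *\<^sub>v v = x \<cdot>\<^sub>v v"
    using \<open>x \<in> spectrum A\<close> c by (auto simp: spectrum_def eigenvalue_def eigenvector_def)
  define w where "w = U\<^sup>T *\<^sub>v v"
  have w: "w \<in> carrier_vec n" using U(1) by (auto simp: w_def intro!: carrier_vecI)
  have Uw: "U *\<^sub>v w = v"
    using mult_vec_assoc_dim[of U "U\<^sup>T" v] U(1,4) v(1) by (simp add: w_def)
  have "w \<noteq> 0\<^sub>v n"
  proof
    assume "w = 0\<^sub>v n"
    then have "v = 0\<^sub>v n" using Uw U(1) by (auto simp: scalar_prod_def)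
    then show False using v(2) by simp
  qed
  then obtain i where i: "i < n" "w $ i \<noteq> 0" using w by (metis carrier_vecD eq_vecI index_zero_vec)
  have "mat_diag n l * U\<^sup>T = U\<^sup>T * A"
    unfolding U(3) using U(1) by (simp add: mult_assoc_dim inverse_cancel_left[OF U(2)])
  then have "mat_diag n l *\<^sub>v w = U\<^sup>T *\<^sub>v (A *\<^sub>v v)"
    using U(1) v(1) c mult_vec_assoc_dim[of "mat_diag n l" "U\<^sup>T" v]
      mult_vec_assoc_dim[of "U\<^sup>T" A v] by (simp add: w_def)
  also have "\<dots> = x \<cdot>\<^sub>v w"
    unfolding v(3) w_def by (rule mult_mat_vec[of _ n n]) (use U(1) v(1) in auto)
  finally have "(mat_diag n l *\<^sub>v w) $ i = (x \<cdot>\<^sub>v w) $ i" by simp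
  moreover have "(mat_diag n l *\<^sub>v w) $ i = l i * w $ i"
    by (rule mat_diag_mult_vec_index[OF w i(1)])
  ultimately have "x = l i" using i w by simp
  then show "x \<in> l ` {..<n}" using i by simp
qed

text \<open>\<^const>\<open>spectrum\<close> is a set, so \<open>n\<close> elements require the \<open>n\<close> diagonal entries to differ.\<close>

lemma eigenvalues_distinct:
  assumes A: "eigendecomposition n A U (mat_diag n l)" and card: "card (spectrum A) = n"
    and ij: "i < n" "j < n" "i \<noteq> j"
  shows "l i \<noteq> l j"
proof -
  have "n \<le> card (l ` {..<n})"
    using card_mono[OF _ spectrum_subset_eigenvalues[OF A]] card by simp
  then have "card (l ` {..<n}) = card {..<n}" using card_image_le[of "{..<n}" l] by simp
  then have "inj_on l {..<n}" by (simp add: inj_on_iff_eq_card)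
  then show ?thesis using ij by (auto simp: inj_on_def)
qed

section \<open>Difference quotients\<close>

text \<open>One-sided derivatives at zero are limits of difference quotients in which the value at
  zero is a separate number, because a perturbation is constrained for positive times only.\<close>

lemma quotient_limit:
  fixes X :: "real \<Rightarrow> real"
  assumes "((\<lambda>t. (X t - x) / t) \<longlongrightarrow> x') (at_right 0)"
  shows "(X \<longlongrightarrow> x) (at_right 0)"
proof -
  have "((\<lambda>t. x + t * ((X t - x) / t)) \<longlongrightarrow> x + 0 * x') (at_right 0)"
    by (intro tendsto_intros assms)
  moreover have "\<forall>\<^sub>F t in at_right 0. x + t * ((X t - x) / t) = X t"
    using eventually_at_right_less[of 0] by eventually_elim simp
  ultimately show ?thesis by (simp add: Lim_transform_eventually)
qed

lemma quotient_divide: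
  fixes X Y :: "real \<Rightarrow> real"
  assumes X: "((\<lambda>t. (X t - x) / t) \<longlongrightarrow> x') (at_right 0)"
    and Y: "((\<lambda>t. (Y t - y) / t) \<longlongrightarrow> y') (at_right 0)" and y: "y \<noteq> 0"
  shows "((\<lambda>t. (X t / Y t - x / y) / t) \<longlongrightarrow> (x' - x / y * y') / y) (at_right 0)"
proof -
  have lim: "((\<lambda>t. ((X t - x) / t - x / y * ((Y t - y) / t)) / Y t) \<longlongrightarrow> (x' - x / y * y') / y) (at_right 0)"
    by (intro tendsto_divide tendsto_diff tendsto_mult X Y tendsto_const quotient_limit[OF Y] y)
  have "\<forall>\<^sub>F t in at_right 0. ((X t - x) / t - x / y * ((Y t - y) / t)) / Y t = (X t / Y t - x / y) / t"
    using eventually_at_right_less[of 0] tendsto_imp_eventually_ne[OF quotient_limit[OF Y] y]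
    by eventually_elim (use y in \<open>simp add: field_simps\<close>)
  then show ?thesis by (rule Lim_transform_eventually[OF lim])
qed

text \<open>The difference of the roots is multiplied by their sum.\<close>

lemma quotient_sqrt_sum_squares:
  fixes X Y :: "real \<Rightarrow> real"
  assumes X: "((\<lambda>t. (X t - x) / t) \<longlongrightarrow> x') (at_right 0)"
    and Y: "((\<lambda>t. (Y t - y) / t) \<longlongrightarrow> y') (at_right 0)" and y: "0 < y"
  shows "((\<lambda>t. (sqrt ((X t)\<^sup>2 + (Y t)\<^sup>2) - sqrt (x\<^sup>2 + y\<^sup>2)) / t)
    \<longlongrightarrow> (x * x' + y * y') / sqrt (x\<^sup>2 + y\<^sup>2)) (at_right 0)"
proof -
  let ?s = "sqrt (x\<^sup>2 + y\<^sup>2)" and ?r = "\<lambda>t. sqrt ((X t)\<^sup>2 + (Y t)\<^sup>2)"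
  have s: "0 < ?s" using y by (simp add: add_nonneg_pos)
  have "((\<lambda>t. ((X t + x) * ((X t - x) / t) + (Y t + y) * ((Y t - y) / t)) / (?r t + ?s))
      \<longlongrightarrow> ((x + x) * x' + (y + y) * y') / (?s + ?s)) (at_right 0)"
    using s by (intro tendsto_divide tendsto_add tendsto_mult tendsto_real_sqrt tendsto_power
        X Y quotient_limit[OF X] quotient_limit[OF Y] tendsto_const) auto
  moreover have "((x + x) * x' + (y + y) * y') / (?s + ?s) = (x * x' + y * y') / ?s"
  proof -
    have "((x + x) * x' + (y + y) * y') / (?s + ?s) = (2 * (x * x' + y * y')) / (2 * ?s)"
      by (simp add: algebra_simps)
    then show ?thesis by (simp only: mult_divide_mult_cancel_left_if) simp
  qed
  moreover have "\<forall>\<^sub>F t in at_right 0. ((X t + x) * ((X t - x) / t) + (Y t + y) * ((Y t - y) / t)) / (?r t + ?s) = (?r t - ?s) / t"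
    using eventually_at_right_less[of 0]
  proof eventually_elim
    case (elim t)
    have pos: "0 < ?r t + ?s" using s by (simp add: add_nonneg_pos)
    have "(?r t - ?s) * (?r t + ?s) = (?r t)\<^sup>2 - ?s\<^sup>2" by (simp add: power2_eq_square algebra_simps)
    also have "\<dots> = (X t + x) * (X t - x) + (Y t + y) * (Y t - y)"
      by (simp add: power2_eq_square algebra_simps)
    finally have "?r t - ?s = ((X t + x) * (X t - x) + (Y t + y) * (Y t - y)) / (?r t + ?s)"
      using pos by (simp add: nonzero_eq_divide_eq)
    then show ?case by (simp add: add_divide_distrib divide_divide_eq_left mult.commute)
  qed
  ultimately show ?thesis by (simp add: Lim_transform_eventually)
qed

lemma trace_diag_conjugate:
  fixes U K :: "real mat"
  assumes "U \<in> carrier_mat n n" "K \<in> carrier_mat n n"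
  shows "mat_trace (U * mat_diag n f * U\<^sup>T * K) = (\<Sum>k<n. f k * (U\<^sup>T * K * U) $$ (k, k))"
proof -
  have "mat_trace (U * mat_diag n f * U\<^sup>T * K) = mat_trace (mat_diag n f * (U\<^sup>T * K * U))"
    using assms mat_trace_commute[of U "mat_diag n f * (U\<^sup>T * K)"] by (simp add: mult_assoc_dim)
  also have "U\<^sup>T * K * U \<in> carrier_mat n n" using assms by auto
  then have "mat_trace (mat_diag n f * (U\<^sup>T * K * U)) = (\<Sum>k<n. f k * (U\<^sup>T * K * U) $$ (k, k))"
    by (simp add: mat_diag_mult_left mat_trace_def)
  finally show ?thesis .
qed

text \<open>For \<open>k \<ge> p\<close> the ratio \<open>b\<^sub>k / s\<^sub>k\<close> is one, which is the identity block of \<^const>\<open>Delta2\<close>.\<close>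

lemma Upsilon2_trace:
  assumes U: "U1 \<in> carrier_mat p p" "U2 \<in> carrier_mat q q" and K: "K \<in> carrier_mat (p + q) (p + q)" and pq: "p \<le> q"
    and a: "\<And>i. i < p \<Longrightarrow> 0 < a i" and b: "\<And>i. i < q \<Longrightarrow> 0 < b i"
  defines "s \<equiv> \<lambda>k. sqrt ((if k < p then (a k)\<^sup>2 else 0) + (b k)\<^sup>2)"
  shows "mat_trace (Upsilon2 p q U1 (mat_diag p a) U2 (mat_diag q b) * K) =
      (\<Sum>k<p. a k / s k * (U1\<^sup>T * upper_left p p K * U1) $$ (k, k)) +
      (\<Sum>k<q. b k / s k * (U2\<^sup>T * lower_right p p K * U2) $$ (k, k))"
    and "Upsilon2 p q U1 (mat_diag p a) U2 (mat_diag q b) \<in> carrier_mat (p + q) (p + q)"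
proof -
  let ?E = "emb1 p q" and ?F = "emb2 p q"
  have s: "0 < s k" if "k < q" for k using b[OF that] by (simp add: s_def add_nonneg_pos)
  have ul: "upper_left p p (mat_diag q b) = mat_diag p b" using pq by (intro eq_matI) auto
  have sq: "mat_diag p a * mat_diag p a + mat_diag p b * mat_diag p b = mat_diag p (\<lambda>k. (s k)\<^sup>2)"
    unfolding mat_diag_diag by (rule eq_matI) (auto simp: s_def power2_eq_square[symmetric])
  have root: "psd_sqrt (mat_diag p (\<lambda>k. (s k)\<^sup>2)) = mat_diag p s"
    using s pq by (subst psd_sqrt_mat_diag) (auto intro!: eq_matI simp: less_imp_le)
  have inv: "mat_inv (mat_diag p s) = mat_diag p (\<lambda>k. 1 / s k)"
  proof (rule mat_inv_eqI)
    show "mat_diag p s * mat_diag p (\<lambda>k. 1 / s k) = 1\<^sub>m p"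
      unfolding mat_diag_diag using s pq by (intro eq_matI) (auto simp: less_imp_neq[symmetric])
  qed auto
  have D1: "Delta1 p (mat_diag p a) (mat_diag q b) = mat_diag p (\<lambda>k. a k / s k)"
    unfolding Delta1_def ul sq root inv by simp
  have ratio: "mat_inv (psd_sqrt (mat_diag p a * mat_diag p a + mat_diag p b * mat_diag p b)) * mat_diag p b = mat_diag p (\<lambda>k. b k / s k)"
    unfolding sq root inv by simp
  have one: "b k / s k = 1" if "p \<le> k" "k < q" for k
    using b[OF that(2)] that(1) by (simp add: s_def)
  have D2: "Delta2 p q (mat_diag p a) (mat_diag q b) = mat_diag q (\<lambda>k. b k / s k)"
    unfolding Delta2_def ul ratio diag_block_mat_pair
  proof (rule eq_matI)
    fix i j assume "i < dim_row (mat_diag q (\<lambda>k. b k / s k))" "j < dim_col (mat_diag q (\<lambda>k. b k / s k))"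
    then have "i < q" "j < q" by auto
    moreover have "i = j" if "i - p = j - p" "\<not> i < p" "\<not> j < p" using that by simp
    moreover have "b j / s j = 1" if "\<not> j < p" using that \<open>j < q\<close> by (intro one) auto
    ultimately show "four_block_mat (mat_diag p (\<lambda>k. b k / s k)) (0\<^sub>m (dim_row (mat_diag p (\<lambda>k. b k / s k))) (dim_col (1\<^sub>m (q - p) :: real mat)))
        (0\<^sub>m (dim_row (1\<^sub>m (q - p) :: real mat)) (dim_col (mat_diag p (\<lambda>k. b k / s k)))) (1\<^sub>m (q - p)) $$ (i, j)
        = mat_diag q (\<lambda>k. b k / s k) $$ (i, j)"
      using pq by (simp del: divide_eq_1_iff) auto
  qed (use pq in auto)
  let ?A = "U1 * mat_diag p (\<lambda>k. a k / s k) * U1\<^sup>T" and ?B = "U2 * mat_diag q (\<lambda>k. b k / s k) * U2\<^sup>T"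
  have c: "?A \<in> carrier_mat p p" "?B \<in> carrier_mat q q" using U by auto
  have Ups: "Upsilon2 p q U1 (mat_diag p a) U2 (mat_diag q b) = ?E * ?A * ?E\<^sup>T + ?F * ?B * ?F\<^sup>T"
    unfolding Upsilon2_def D1 D2 by (rule diag_block_mat_emb[OF c])
  then show "Upsilon2 p q U1 (mat_diag p a) U2 (mat_diag q b) \<in> carrier_mat (p + q) (p + q)"
    by (auto intro!: carrier_matI)
  have block: "mat_trace (G * A * G\<^sup>T * K) = mat_trace (A * (G\<^sup>T * K * G))"
    if "G \<in> carrier_mat (p + q) m" "A \<in> carrier_mat m m" for G A m
    using that K mat_trace_commute[of G "A * (G\<^sup>T * K)"] by (simp add: mult_assoc_dim)
  have "mat_trace (Upsilon2 p q U1 (mat_diag p a) U2 (mat_diag q b) * K)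
      = mat_trace (?E * ?A * ?E\<^sup>T * K) + mat_trace (?F * ?B * ?F\<^sup>T * K)"
    unfolding Ups using K by (simp add: add_mult_dim trace_dim)
  also have "\<dots> = mat_trace (?A * upper_left p p K) + mat_trace (?B * lower_right p p K)"
    unfolding block[OF emb_carrier(1) c(1)] block[OF emb_carrier(2) c(2)]
    by (simp only: upper_left_emb[OF K] lower_right_emb[OF K])
  also have "\<dots> = (\<Sum>k<p. a k / s k * (U1\<^sup>T * upper_left p p K * U1) $$ (k, k)) +
      (\<Sum>k<q. b k / s k * (U2\<^sup>T * lower_right p p K * U2) $$ (k, k))"
    using K by (subst (1 2) trace_diag_conjugate) (auto intro!: U carrier_matI)
  finally show "mat_trace (Upsilon2 p q U1 (mat_diag p a) U2 (mat_diag q b) * K) =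
      (\<Sum>k<p. a k / s k * (U1\<^sup>T * upper_left p p K * U1) $$ (k, k)) +
      (\<Sum>k<q. b k / s k * (U2\<^sup>T * lower_right p p K * U2) $$ (k, k))" .
qed

text \<open>The denominator of the coefficient is positive: the trace of \<open>S\<close> is the right-hand side,
  and \<open>sqrt (a\<^sub>k\<^sup>2 + b\<^sub>k\<^sup>2) < a\<^sub>k + b\<^sub>k\<close> holds at \<open>k = 0\<close> because \<open>p\<close> is positive.\<close>

lemma aligned_fidelity_less:
  assumes "1 \<le> p" "p \<le> q" and a: "\<And>i. i < p \<Longrightarrow> 0 < a i" and b: "\<And>i. i < q \<Longrightarrow> 0 < b i"
  shows "aligned_fidelity p q a b < (\<Sum>i<p. a i) + (\<Sum>i<q. b i)"
proof -
  have lt: "sqrt ((a k)\<^sup>2 + (b k)\<^sup>2) < a k + b k" if "k < p" for k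
  proof -
    have ab: "0 < a k" "0 < b k" using a b that assms(2) by auto
    have "(a k)\<^sup>2 + (b k)\<^sup>2 < (a k + b k)\<^sup>2" using ab by (simp add: power2_sum)
    then show ?thesis using ab by (intro real_less_lsqrt) auto
  qed
  have "aligned_fidelity p q a b < (\<Sum>k<q. (if k < p then a k else 0) + b k)"
    unfolding aligned_fidelity_def
  proof (rule sum_strict_mono_ex1)
    show "\<forall>k\<in>{..<q}. sqrt ((if k < p then (a k)\<^sup>2 else 0) + (b k)\<^sup>2) \<le> (if k < p then a k else 0) + b k"
      using lt b by (auto simp: less_imp_le)
    show "\<exists>k\<in>{..<q}. sqrt ((if k < p then (a k)\<^sup>2 else 0) + (b k)\<^sup>2) < (if k < p then a k else 0) + b k"
      using lt[of 0] assms(1,2) by (intro bexI[of _ 0]) auto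
  qed simp
  also have "\<dots> = (\<Sum>i<p. a i) + (\<Sum>i<q. b i)"
    unfolding sum.distrib using assms(2)
    by (intro arg_cong2[of _ _ _ _ "(+)"] sum.mono_neutral_cong_right) auto
  finally show ?thesis .
qed

lemma aligned_fidelity_derivative:
  assumes pq: "p \<le> q" and b: "\<And>i. i < q \<Longrightarrow> 0 < b i"
    and A: "\<And>k. k < p \<Longrightarrow> ((\<lambda>t. (A t k - a k) / t) \<longlongrightarrow> a' k) (at_right 0)"
    and B: "\<And>k. k < q \<Longrightarrow> ((\<lambda>t. (B t k - b k) / t) \<longlongrightarrow> b' k) (at_right 0)"
  defines "s \<equiv> \<lambda>k. sqrt ((if k < p then (a k)\<^sup>2 else 0) + (b k)\<^sup>2)"
  shows "((\<lambda>t. (aligned_fidelity p q (A t) (B t) - aligned_fidelity p q a b) / t)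
    \<longlongrightarrow> (\<Sum>k<p. a k / s k * a' k) + (\<Sum>k<q. b k / s k * b' k)) (at_right 0)"
proof -
  define x where "x f k = (if k < p then f k else 0)" for f :: "nat \<Rightarrow> real" and k
  have af: "aligned_fidelity p q f g = (\<Sum>k<q. sqrt ((x f k)\<^sup>2 + (g k)\<^sup>2))" for f g
    unfolding aligned_fidelity_def by (intro sum.cong refl) (simp add: x_def)
  have s: "s k = sqrt ((x a k)\<^sup>2 + (b k)\<^sup>2)" for k by (simp add: s_def x_def)
  have "((\<lambda>t. (x (A t) k - x a k) / t) \<longlongrightarrow> x a' k) (at_right 0)" for k
    using A[of k] by (cases "k < p") (simp_all add: x_def)
  then have "((\<lambda>t. \<Sum>k<q. (sqrt ((x (A t) k)\<^sup>2 + (B t k)\<^sup>2) - s k) / t)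
      \<longlongrightarrow> (\<Sum>k<q. (x a k * x a' k + b k * b' k) / s k)) (at_right 0)"
    unfolding s by (intro tendsto_sum quotient_sqrt_sum_squares B b) auto
  moreover have "(\<Sum>k<q. (sqrt ((x (A t) k)\<^sup>2 + (B t k)\<^sup>2) - s k) / t)
      = (aligned_fidelity p q (A t) (B t) - aligned_fidelity p q a b) / t" for t
    unfolding af s sum_divide_distrib[symmetric] sum_subtractf ..
  moreover have "(\<Sum>k<q. (x a k * x a' k + b k * b' k) / s k) = (\<Sum>k<p. a k / s k * a' k) + (\<Sum>k<q. b k / s k * b' k)"
  proof -
    have "(\<Sum>k<q. x a k * x a' k / s k) = (\<Sum>k<p. a k / s k * a' k)"
      by (rule sum.mono_neutral_cong_right) (use pq in \<open>auto simp: x_def\<close>)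
    then show ?thesis by (simp add: add_divide_distrib sum.distrib)
  qed
  ultimately show ?thesis by simp
qed

lemma eigenvalues_trace:
  assumes "eigendecomposition n A U (mat_diag n l)"
  shows "mat_trace A = (\<Sum>i<n. l i)"
proof -
  note U = eigendecompositionD(1-3)[OF assms]
  have "mat_trace A = mat_trace (mat_diag n l)"
    unfolding U(3) using U(1) mat_trace_commute[of "U * mat_diag n l" "U\<^sup>T"]
    by (simp add: inverse_cancel_left[OF U(2)])
  then show ?thesis by (simp add: mat_trace_def)
qed

section \<open>The directional derivative of the coefficient\<close>

theorem theorem4p2:
  fixes p q :: nat
    and S S1 S2 U1 L1 U2 L2 Hlim :: "real mat"
    and H :: "real \<Rightarrow> real mat"
  assumes "1 \<le> p" and "p \<le> q"
    and "S \<in> pd_mats (p + q)"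
    and "S1 = upper_left p p S"
    and "S2 = lower_right p p S"
    and "card (spectrum S1) = p"
    and "card (spectrum S2) = q"
    and "eigendecomposition p S1 U1 L1"
    and "eigendecomposition q S2 U2 L2"
    and "\<And>t. 0 < t \<Longrightarrow> H t \<in> sym_mats (p + q)"
    and "Hlim \<in> sym_mats (p + q)"
    and "\<And>i j. i < p + q \<Longrightarrow> j < p + q \<Longrightarrow>
           ((\<lambda>t. index_mat (H t) (i, j)) \<longlongrightarrow> index_mat Hlim (i, j)) (at_right 0)"
  shows "((\<lambda>t. (D2_coeff p q (S + t \<cdot>\<^sub>m H t) - D2_coeff p q S) / t)
           \<longlongrightarrow> mat_trace (M2 p q S U1 L1 U2 L2 * Hlim)) (at_right 0)"
proof -
  let ?n = "p + q" and ?F = "at_right (0 :: real)"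
  let ?S = "\<lambda>t. S + t \<cdot>\<^sub>m H t"
  note pq = assms(2) and S = assms(3) and Hsym = assms(10)
  have cS: "S \<in> carrier_mat ?n ?n" using pd_matsD[OF S] by auto
  have cK: "Hlim \<in> carrier_mat ?n ?n" using sym_matsD[OF assms(11)] by auto
  have cH: "H t \<in> carrier_mat ?n ?n" if "0 < t" for t using sym_matsD[OF Hsym[OF that]] by auto
  have pos: "\<forall>\<^sub>F t in ?F. 0 < t" by (rule eventually_at_right_less)
  obtain a where L1: "L1 = mat_diag p a" using assms(8) by (rule eigendecomposition_mat_diag)
  obtain b where L2: "L2 = mat_diag q b" using assms(9) by (rule eigendecomposition_mat_diag)
  have e1: "eigendecomposition p (upper_left p p S) U1 (mat_diag p a)" using assms(4,8) L1 by simp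
  have e2: "eigendecomposition q (lower_right p p S) U2 (mat_diag q b)" using assms(5,9) L2 by simp
  have a: "0 < a i" if "i < p" for i by (rule eigenvalues_pos[OF pd_blocks(1)[OF S] e1 that])
  have b: "0 < b i" if "i < q" for i by (rule eigenvalues_pos[OF pd_blocks(2)[OF S] e2 that])
  note U = eigendecompositionD(1)[OF e1] eigendecompositionD(1)[OF e2]

  have Hlim: "mat_tendsto ?n ?n H Hlim ?F"
    by (rule mat_tendstoI[OF cK _ assms(12)]) (use pos in \<open>auto elim: eventually_mono intro: cH\<close>)
  have "mat_tendsto ?n ?n ?S (S + 0 \<cdot>\<^sub>m Hlim) ?F"
    by (intro mat_tendsto_add mat_tendsto_const cS mat_tendsto_smult tendsto_ident_at Hlim)
  moreover have "S + 0 \<cdot>\<^sub>m Hlim = S" using cS cK by (intro eq_matI) auto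
  ultimately have Slim: "mat_tendsto ?n ?n ?S S ?F" by simp
  have Ssym: "?S t \<in> sym_mats ?n" if "0 < t" for t
    using sym_mats_index[OF pd_sym[OF S]] sym_mats_index[OF Hsym[OF that]] cS cH[OF that]
    by (intro sym_matsI eq_matI) auto
  have Spd: "\<forall>\<^sub>F t in ?F. ?S t \<in> pd_mats ?n"
    by (rule eventually_pd[OF Slim S]) (use pos in \<open>auto elim: eventually_mono intro: Ssym\<close>)

  \<comment> \<open>The eigenvectors at each time are an arbitrary choice. Only the sorted eigenvalues enter the
    closed form of the coefficient, and they are determined by the matrix.\<close>
  have ul: "upper_left p p (?S t) = upper_left p p S + t \<cdot>\<^sub>m upper_left p p (H t)" if "0 < t" for t
    using cS cH[OF that] by (intro eq_matI) auto
  have lr: "lower_right p p (?S t) = lower_right p p S + t \<cdot>\<^sub>m lower_right p p (H t)" if "0 < t" for t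
    using cS cH[OF that] by (intro eq_matI) auto
  have "\<forall>t. \<exists>V m. 0 < t \<longrightarrow> eigendecomposition p (upper_left p p (?S t)) V (mat_diag p m)"
    using eigendecomposition_exists[OF sym_blocks(1)[OF Ssym]] by blast
  then obtain V1 A where A: "\<And>t. 0 < t \<Longrightarrow> eigendecomposition p (upper_left p p (?S t)) (V1 t) (mat_diag p (A t))"
    by metis
  have "\<forall>t. \<exists>V m. 0 < t \<longrightarrow> eigendecomposition q (lower_right p p (?S t)) V (mat_diag q m)"
    using eigendecomposition_exists[OF sym_blocks(2)[OF Ssym]] by blast
  then obtain V2 B where B: "\<And>t. 0 < t \<Longrightarrow> eigendecomposition q (lower_right p p (?S t)) (V2 t) (mat_diag q (B t))"
    by metis
  define K1 where "K1 = U1\<^sup>T * upper_left p p Hlim * U1"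
  define K2 where "K2 = U2\<^sup>T * lower_right p p Hlim * U2"
  have H1: "mat_tendsto p p (\<lambda>t. upper_left p p (H t)) (upper_left p p Hlim) ?F"
    by (rule mat_tendstoI) (auto intro!: always_eventually carrier_matI assms(12))
  have H2: "mat_tendsto q q (\<lambda>t. lower_right p p (H t)) (lower_right p p Hlim) ?F"
  proof (rule mat_tendstoI)
    show "\<forall>\<^sub>F t in ?F. lower_right p p (H t) \<in> carrier_mat q q"
      using pos
    proof eventually_elim
      case (elim t)
      then show ?case using carrier_matD[OF cH[OF elim]] by (intro carrier_matI) simp_all
    qed
    fix i j assume ij: "i < q" "j < q"
    have "\<forall>\<^sub>F t in ?F. H t $$ (i + p, j + p) = lower_right p p (H t) $$ (i, j)"
      using pos
    proof eventually_elim
      case (elim t)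
      then show ?case using cH[OF elim] ij by simp
    qed
    moreover have "((\<lambda>t. H t $$ (i + p, j + p)) \<longlongrightarrow> Hlim $$ (i + p, j + p)) ?F"
      using ij by (intro assms(12)) auto
    ultimately show "((\<lambda>t. lower_right p p (H t) $$ (i, j)) \<longlongrightarrow> lower_right p p Hlim $$ (i, j)) ?F"
      using cK ij by (simp add: Lim_transform_eventually)
  qed (use cK in \<open>auto intro!: carrier_matI\<close>)
  have dA: "((\<lambda>t. (A t k - a k) / t) \<longlongrightarrow> K1 $$ (k, k)) ?F" if "k < p" for k
    unfolding K1_def
    by (rule simple_eigenvalue_derivative[OF e1 _ H1 _ that])
      (use eigenvalues_distinct[OF e1] assms(4,6) A ul in auto)
  have dB: "((\<lambda>t. (B t k - b k) / t) \<longlongrightarrow> K2 $$ (k, k)) ?F" if "k < q" for k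
    unfolding K2_def
    by (rule simple_eigenvalue_derivative[OF e2 _ H2 _ that])
      (use eigenvalues_distinct[OF e2] assms(5,7) B lr in auto)

  define G where "G = aligned_fidelity p q a b"
  define g' where "g' = mat_trace (Upsilon2 p q U1 L1 U2 L2 * Hlim)"
  define f' where "f' = mat_trace ((diag_part p (J_mat p S) + mat_inv (J_mat p S)) * Hlim) / 2"
  have dG: "((\<lambda>t. (aligned_fidelity p q (A t) (B t) - G) / t) \<longlongrightarrow> g') ?F"
  proof -
    let ?s = "\<lambda>k. sqrt ((if k < p then (a k)\<^sup>2 else 0) + (b k)\<^sup>2)"
    have "g' = (\<Sum>k<p. a k / ?s k * K1 $$ (k, k)) + (\<Sum>k<q. b k / ?s k * K2 $$ (k, k))"
      unfolding g'_def L1 L2 K1_def K2_def by (rule Upsilon2_trace(1)[OF U cK pq]) (fact a b)+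
    moreover have "((\<lambda>t. (aligned_fidelity p q (A t) (B t) - G) / t)
        \<longlongrightarrow> (\<Sum>k<p. a k / ?s k * K1 $$ (k, k)) + (\<Sum>k<q. b k / ?s k * K2 $$ (k, k))) ?F"
      unfolding G_def by (rule aligned_fidelity_derivative[OF pq]) (fact b dA dB)+
    ultimately show ?thesis by simp
  qed
  have df: "((\<lambda>t. (fidelity p (?S t) - fidelity p S) / t) \<longlongrightarrow> f') ?F"
    unfolding f'_def by (rule fidelity_derivative[OF S Hsym Hlim Spd Slim])
  have dtr: "((\<lambda>t. (mat_trace (?S t) - mat_trace S) / t) \<longlongrightarrow> mat_trace Hlim) ?F"
  proof (rule Lim_transform_eventually[OF mat_tendsto_trace[OF Hlim]])
    show "\<forall>\<^sub>F t in ?F. mat_trace (H t) = (mat_trace (?S t) - mat_trace S) / t"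
      using pos
    proof eventually_elim
      case (elim t)
      then show ?case using cS cH[OF elim] by (simp add: trace_dim)
    qed
  qed
  have trS: "mat_trace S = (\<Sum>i<p. a i) + (\<Sum>i<q. b i)"
    using trace_blocks[OF cS] eigenvalues_trace[OF e1] eigenvalues_trace[OF e2] by simp
  have c_pos: "0 < mat_trace S - G"
    using aligned_fidelity_less[OF assms(1) pq a b] by (simp add: trS G_def)
  have D2: "D2_coeff p q S = (mat_trace S - fidelity p S) / (mat_trace S - G)"
    unfolding G_def by (rule D2_coeff_eq[OF S pq e1 e2])
  have diff: "((\<lambda>t. ((X t - Y t) - (x - y)) / t) \<longlongrightarrow> x' - y') ?F"
    if "((\<lambda>t. (X t - x) / t) \<longlongrightarrow> x') ?F" "((\<lambda>t. (Y t - y) / t) \<longlongrightarrow> y') ?F"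
    for X Y :: "real \<Rightarrow> real" and x y x' y'
  proof -
    have "((X t - Y t) - (x - y)) / t = (X t - x) / t - (Y t - y) / t" for t
      unfolding diff_divide_distrib[symmetric] by (simp add: algebra_simps)
    then show ?thesis using tendsto_diff[OF that] by simp
  qed
  have "((\<lambda>t. ((mat_trace (?S t) - fidelity p (?S t)) / (mat_trace (?S t) - aligned_fidelity p q (A t) (B t))
        - (mat_trace S - fidelity p S) / (mat_trace S - G)) / t)
      \<longlongrightarrow> ((mat_trace Hlim - f') - (mat_trace S - fidelity p S) / (mat_trace S - G) * (mat_trace Hlim - g'))
        / (mat_trace S - G)) ?F"
    by (rule quotient_divide[OF diff[OF dtr df] diff[OF dtr dG]]) (use c_pos in simp)
  moreover have "\<forall>\<^sub>F t in ?F. ((mat_trace (?S t) - fidelity p (?S t)) / (mat_trace (?S t) - aligned_fidelity p q (A t) (B t))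
        - (mat_trace S - fidelity p S) / (mat_trace S - G)) / t = (D2_coeff p q (?S t) - D2_coeff p q S) / t"
    using pos Spd
  proof eventually_elim
    case (elim t)
    show ?case
      using D2_coeff_eq[OF elim(2) pq A[OF elim(1)] B[OF elim(1)]] by (simp only: D2)
  qed
  ultimately have lim: "((\<lambda>t. (D2_coeff p q (?S t) - D2_coeff p q S) / t)
      \<longlongrightarrow> ((mat_trace Hlim - f') - D2_coeff p q S * (mat_trace Hlim - g')) / (mat_trace S - G)) ?F"
    unfolding D2 by (rule Lim_transform_eventually)

  have c2: "c2 p q S U1 L1 U2 L2 = mat_trace S - G"
    using Sigma_m_fidelity(3)[OF S pq e1 a e2 b] by (simp add: c2_def L1 L2 G_def)
  have cJ: "J_mat p S \<in> carrier_mat ?n ?n" "mat_inv (J_mat p S) \<in> carrier_mat ?n ?n"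
    using pd_matsD[OF J_mat_pd[OF S]] pd_matsD[OF pd_inv[OF J_mat_pd[OF S]]] by (auto intro!: carrier_matI)
  have cU: "Upsilon2 p q U1 L1 U2 L2 \<in> carrier_mat ?n ?n"
    unfolding L1 L2 by (rule Upsilon2_trace(2)[OF U cK pq a b])
  have "mat_trace (M2 p q S U1 L1 U2 L2 * Hlim)
      = 1 / (mat_trace S - G) * (- f' + (1 - D2_coeff p q S) * mat_trace Hlim + D2_coeff p q S * g')"
    using cJ cU cK diag_part_dims[OF cJ(1)]
    by (simp add: M2_def c2 f'_def g'_def smult_mult_dim add_mult_dim trace_dim)
  also have "\<dots> = ((mat_trace Hlim - f') - D2_coeff p q S * (mat_trace Hlim - g')) / (mat_trace S - G)"
    unfolding times_divide_eq_left mult_1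
    by (rule arg_cong[of _ _ "\<lambda>x. x / (mat_trace S - G)"]) (simp add: algebra_simps)
  finally show ?thesis using lim by simp
qed

end
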